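(* Let $\mathscr{H}=\mathcal{C}\boxtimes\mathcal{H}$ be a pre-foliation on $\mathbb{P}^2_{\mathbb{C}}$ of degree $d\ge1$ and co-degree $k<d$ which is homogeneous and convex. Then its dual web $\mathrm{Leg}\,\mathscr{H}$ is flat, i.e. its curvature $K(\mathrm{Leg}\,\mathscr{H})$ vanishes identically.
   Context: **Pre-foliations.** Let $0\le k\le d$ be integers. A (holomorphic) pre-foliation $\mathscr{F}=\mathcal{C}\boxtimes\mathcal{F}$ on $\mathbb{P}^2_{\mathbb{C}}$ of co-degree $k$ and degree $d$ (of type $(k,d)$) is the data of a reduced complex projective curve $\mathcal{C}\subset\mathbb{P}^2_{\mathbb{C}}$ of degree $k$ (the associated curve) and a holomorphic foliation $\mathcal{F}$ (with isolated singularities) on $\mathbb{P}^2_{\mathbb{C}}$ of degree $d-k$ (the associated foliation). **Convexity.** A holomorphic foliation on $\mathbb{P}^2_{\mathbb{C}}$ is convex if its leaves which are not straight lines have no inflection points. A pre-foliation $\mathcal{C}\boxtimes\mathcal{F}$ is convex if $\mathcal{F}$ is convex and $\mathcal{C}$ is invariant by $\mathcal{F}$. **Homogeneity.** A pre-foliation (in particular a foliation, the case $k=0$) on $\mathbb{P}^2_{\mathbb{C}}$ is homogeneous if there is an affine chart $(x,y)$ of $\mathbb{P}^2_{\mathbb{C}}$ in which it is invariant under all complex homotheties $(x,y)\mapsto\lambda(x,y)$, $\lambda\in\mathbb{C}^*$. A homogeneous pre-foliation of type $(k,d)$ is then of the form $\mathcal{C}\boxtimes\mathcal{H}$ with $\mathcal{H}$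 a homogeneous foliation of degree $d-k$ and $\mathcal{C}$ consisting either of $k$ lines through the origin $O$ of the chart, or of the line at infinity $L_\infty$ and $k-1$ lines through $O$. **Webs.** A regular $d$-web of $(\mathbb{C}^2,0)$ is a family $\{\mathcal{F}_1,\dots,\mathcal{F}_d\}$ of germs of regular holomorphic foliations pairwise transverse at the origin, written $\mathcal{F}_1\boxtimes\cdots\boxtimes\mathcal{F}_d$. A $d$-web on a complex surface $M$ is given in local coordinates $(x,y)$ by an implicit differential equation $F(x,y,y')=0$, where $F(x,y,p)=\sum_{i=0}^d a_i(x,y)p^{d-i}$ is a reduced polynomial in $p$ of degree $d$ with analytic coefficients, $a_0\not\equiv0$; near every point where $a_0\Delta\ne0$ ($\Delta$ the $p$-discriminant of $F$) its integral curves form a regular $d$-web. The product $\boxtimes$ denotes superposition of webs without common component. **Dual web (Legendre transform).** Let $\mathscr{F}=\mathcal{C}\boxtimes\mathcal{F}$ be a pre-foliation of degree $d\ge1$ and co-degree $k<d$, given in an affine chart $(x,y)$ by $\omega=f(x,y)(A(x,y)\,dx+B(x,y)\,dy)$, with $f,A,B\in\mathbb{C}[x,y]$, $\gcd(A,B)=1$, where $f=0$ defines $\mathcal{C}$ and $A\,dx+B\,dy$ defines $\mathcal{F}$. In the affine chart $(p,q)$ of the dual plane $\check{\mathbb{P}}^2_{\mathbb{C}}$ corresponding to the line $\{y=px-q\}\subset\mathbb{P}^2_{\mathbb{C}}$, $\mathrm{Leg}\,\mathscr{F}$ is the $d$-web given by $f(x,px-q)\,(A(x,px-q)+pB(x,px-q))=0$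 with $x=\frac{dq}{dp}$. Thus $\mathrm{Leg}\,\mathscr{F}=\mathrm{Leg}\,\mathcal{C}\boxtimes\mathrm{Leg}\,\mathcal{F}$ for $k\ge1$. For a line $\ell$, $\mathrm{Leg}\,\ell$ is the radial foliation of $\check{\mathbb{P}}^2_{\mathbb{C}}$ whose leaves are the lines through the point dual to $\ell$ (for the line at infinity $L_\infty$ of the chart it is given by $dp=0$). **Curvature and flatness.** For a completely decomposable 3-web $\mathcal{W}=\mathcal{F}_1\boxtimes\mathcal{F}_2\boxtimes\mathcal{F}_3$ choose 1-forms $\omega_i$ defining $\mathcal{F}_i$ with $\omega_1+\omega_2+\omega_3=0$; there is a meromorphic 1-form $\eta(\mathcal{W})$, well defined up to addition of $dg/g$ with $g$ a holomorphic unit, with $d\omega_i=\eta(\mathcal{W})\wedge\omega_i$ for $i=1,2,3$; set $K(\mathcal{W})=d\eta(\mathcal{W})$. For a completely decomposable $d$-web with $d>3$, $K(\mathcal{W})$ is the sum of the curvatures of its 3-subwebs. For a general $d$-web on a surface $M$, $K(\mathcal{W})$ is the global meromorphic 2-form on $M$ (poles along the discriminant) obtained by passing to a ramified Galois covering where the web decomposes completely and descending; near generic points it is given by the preceding local definition. For $d\le 2$ the curvature is $0$ (empty sum). A web is flat if its curvature is identically zero. *)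

theory Defs
  imports
    "HOL-Analysis.Analysis"
    "HOL-Computational_Algebra.Squarefree"
    "HOL-Complex_Analysis.Complex_Analysis"
begin

section \<open>Ternary forms\<close>

text \<open>
  A polynomial in the homogeneous coordinates \<open>X\<^sub>1, X\<^sub>2, X\<^sub>3\<close> is an element of
  \<open>\<complex>[X\<^sub>3][X\<^sub>2][X\<^sub>1]\<close>: the outermost variable is \<open>X\<^sub>1\<close>.  Points of the projective plane are
  represented by nonzero vectors of \<open>\<complex>\<^sup>3\<close>.
\<close>

type_synonym poly3 = "complex poly poly poly"

definition eval3 :: "poly3 \<Rightarrow> complex^3 \<Rightarrow> complex" where
  "eval3 P v = poly (poly (poly P [:[:v$1:]:]) [:v$2:]) (v$3)"

definition homogeneous3 :: "nat \<Rightarrow> poly3 \<Rightarrow> bool" where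
  "homogeneous3 m P \<longleftrightarrow> (\<forall>i j k. coeff (coeff (coeff P i) j) k \<noteq> 0 \<longrightarrow> i + j + k = m)"


section \<open>Pre-foliations on the projective plane\<close>

text \<open>
  The vector \<open>W\<close> stands for the 1-form \<open>W\<^sub>1 dX\<^sub>1 + W\<^sub>2 dX\<^sub>2 + W\<^sub>3 dX\<^sub>3\<close> on \<open>\<complex>\<^sup>3\<close>.
\<close>

definition form_at :: "poly3^3 \<Rightarrow> complex^3 \<Rightarrow> complex^3" where
  "form_at W v = (\<chi> i. eval3 (W$i) v)"

text \<open>
  A foliation of degree \<open>n\<close> (\<open>n\<close> tangencies with a generic line) is given by a form whose
  coefficients are homogeneous of degree \<open>n + 1\<close> and which is annihilated by the radial vector
  field.  The singularities are isolated iff the coefficients have no common factor.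
\<close>

definition foliation :: "nat \<Rightarrow> poly3^3 \<Rightarrow> bool" where
  "foliation n W \<longleftrightarrow>
     (\<forall>i. homogeneous3 (n + 1) (W$i)) \<and>
     (\<forall>v. (\<Sum>i\<in>UNIV. v$i * form_at W v $ i) = 0) \<and>
     (\<forall>h. (\<forall>i. h dvd W$i) \<longrightarrow> h dvd 1)"

definition reduced_curve :: "nat \<Rightarrow> poly3 \<Rightarrow> bool" where
  "reduced_curve k F \<longleftrightarrow> homogeneous3 k F \<and> squarefree F"

definition prefoliation :: "nat \<Rightarrow> nat \<Rightarrow> poly3 \<Rightarrow> poly3^3 \<Rightarrow> bool" where
  "prefoliation k d F W \<longleftrightarrow> k \<le> d \<and> reduced_curve k F \<and> foliation (d - k) W"


section \<open>Leaves, inflection points, convexity\<close>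

definition curve_deriv :: "(complex \<Rightarrow> complex^3) \<Rightarrow> complex \<Rightarrow> complex^3" where
  "curve_deriv \<gamma> t = (\<chi> i. deriv (\<lambda>s. \<gamma> s $ i) t)"

text \<open>
  Immersed holomorphic curves in the regular part of the foliation that are tangent to it, given
  by a lift to \<open>\<complex>\<^sup>3\<close>; linear independence of \<open>\<gamma>\<close> and \<open>\<gamma>'\<close> says that the projection to the
  projective plane is an immersion.
\<close>

definition integral_curve :: "poly3^3 \<Rightarrow> complex set \<Rightarrow> (complex \<Rightarrow> complex^3) \<Rightarrow> bool" where
  "integral_curve W D \<gamma> \<longleftrightarrow>
     open D \<and> connected D \<and> (\<forall>i. (\<lambda>t. \<gamma> t $ i) holomorphic_on D) \<and>
     (\<forall>t\<in>D. form_at W (\<gamma> t) \<noteq> 0 \<and>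
            (\<forall>a b. a *s \<gamma> t + b *s curve_deriv \<gamma> t = 0 \<longrightarrow> a = 0 \<and> b = 0) \<and>
            (\<Sum>i\<in>UNIV. form_at W (\<gamma> t) $ i * curve_deriv \<gamma> t $ i) = 0)"

definition same_point :: "complex^3 \<Rightarrow> complex^3 \<Rightarrow> bool" where
  "same_point v w \<longleftrightarrow> (\<exists>c. c \<noteq> 0 \<and> w = c *s v)"

definition nonsingular_at :: "poly3^3 \<Rightarrow> complex^3 \<Rightarrow> bool" where
  "nonsingular_at W v \<longleftrightarrow> v \<noteq> 0 \<and> form_at W v \<noteq> 0"

definition joined :: "poly3^3 \<Rightarrow> complex^3 \<Rightarrow> complex^3 \<Rightarrow> bool" where
  "joined W v w \<longleftrightarrow>
     (\<exists>D \<gamma> s t. integral_curve W D \<gamma> \<and> s \<in> D \<and> t \<in> D \<and> same_point (\<gamma> s) v \<and> same_point (\<gamma> t) w)"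

text \<open>The leaf through the nonsingular point \<open>v\<close>, as a cone in \<open>\<complex>\<^sup>3\<close>.\<close>

definition leaf :: "poly3^3 \<Rightarrow> complex^3 \<Rightarrow> (complex^3) set" where
  "leaf W v = {w. (joined W)\<^sup>*\<^sup>* v w}"

definition in_straight_line :: "(complex^3) set \<Rightarrow> bool" where
  "in_straight_line L \<longleftrightarrow> (\<exists>l::complex^3. l \<noteq> 0 \<and> (\<forall>w\<in>L. (\<Sum>i\<in>UNIV. l$i * w$i) = 0))"

text \<open>
  \<open>v\<close> is an inflection point of the leaf through it: the tangent line has contact of order at
  least 3 with the leaf at \<open>v\<close>.  For a lift \<open>\<gamma>\<close> this means \<open>det(\<gamma>, \<gamma>', \<gamma>'') = 0\<close>, a condition
  that depends neither on the lift nor on the parametrization.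
\<close>

definition inflection_point :: "poly3^3 \<Rightarrow> complex^3 \<Rightarrow> bool" where
  "inflection_point W v \<longleftrightarrow>
     (\<exists>D \<gamma> t. integral_curve W D \<gamma> \<and> t \<in> D \<and> same_point (\<gamma> t) v \<and>
        det (vector [\<gamma> t, curve_deriv \<gamma> t, curve_deriv (curve_deriv \<gamma>) t] :: complex^3^3) = 0)"

definition convex_foliation :: "poly3^3 \<Rightarrow> bool" where
  "convex_foliation W \<longleftrightarrow>
     (\<forall>v. nonsingular_at W v \<and> \<not> in_straight_line (leaf W v) \<longrightarrow>
          (\<forall>w\<in>leaf W v. \<not> inflection_point W w))"

definition invariant_curve :: "poly3^3 \<Rightarrow> poly3 \<Rightarrow> bool" where
  "invariant_curve W F \<longleftrightarrow>
     (\<forall>v. nonsingular_at W v \<and> eval3 F v = 0 \<longrightarrow> (\<forall>w\<in>leaf W v. eval3 F w = 0))"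

definition convex_prefoliation :: "poly3 \<Rightarrow> poly3^3 \<Rightarrow> bool" where
  "convex_prefoliation F W \<longleftrightarrow> convex_foliation W \<and> invariant_curve W F"


section \<open>Affine charts and homogeneity\<close>

text \<open>
  An invertible matrix \<open>M\<close> gives the affine chart \<open>(x, y) \<mapsto> [M(x, y, 1)]\<close>; its line at infinity is
  the image of \<open>X\<^sub>3 = 0\<close>.  \<open>pullback M W\<close> gives the coefficients of \<open>M\<^sup>*W\<close>.
\<close>

definition pullback :: "complex^3^3 \<Rightarrow> poly3^3 \<Rightarrow> complex^3 \<Rightarrow> complex^3" where
  "pullback M W v = transpose M *v form_at W (M *v v)"

definition homothety :: "complex \<Rightarrow> complex^3^3" where
  "homothety c = vector [vector [c, 0, 0], vector [0, c, 0], vector [0, 0, 1]]"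

text \<open>
  Two square-free forms define the same curve, and two coprime 1-forms the same foliation, iff they
  agree up to a nonzero constant.
\<close>

definition homogeneous_prefoliation :: "poly3 \<Rightarrow> poly3^3 \<Rightarrow> bool" where
  "homogeneous_prefoliation F W \<longleftrightarrow>
     (\<exists>M::complex^3^3. invertible M \<and>
       (\<forall>c. c \<noteq> 0 \<longrightarrow>
         (\<exists>a. a \<noteq> 0 \<and> (\<forall>v. eval3 F ((M ** homothety c) *v v) = a * eval3 F (M *v v))) \<and>
         (\<exists>b. b \<noteq> 0 \<and> (\<forall>v. pullback (M ** homothety c) W v = b *s pullback M W v))))"


section \<open>Webs on open sets of the complex plane\<close>

text \<open>
  Functions and 1-forms of two complex variables \<open>(p, q)\<close>; the pair \<open>(\<alpha>, \<beta>)\<close> is the form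
  \<open>\<alpha> dp + \<beta> dq\<close>, and 2-forms are identified with their coefficient on \<open>dp \<and> dq\<close>.
\<close>

type_synonym form1 = "complex \<times> complex \<Rightarrow> complex \<times> complex"

definition holomorphic2 :: "(complex \<times> complex) set \<Rightarrow> (complex \<times> complex \<Rightarrow> complex) \<Rightarrow> bool" where
  "holomorphic2 U f \<longleftrightarrow>
     open U \<and> (\<forall>z\<in>U. \<exists>a b. (f has_derivative (\<lambda>h. a * fst h + b * snd h)) (at z))"

definition holomorphic_form :: "(complex \<times> complex) set \<Rightarrow> form1 \<Rightarrow> bool" where
  "holomorphic_form U \<omega> \<longleftrightarrow> holomorphic2 U (\<lambda>z. fst (\<omega> z)) \<and> holomorphic2 U (\<lambda>z. snd (\<omega> z))"

definition wedge :: "complex \<times> complex \<Rightarrow> complex \<times> complex \<Rightarrow> complex" where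
  "wedge a b = fst a * snd b - snd a * fst b"

definition ext_deriv :: "form1 \<Rightarrow> complex \<times> complex \<Rightarrow> complex" where
  "ext_deriv \<omega> z =
     deriv (\<lambda>p. snd (\<omega> (p, snd z))) (fst z) - deriv (\<lambda>q. fst (\<omega> (fst z, q))) (snd z)"

text \<open>
  An implicit \<open>d\<close>-web is given by \<open>\<Phi> (p, q) x = 0\<close> with \<open>x = dq/dp\<close>, where \<open>\<Phi> (p, q)\<close> is a polynomial
  function of \<open>x\<close> of degree at most \<open>d\<close>, read as the dehomogenization at \<open>dp = 1\<close> of a binary form of
  degree \<open>d\<close> in \<open>(dp, dq)\<close>: a drop of the degree below \<open>d\<close> accounts for the direction \<open>dp = 0\<close>.
  On \<open>U\<close> it is the regular web of the \<open>d\<close> pairwise transverse foliations \<open>\<theta> i = 0\<close> if this form is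
  the product of the \<open>\<theta> i\<close>; note that \<open>\<theta> i\<close> takes the value \<open>\<alpha> + \<beta> x\<close> on the vector \<open>(1, x)\<close>.
\<close>

definition decomposes ::
    "nat \<Rightarrow> (complex \<times> complex \<Rightarrow> complex \<Rightarrow> complex) \<Rightarrow> (complex \<times> complex) set \<Rightarrow> (nat \<Rightarrow> form1) \<Rightarrow> bool"
  where
  "decomposes d \<Phi> U \<theta> \<longleftrightarrow>
     open U \<and> (\<forall>i<d. holomorphic_form U (\<theta> i)) \<and>
     (\<forall>z\<in>U. \<forall>i<d. \<theta> i z \<noteq> 0) \<and>
     (\<forall>z\<in>U. \<forall>i<d. \<forall>j<d. i \<noteq> j \<longrightarrow> wedge (\<theta> i z) (\<theta> j z) \<noteq> 0) \<and>
     (\<forall>z\<in>U. \<forall>x. \<Phi> z x = (\<Prod>i<d. fst (\<theta> i z) + snd (\<theta> i z) * x))"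

definition defines_same_foliation :: "(complex \<times> complex) set \<Rightarrow> form1 \<Rightarrow> form1 \<Rightarrow> bool" where
  "defines_same_foliation U \<omega> \<theta> \<longleftrightarrow>
     holomorphic_form U \<omega> \<and> (\<forall>z\<in>U. \<omega> z \<noteq> 0 \<and> wedge (\<omega> z) (\<theta> z) = 0)"

definition web3_connection ::
    "(complex \<times> complex) set \<Rightarrow> form1 \<Rightarrow> form1 \<Rightarrow> form1 \<Rightarrow> form1 \<Rightarrow> bool" where
  "web3_connection U \<theta>1 \<theta>2 \<theta>3 \<eta> \<longleftrightarrow>
     holomorphic_form U \<eta> \<and>
     (\<exists>\<omega>1 \<omega>2 \<omega>3.
        defines_same_foliation U \<omega>1 \<theta>1 \<and> defines_same_foliation U \<omega>2 \<theta>2 \<and>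
        defines_same_foliation U \<omega>3 \<theta>3 \<and>
        (\<forall>z\<in>U. \<omega>1 z + \<omega>2 z + \<omega>3 z = 0 \<and>
               ext_deriv \<omega>1 z = wedge (\<eta> z) (\<omega>1 z) \<and>
               ext_deriv \<omega>2 z = wedge (\<eta> z) (\<omega>2 z) \<and>
               ext_deriv \<omega>3 z = wedge (\<eta> z) (\<omega>3 z)))"

text \<open>
  \<open>K\<close> is the value at \<open>z\<close> of the curvature, the sum of \<open>d\<eta>\<close> over all 3-subwebs of a local
  decomposition near \<open>z\<close>.  Such \<open>K\<close> is unique: another decomposition only permutes the
  foliations, and each \<open>\<eta>\<close> is determined up to adding \<open>dg/g\<close> for a unit \<open>g\<close>.
\<close>

definition web_curvature_at ::
    "nat \<Rightarrow> (complex \<times> complex \<Rightarrow> complex \<Rightarrow> complex) \<Rightarrow> complex \<times> complex \<Rightarrow> complex \<Rightarrow> bool" where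
  "web_curvature_at d \<Phi> z K \<longleftrightarrow>
     (\<exists>U \<theta> \<eta>. z \<in> U \<and> decomposes d \<Phi> U \<theta> \<and>
        (\<forall>i j l. i < j \<and> j < l \<and> l < d \<longrightarrow> web3_connection U (\<theta> i) (\<theta> j) (\<theta> l) (\<eta> i j l)) \<and>
        K = (\<Sum>(i, j, l)\<in>{(i, j, l). i < j \<and> j < l \<and> l < d}. ext_deriv (\<eta> i j l) z))"

definition regular_web_at ::
    "nat \<Rightarrow> (complex \<times> complex \<Rightarrow> complex \<Rightarrow> complex) \<Rightarrow> complex \<times> complex \<Rightarrow> bool" where
  "regular_web_at d \<Phi> z \<longleftrightarrow> (\<exists>U \<theta>. z \<in> U \<and> decomposes d \<Phi> U \<theta>)"

definition flat_web :: "nat \<Rightarrow> (complex \<times> complex \<Rightarrow> complex \<Rightarrow> complex) \<Rightarrow> bool" where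
  "flat_web d \<Phi> \<longleftrightarrow> (\<forall>z. regular_web_at d \<Phi> z \<longrightarrow> web_curvature_at d \<Phi> z 0)"


section \<open>The dual web\<close>

text \<open>
  In the chart \<open>M\<close> the pre-foliation is given by \<open>f (A dx + B dy)\<close>, where \<open>f\<close>, \<open>A\<close>, \<open>B\<close> at \<open>(x, y)\<close>
  are \<open>F\<close> and the first two coefficients of \<open>M\<^sup>*W\<close> at \<open>(x, y, 1)\<close>.  The point \<open>(p, q)\<close> of the dual
  plane is the line \<open>y = p x - q\<close>.  If the line at infinity of the chart is a component of the curve,
  then \<open>f\<close> has degree \<open>k - 1\<close>, and the missing degree in \<open>x\<close> is the component \<open>dp = 0\<close>.
\<close>

definition Leg :: "complex^3^3 \<Rightarrow> poly3 \<Rightarrow> poly3^3 \<Rightarrow> complex \<times> complex \<Rightarrow> complex \<Rightarrow> complex" where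
  "Leg M F W = (\<lambda>(p, q) x.
     let X = vector [x, p * x - q, 1]
     in eval3 F (M *v X) * (pullback M W X $ 1 + p * pullback M W X $ 2))"

text \<open>
  The charts \<open>(p, q)\<close> coming from all affine charts cover the dual plane, so the curvature of the
  dual web vanishes iff it does so in each of them.
\<close>

definition flat_dual_web :: "nat \<Rightarrow> poly3 \<Rightarrow> poly3^3 \<Rightarrow> bool" where
  "flat_dual_web d F W \<longleftrightarrow> (\<forall>M::complex^3^3. invertible M \<longrightarrow> flat_web d (Leg M F W))"

end

theory Submission
  imports Defs "HOL-Computational_Algebra.Fundamental_Theorem_Algebra"
begin

text \<open>
  In a homogeneous chart let \<open>\<mu>\<^sub>1, \<mu>\<^sub>2\<close> be affine coordinates of the dual plane centred at the line at
  infinity.  The dual web is \<open>d\<mu>\<^sub>1 + t\<^sub>i d\<mu>\<^sub>2 = 0\<close>, where the slopes \<open>t\<^sub>i\<close> depend only on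
  \<open>p = - \<mu>\<^sub>1 / \<mu>\<^sub>2\<close>: they are the preimages of \<open>p\<close> under the Gauss map \<open>G = - a / b\<close>, the constant
  slopes of the invariant lines through the origin and, for the line at infinity, \<open>p\<close> itself.
  For three slopes one finds \<open>\<eta> = \<alpha>(p) dp - \<beta>(p) d\<mu>\<^sub>2 / \<mu>\<^sub>2\<close> with
  \<open>\<beta> = - \<Sum> t\<^sub>1' (p - t\<^sub>2) (p - t\<^sub>3) / ((t\<^sub>1 - t\<^sub>2) (t\<^sub>1 - t\<^sub>3))\<close>, the sum being cyclic, so the web is flat as soon as the sum of
  the \<open>\<beta>\<close> over all triples is constant.

  This sum is the trace under \<open>G\<close> of a rational 1-form \<open>\<kappa>\<close>.  Convexity means that the critical points
  of \<open>G\<close> and the slopes of the curve are fixed points of \<open>G\<close>; there \<open>p - t\<close> vanishes and compensates the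
  poles, so that \<open>b\<^sup>2 \<kappa>\<close> is a polynomial of degree at most \<open>2 n - 2\<close>.  The residue theorem then shows that
  the trace takes the same value at any two \<open>p\<close>.
\<close>

section \<open>The trace of the slopes\<close>

text \<open>As \<open>\<alpha>(p) dp\<close> is closed, \<open>d\<eta> = - \<beta>'(p) dp \<and>
  d\<mu>\<^sub>2 / \<mu>\<^sub>2\<close>, so only \<open>\<beta>\<close> matters. Here
  \<open>- \<beta>\<close> is the value at \<open>p\<close> of the quadratic that takes the
  derivatives of the three slopes as its values at the slopes. Summed over all triples, the Lagrange
  weights regroup, for each slope \<open>t\<close>, into one symmetric function of the numbers
  \<open>(p - s) / (t - s)\<close>, and this is read off from the first three derivatives of
  \<open>(a + p b) f\<close> at \<open>t\<close>. Eliminating \<open>p = - a / b\<close> leaves a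
  rational function of \<open>t\<close> alone, which is why the sum is a trace. Slopes of fixed
  lines have derivative 0 and occur only inside the symmetric functions; the line at infinity adds a
  constant. The obstacle is the slope coordinate \<open>y / x\<close>, which misses one direction.
  The degree bound needs this direction to be neither fixed nor critical for \<open>G\<close>, and
  the local formulas need it to avoid the slopes at the given point. Flatness is checked point by
  point, so the coordinate is chosen anew for each point and constants from different choices are
  never compared.\<close>

lemma prod_linear_degree:
  fixes S :: "complex set"
  assumes "finite S"
  shows "degree (\<Prod>s\<in>S. [:-s, 1:]) = card S" "lead_coeff (\<Prod>s\<in>S. [:-s, 1:]) = 1"
proof -
  show "degree (\<Prod>s\<in>S. [:-s, 1:]) = card S"
    by (subst degree_prod_eq_sum_degree) auto
  show "lead_coeff (\<Prod>s\<in>S. [:-s, 1:]) = 1"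
    by (subst lead_coeff_prod) auto
qed

text \<open>The sum is the coefficient of degree \<open>card S - 1\<close> in the Lagrange
  interpolant of \<open>P\<close> on \<open>S\<close>. That interpolant is \<open>P\<close> itself,
  whose degree is smaller.\<close>

lemma sum_residues_eq_0:
  fixes S :: "complex set"
  assumes S: "finite S" and deg: "degree P + 2 \<le> card S"
  shows "(\<Sum>r\<in>S. poly P r / (\<Prod>s\<in>S-{r}. r - s)) = 0"
proof -
  define w where "w r = poly P r / (\<Prod>s\<in>S-{r}. r - s)" for r
  define q where "q r = (\<Prod>s\<in>S-{r}. [:-s, 1:])" for r
  define L where "L = (\<Sum>r\<in>S. smult (w r) (q r))"
  have dq: "degree (q r) = card S - 1" "lead_coeff (q r) = 1" if "r \<in> S" for r
    using prod_linear_degree[of "S - {r}"] S that by (auto simp: q_def)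
  have "degree L \<le> card S - 1"
    unfolding L_def using dq by (intro degree_sum_le S) (metis degree_smult_le)
  moreover have "poly L x = poly P x" if x: "x \<in> S" for x
  proof -
    have "poly L x = (\<Sum>r\<in>S. w r * poly (q r) x)"
      by (simp add: L_def poly_sum)
    also have "\<dots> = w x * poly (q x) x"
      using S x by (subst sum.remove[OF S x], subst sum.neutral)
        (auto simp: q_def poly_prod intro!: prod_zero)
    also have "\<dots> = poly P x"
      using S by (simp add: w_def q_def poly_prod)
    finally show ?thesis .
  qed
  ultimately have "L = P"
    using deg by (intro poly_eqI_degree[of S]) auto
  have "(\<Sum>r\<in>S. w r) = (\<Sum>r\<in>S. w r * coeff (q r) (card S - 1))"
    using dq by (intro sum.cong) auto
  also have "\<dots> = coeff L (card S - 1)"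
    by (simp add: L_def coeff_sum)
  also have "\<dots> = 0"
    unfolding \<open>L = P\<close> using deg by (intro coeff_eq_0) auto
  finally show ?thesis by (simp add: w_def)
qed

text \<open>Logarithmic differentiation: \<open>q' / q\<close> is the sum of the
  \<open>1 / (t - s)\<close>, whose derivative is minus the sum of their squares.\<close>

lemma pderiv_prod_linear:
  fixes S :: "complex set"
  assumes "finite S" "t \<notin> S"
  defines "q \<equiv> (\<Prod>s\<in>S. [:-s, 1:])"
  shows "poly (pderiv q) t = poly q t * (\<Sum>s\<in>S. 1 / (t - s)) \<and>
         poly (pderiv (pderiv q)) t =
           poly q t * ((\<Sum>s\<in>S. 1 / (t - s))\<^sup>2 - (\<Sum>s\<in>S. 1 / (t - s)^2))"
  using assms(1,2) unfolding q_def
proof (induction S)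
  case (insert x F)
  have nz: "t - x \<noteq> 0" "t \<notin> F" using insert.prems by auto
  note IH = insert.IH[OF nz(2), THEN conjunct1] insert.IH[OF nz(2), THEN conjunct2]
  have 1: "poly (pderiv (\<Prod>s\<in>insert x F. [:-s, 1:])) t
      = poly (\<Prod>s\<in>insert x F. [:-s, 1:]) t * (\<Sum>s\<in>insert x F. 1 / (t - s))"
    using insert.hyps nz(1) IH(1)
    by (simp add: pderiv_mult pderiv_pCons del: mult_pCons_left mult_pCons_right)
      (simp add: field_simps)
  have 2: "poly (pderiv (pderiv (\<Prod>s\<in>insert x F. [:-s, 1:]))) t
      = poly (\<Prod>s\<in>insert x F. [:-s, 1:]) t *
        ((\<Sum>s\<in>insert x F. 1 / (t - s))\<^sup>2 - (\<Sum>s\<in>insert x F. 1 / (t - s)^2))"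
  proof -
    define q a r u where "q = poly (\<Prod>s\<in>F. [:-s, 1:]) t" and "a = (\<Sum>s\<in>F. 1 / (t - s))"
      and "r = (\<Sum>s\<in>F. 1 / (t - s)^2)" and "u = 1 / (t - x)"
    have u: "(t - x) * u = 1" using nz by (simp add: u_def)
    have "2 * (q * a) + (t - x) * (q * (a^2 - r)) = (t - x) * q * ((u + a)^2 - (u^2 + r))"
      using u by algebra
    then show ?thesis
      using insert.hyps IH
      by (simp add: pderiv_mult pderiv_pCons pderiv_add q_def a_def r_def u_def power_one_over
          del: mult_pCons_left mult_pCons_right)
  qed
  from 1 2 show ?case by blast
qed auto

section \<open>Divisibility and degree of the numerator of the trace\<close>

lemma order_linear_root: "order x [:-c, 1::complex:] = (if x = c then 1 else 0)"
  using order_power_n_n[of c 1] by (cases "x = c") (simp_all add: order_0I)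

text \<open>Over the complex numbers divisibility can be tested root by root. The induction strips
  one factor \<open>x - c\<close> from both polynomials, which lowers the order at \<open>c\<close>
  and leaves the other orders unchanged.\<close>

lemma dvd_of_order_le:
  fixes p q :: "complex poly"
  assumes "p \<noteq> 0" "\<And>c. poly p c = 0 \<Longrightarrow> [:-c, 1:] ^ order c p dvd q"
  shows "p dvd q"
  using assms
proof (induction "degree p" arbitrary: p q)
  case 0
  then have "is_unit p" by (simp add: is_unit_iff_degree)
  then show ?case by (rule unit_imp_dvd)
next
  case (Suc n)
  then obtain c where c: "poly p c = 0"
    using alg_closed_imp_poly_has_root[of p] by (metis zero_less_Suc)
  then obtain p' where p': "p = [:-c, 1:] * p'" by (meson poly_eq_0_iff_dvd dvd_def)
  have "p' \<noteq> 0" using Suc.prems p' by auto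
  then have dp: "degree p = Suc (degree p')" by (simp add: p' degree_mult_eq del: mult_pCons_left)
  have oc: "order c p = Suc (order c p')" and oo: "x \<noteq> c \<Longrightarrow> order x p = order x p'" for x
    using Suc.prems(1) unfolding p' by (auto simp: order_mult order_linear_root simp del: mult_pCons_left)
  have "[:-c, 1:] dvd q"
    using Suc.prems(2)[OF c] oc by (metis dvd_mult_left power_Suc)
  then obtain q' where q': "q = [:-c, 1:] * q'" by (auto elim: dvdE)
  have "p' dvd q'"
  proof (rule Suc.hyps(1))
    show "n = degree p'" "p' \<noteq> 0" using Suc.hyps(2) dp \<open>p' \<noteq> 0\<close> by auto
    fix x assume x: "poly p' x = 0"
    show "[:-x, 1:] ^ order x p' dvd q'"
    proof (cases "x = c")
      case True
      then show ?thesis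
        using Suc.prems(2)[OF c] unfolding oc q' by (auto simp del: mult_pCons_left)
    next
      case False
      have "[:-x, 1:] ^ order x p' dvd [:-c, 1:] * q'"
        using Suc.prems(2)[of x] x unfolding oo[OF False] q' by (simp add: p' del: mult_pCons_left)
      then show ?thesis
        using False unfolding order_divides
        by (cases "q' = 0") (auto simp: order_mult order_linear_root simp del: mult_pCons_left)
    qed
  qed
  then show ?case by (simp add: p' q' del: mult_pCons_left)
qed

lemma power_dvd_pderiv:
  fixes p :: "complex poly"
  assumes "[:-c, 1:] ^ m dvd p"
  shows "[:-c, 1:] ^ (m - 1) dvd pderiv p"
proof (cases m)
  case (Suc k)
  from assms obtain q where "p = [:-c, 1:] ^ Suc k * q" unfolding Suc by (auto elim: dvdE)
  then have "pderiv p = [:-c, 1:] ^ k * ([:-c, 1:] * pderiv q + smult (of_nat (Suc k)) q)"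
    by (simp add: pderiv_mult pderiv_power_Suc pderiv_pCons algebra_simps
        del: mult_pCons_left mult_pCons_right power_Suc)
      (simp add: algebra_simps one_pCons[symmetric] del: mult_pCons_left mult_pCons_right)
  then show ?thesis using Suc by simp
qed auto

text \<open>For a polynomial \<open>h\<close> regarded as a binary form of degree \<open>N\<close> in \<open>(y\<^sub>1, y\<^sub>2)\<close> at \<open>(1, x)\<close>, this is
  the derivative along \<open>y\<^sub>1\<close>, by Euler's identity.\<close>

definition deriv1 :: "nat \<Rightarrow> complex poly \<Rightarrow> complex poly" where
  "deriv1 N h = smult (of_nat N) h - pCons 0 (pderiv h)"

text \<open>In degree \<open>N\<close> both terms have the coefficient \<open>N * coeff h N\<close>,
  and they cancel.\<close>

lemma degree_deriv1:
  assumes "degree h \<le> N"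
  shows "degree (deriv1 N h) \<le> N - 1"
proof (rule degree_le, intro allI impI)
  fix i assume "N - 1 < i"
  then show "coeff (deriv1 N h) i = 0"
    using assms by (cases "i = N"; cases i)
      (auto simp: deriv1_def coeff_pderiv coeff_pCons coeff_eq_0)
qed

lemma degree_pderiv_le: "degree (h :: complex poly) \<le> N \<Longrightarrow> degree (pderiv h) \<le> N - 1"
  by (simp add: degree_pderiv)

lemma poly_deriv1_iterate:
  assumes "N \<ge> 3"
  shows "poly (deriv1 (N-2) (pderiv (pderiv h))) x =
           (of_nat N - 2) * poly (pderiv (pderiv h)) x - x * poly (pderiv (pderiv (pderiv h))) x"
    and "poly (deriv1 (N-2) (deriv1 (N-1) (pderiv h))) x =
           (of_nat N - 1) * (of_nat N - 2) * poly (pderiv h) x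
           - 2 * (of_nat N - 2) * x * poly (pderiv (pderiv h)) x
           + x^2 * poly (pderiv (pderiv (pderiv h))) x"
    and "poly (deriv1 (N-2) (deriv1 (N-1) (deriv1 N h))) x =
           of_nat N * (of_nat N - 1) * (of_nat N - 2) * poly h x
           - 3 * (of_nat N - 1) * (of_nat N - 2) * x * poly (pderiv h) x
           + 3 * (of_nat N - 2) * x^2 * poly (pderiv (pderiv h)) x
           - x^3 * poly (pderiv (pderiv (pderiv h))) x"
  using assms
  by (simp_all add: deriv1_def pderiv_diff pderiv_smult pderiv_pCons pderiv_add of_nat_diff
      algebra_simps power2_eq_square power3_eq_cube)

lemma degree_mult_le': "degree (p::complex poly) \<le> a \<Longrightarrow> degree q \<le> b \<Longrightarrow> degree (p * q) \<le> a + b"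
  using degree_mult_le[of p q] by linarith

lemma degree_power_le': "degree (p::complex poly) \<le> a \<Longrightarrow> degree (p ^ k) \<le> k * a"
  using degree_power_le[of p k] mult_le_mono1[of "degree p" a k] by (metis le_trans mult.commute)

text \<open>Divided by \<open>b^2\<close> this is the derivative of the Gauss map
  \<open>- a / b\<close>; for coprime \<open>a\<close> and \<open>b\<close> its roots are the
  critical points at finite slopes.\<close>

definition wron :: "complex poly \<Rightarrow> complex poly \<Rightarrow> complex poly" where
  "wron a b = a * pderiv b - pderiv a * b"

text \<open>For coprime \<open>a\<close> and \<open>b\<close> the roots are the finite fixed points
  of the Gauss map. At a root \<open>t\<close> of \<open>a + p b\<close> the value is
  \<open>(t - p) b(t)\<close>, so this polynomial stands for the factor
  \<open>p - t\<close>.\<close>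

definition tangent_cone :: "complex poly \<Rightarrow> complex poly \<Rightarrow> complex poly" where
  "tangent_cone a b = a + pCons 0 b"

text \<open>The slopes \<open>s\<close> of the web at a point of slope \<open>p\<close> are the roots of \<open>(a + p b) f\<close>.  With
  \<open>X\<^sub>i = b (a f)\<^sup>(\<^sup>i\<^sup>) - a (b f)\<^sup>(\<^sup>i\<^sup>)\<close>, this numerator divided by \<open>6 b\<^sup>2 X\<^sub>1\<close> is, at a root \<open>t\<close> of \<open>a + p b\<close>, the
  second elementary symmetric function of the \<open>(p - s) / (t - s)\<close>.\<close>

definition trace_num :: "nat \<Rightarrow> complex poly \<Rightarrow> complex poly \<Rightarrow> complex poly \<Rightarrow> complex poly" where
  "trace_num N a b f =
     (let u = a * f; v = b * f;
          X1 = b * pderiv u - a * pderiv v;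
          X2 = b * pderiv (pderiv u) - a * pderiv (pderiv v);
          X3 = b * pderiv (pderiv (pderiv u)) - a * pderiv (pderiv (pderiv v))
      in smult (3 * (of_nat N - 1) * (of_nat N - 2)) (b^2 * X1)
         - smult (3 * (of_nat N - 2)) (b * tangent_cone a b * X2) + (tangent_cone a b)^2 * X3)"

text \<open>The terms with the derivative of \<open>f\<close> cancel. Hence
  \<open>X\<^sub>1\<close>, by which \<open>trace_num\<close> has to be divisible, is up to sign
  \<open>wron a b * f\<close>.\<close>

lemma trace_den_eq: "b * pderiv (a * f) - a * pderiv (b * f) = - (wron a b * f)"
  by (simp add: wron_def pderiv_mult algebra_simps)

text \<open>Order count at a root \<open>c\<close>: if \<open>h = a + c b\<close> and
  \<open>f\<close> vanish there to the orders \<open>r \<ge> 1\<close> and \<open>\<nu>\<close>,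
  then \<open>wron a b * f\<close> has order at most \<open>r + \<nu> - 1\<close> and
  \<open>X\<^sub>i\<close> at least \<open>r + \<nu> - i\<close>. The \<open>i - 1\<close> missing
  factors come from the power of \<open>tangent_cone a b\<close> that accompanies
  \<open>X\<^sub>i\<close>; its vanishing at \<open>c\<close> is what convexity provides.\<close>

lemma trace_num_dvd:
  assumes J: "wron a b \<noteq> 0" and f: "f \<noteq> 0"
    and cop: "\<And>c. \<not> (poly a c = 0 \<and> poly b c = 0)"
    and crit: "\<And>c. poly (wron a b) c = 0 \<Longrightarrow> poly (tangent_cone a b) c = 0"
    and inv: "\<And>c. poly f c = 0 \<Longrightarrow> poly (tangent_cone a b) c = 0"
  shows "wron a b * f dvd trace_num N a b f"
proof (rule dvd_of_order_le)
  show "wron a b * f \<noteq> 0" using J f by simp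
  fix c assume "poly (wron a b * f) c = 0"
  then have C0: "poly (tangent_cone a b) c = 0" using crit inv by auto
  define l where "l = [:-c, 1:]"
  \<comment> \<open>Replacing \<open>a\<close> by \<open>h\<close> changes neither \<open>wron\<close> nor the \<open>X\<^sub>i\<close>, and \<open>h\<close> vanishes at \<open>c\<close>.\<close>
  define h where "h = a + smult c b"
  have "poly h c = 0" using C0 by (simp add: h_def tangent_cone_def)
  have bc: "poly b c \<noteq> 0" using C0 cop[of c] by (auto simp: tangent_cone_def)
  have h_eq: "wron a b = h * pderiv b - pderiv h * b"
    by (simp add: wron_def h_def pderiv_add pderiv_smult algebra_simps)
  have "h \<noteq> 0" using J by (auto simp: h_eq)
  define r where "r = order c h"
  define \<nu> where "\<nu> = order c f"
  have r: "r \<ge> 1" using \<open>h \<noteq> 0\<close> \<open>poly h c = 0\<close> by (auto simp: r_def order_root Suc_le_eq)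
  have hr: "l ^ r dvd h" unfolding l_def r_def by (rule order_1)
  have "pderiv h \<noteq> 0"
  proof
    assume "pderiv h = 0"
    then obtain e where "h = [:e:]" using pderiv_iszero by blast
    then show False using \<open>h \<noteq> 0\<close> \<open>poly h c = 0\<close> by simp
  qed
  \<comment> \<open>In \<open>h * pderiv b - pderiv h * b\<close> the first term has order at least
    \<open>r\<close> and the second exactly \<open>r - 1\<close>, because \<open>b\<close> does not
    vanish at \<open>c\<close>.\<close>
  have ord_J: "order c (wron a b) \<le> r - 1"
  proof (rule ccontr)
    assume "\<not> ?thesis"
    then have "l ^ r dvd wron a b"
      unfolding l_def order_divides using r by linarith
    moreover have "l ^ r dvd h * pderiv b" using hr by simp
    ultimately have "l ^ r dvd h * pderiv b - wron a b" by (rule dvd_diff[rotated])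
    then have "l ^ r dvd b * pderiv h" by (simp add: h_eq mult.commute)
    moreover have "order c (b * pderiv h) = r - 1"
    proof -
      have "order c h = Suc (order c (pderiv h))"
        using \<open>pderiv h \<noteq> 0\<close> \<open>h \<noteq> 0\<close> \<open>poly h c = 0\<close> by (intro order_pderiv)
      moreover have "order c b = 0" using bc by (simp add: order_0I)
      ultimately show ?thesis
        using \<open>pderiv h \<noteq> 0\<close> bc by (subst order_mult) (auto simp: r_def)
    qed
    moreover have "b * pderiv h \<noteq> 0" using \<open>pderiv h \<noteq> 0\<close> bc by auto
    ultimately show False
      using r unfolding l_def order_divides by auto
  qed
  have ord: "order c (wron a b * f) \<le> r + \<nu> - 1"
    using ord_J r J f by (subst order_mult) (auto simp: \<nu>_def)
  have C: "l dvd tangent_cone a b" using C0 by (simp add: l_def poly_eq_0_iff_dvd)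
  have hf: "l ^ (r + \<nu>) dvd h * f"
    unfolding power_add using hr order_1[of c f] by (simp add: mult_dvd_mono l_def \<nu>_def)
  have bf: "l ^ \<nu> dvd b * f"
    using order_1[of c f] by (simp add: l_def \<nu>_def)
  define X where "X D = b * D (a * f) - a * D (b * f)" for D :: "complex poly \<Rightarrow> complex poly"
  define D :: "nat \<Rightarrow> complex poly \<Rightarrow> complex poly" where "D i = (pderiv ^^ i)" for i
  have D_add: "D i (u + v) = D i u + D i v" "D i (smult c u) = smult c (D i u)" for i and u v :: "complex poly"
    by (induction i) (auto simp: D_def pderiv_add pderiv_smult)
  have D_dvd: "l ^ (m - i) dvd D i u" if "l ^ m dvd u" for m i u
    using that
  proof (induction i)
    case (Suc i)
    then show ?case using power_dvd_pderiv[of c "m - i" "D i u"] by (simp add: D_def l_def)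
  qed (simp add: D_def)
  have X_eq: "X (D i) = b * D i (h * f) - h * D i (b * f)" for i
    by (simp add: X_def h_def D_add algebra_simps)
  have X_dvd: "l ^ (r + \<nu> - i) dvd X (D i)" for i
    unfolding X_eq
  proof (rule dvd_diff)
    show "l ^ (r + \<nu> - i) dvd b * D i (h * f)"
      by (intro dvd_mult D_dvd hf)
    \<comment> \<open>Subtraction is truncated: once \<open>i\<close> exceeds \<open>\<nu>\<close>
      this exponent stays at \<open>r\<close>, which is still at least
      \<open>r + \<nu> - i\<close>.\<close>
    have "l ^ (r + (\<nu> - i)) dvd h * D i (b * f)"
      unfolding power_add by (intro mult_dvd_mono hr D_dvd bf)
    then show "l ^ (r + \<nu> - i) dvd h * D i (b * f)"
      by (rule power_le_dvd) simp
  qed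
  have X1: "l ^ (r + \<nu> - 1) dvd X (D 1)" by (rule X_dvd)
  have X2: "l ^ (r + \<nu> - 1) dvd tangent_cone a b * X (D 2)"
  proof -
    have "l ^ (1 + (r + \<nu> - 2)) dvd tangent_cone a b * X (D 2)"
      unfolding power_add by (intro mult_dvd_mono X_dvd) (simp add: C)
    then show ?thesis by (rule power_le_dvd) simp
  qed
  have X3: "l ^ (r + \<nu> - 1) dvd (tangent_cone a b)^2 * X (D 3)"
  proof -
    have "l ^ (2 + (r + \<nu> - 3)) dvd (tangent_cone a b)^2 * X (D 3)"
      unfolding power_add by (intro mult_dvd_mono X_dvd dvd_power_same C)
    then show ?thesis by (rule power_le_dvd) simp
  qed
  have "trace_num N a b f = smult (3 * (of_nat N - 1) * (of_nat N - 2)) (b^2 * X (D 1))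
         - smult (3 * (of_nat N - 2)) (b * (tangent_cone a b * X (D 2))) + (tangent_cone a b)^2 * X (D 3)"
    by (simp add: trace_num_def X_def D_def Let_def eval_nat_numeral mult.assoc)
  then have "l ^ (r + \<nu> - 1) dvd trace_num N a b f"
    using X1 X2 X3 by (auto intro!: dvd_add dvd_diff dvd_smult dvd_mult)
  then show "[:-c, 1:] ^ order c (wron a b * f) dvd trace_num N a b f"
    using ord unfolding l_def by (meson power_le_dvd)
qed

text \<open>The product is, up to sign, the third derivative along the vector \<open>(b, - a)\<close> of the binary form
  defined by \<open>b (a f) - a (b f)\<close> (with the outer factors kept constant), whose degree is plain.\<close>

lemma degree_cone_trace_num:
  assumes a: "degree a \<le> n" and b: "degree b \<le> n" and N: "N \<ge> 3" "n + degree f = N"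
  shows "degree (tangent_cone a b * trace_num N a b f) \<le> 4 * n + N - 3"
proof -
  define u v where "u = a * f" and "v = b * f"
  define T where "T h = b^3 * deriv1 (N-2) (deriv1 (N-1) (deriv1 N h))
      - smult 3 (b^2 * a * deriv1 (N-2) (deriv1 (N-1) (pderiv h)))
      + smult 3 (b * a^2 * deriv1 (N-2) (pderiv (pderiv h)))
      - a^3 * pderiv (pderiv (pderiv h))" for h
  have eq: "tangent_cone a b * trace_num N a b f = a * T v - b * T u"
  proof (rule poly_ext)
    fix x
    have uv: "poly b x * poly u x = poly a x * poly v x" by (simp add: u_def v_def)
    show "poly (tangent_cone a b * trace_num N a b f) x = poly (a * T v - b * T u) x"
      unfolding trace_num_def u_def[symmetric] v_def[symmetric] Let_def
      by (simp add: T_def tangent_cone_def poly_deriv1_iterate[OF N(1)] del: One_nat_def) (use uv in algebra)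
  qed
  have dT: "degree (T h) \<le> 3 * n + (N - 3)" if h: "degree h \<le> N" for h
  proof -
    have d1: "degree (deriv1 (N-2) (deriv1 (N-1) (deriv1 N h))) \<le> N - 3"
      using degree_deriv1[OF degree_deriv1[OF degree_deriv1[OF h]]] by (simp add: numeral_eq_Suc)
    have d2: "degree (deriv1 (N-2) (deriv1 (N-1) (pderiv h))) \<le> N - 3"
      using degree_deriv1[OF degree_deriv1[OF degree_pderiv_le[OF h]]] by (simp add: numeral_eq_Suc)
    have d3: "degree (deriv1 (N-2) (pderiv (pderiv h))) \<le> N - 3"
      using degree_deriv1[OF degree_pderiv_le[OF degree_pderiv_le[OF h]]]
      by (simp add: numeral_eq_Suc)
    have d4: "degree (pderiv (pderiv (pderiv h))) \<le> N - 3"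
      using degree_pderiv_le[OF degree_pderiv_le[OF degree_pderiv_le[OF h]]]
      by (simp add: numeral_eq_Suc)
    have "degree (b^2 * a) \<le> 3 * n" "degree (b * a^2) \<le> 3 * n"
      using degree_mult_le'[OF degree_power_le'[OF b, of 2] a]
        degree_mult_le'[OF b degree_power_le'[OF a, of 2]] by auto
    then show ?thesis
      unfolding T_def
      by (intro degree_add_le degree_diff_le order_trans[OF degree_smult_le] degree_mult_le'
          degree_power_le' a b d1 d2 d3 d4)
  qed
  have "degree u \<le> N" "degree v \<le> N"
    using degree_mult_le'[OF a, of f "degree f"] degree_mult_le'[OF b, of f "degree f"] N
    by (auto simp: u_def v_def)
  then have "degree (a * T v - b * T u) \<le> n + (3 * n + (N - 3))"
    by (intro degree_diff_le degree_mult_le' a b dT)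
  then show ?thesis using N unfolding eq by simp
qed

text \<open>Twice the second elementary symmetric function of the numbers
  \<open>(p - s) / (t - s)\<close>, written with power sums.\<close>

definition sym2 :: "complex set \<Rightarrow> complex \<Rightarrow> complex \<Rightarrow> complex" where
  "sym2 S p t = (\<Sum>s\<in>S-{t}. (p - s) / (t - s))\<^sup>2 - (\<Sum>s\<in>S-{t}. ((p - s) / (t - s))\<^sup>2)"

lemma poly_eq_smult_prod_roots:
  fixes R :: "complex poly"
  assumes "R \<noteq> 0" "Z \<subseteq> {z. poly R z = 0}" "card Z = degree R"
  shows "R = smult (lead_coeff R) (\<Prod>z\<in>Z. [:-z, 1:])"
proof (rule ccontr)
  assume neq: "R \<noteq> smult (lead_coeff R) (\<Prod>z\<in>Z. [:-z, 1:])"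
  define D where "D = R - smult (lead_coeff R) (\<Prod>z\<in>Z. [:-z, 1:])"
  have fin: "finite Z" using assms finite_subset poly_roots_finite by blast
  have "D \<noteq> 0" using neq by (simp add: D_def)
  have le: "degree D \<le> degree R"
    unfolding D_def using prod_linear_degree(1)[OF fin] assms(3) by (intro degree_diff_le) auto
  have "coeff D (degree R) = 0"
    using prod_linear_degree[OF fin] assms(3) by (simp add: D_def)
  with le \<open>D \<noteq> 0\<close> have "degree D < degree R"
    by (metis leading_coeff_neq_0 le_neq_implies_less)
  moreover have "Z \<subseteq> {z. poly D z = 0}"
    using assms(2) fin by (auto simp: D_def poly_prod intro!: prod_zero)
  then have "card Z \<le> degree D"
    using card_mono[OF poly_roots_finite[OF \<open>D \<noteq> 0\<close>]] card_poly_roots_bound[OF \<open>D \<noteq> 0\<close>]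
    by (meson order_trans)
  ultimately show False using assms(3) by simp
qed

text \<open>At such a \<open>t\<close> one has \<open>a = - p b\<close>, so an expression
  \<open>b D(a f) - a D(b f)\<close> with a linear operator \<open>D\<close> collapses to
  \<open>b D((a + p b) f)\<close>. The proof of \<open>sym2_eq\<close> uses this for the first three
  derivatives.\<close>

lemma wron_at_root:
  assumes t: "poly (a + smult p b) t = 0"
  shows "poly (wron a b * f) t = - (poly b t * poly (pderiv ((a + smult p b) * f)) t)"
proof -
  have "poly a t = - p * poly b t" using t by (simp add: eq_neg_iff_add_eq_0)
  then have "poly (b * pderiv (a * f) - a * pderiv (b * f)) t
      = poly b t * poly (pderiv ((a + smult p b) * f)) t"
    by (simp add: distrib_right pderiv_add pderiv_smult algebra_simps)
  then show ?thesis unfolding trace_den_eq poly_minus by (metis minus_minus)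
qed

lemma pderiv_at_simple_root:
  fixes S :: "complex set"
  assumes "finite S" "t \<in> S"
  shows "poly (pderiv (smult c (\<Prod>s\<in>S. [:-s, 1:]))) t = c * (\<Prod>s\<in>S-{t}. t - s)"
  by (simp add: prod.remove[OF assms] pderiv_mult pderiv_smult pderiv_pCons poly_prod
      del: mult_pCons_left mult_pCons_right)

text \<open>By \<open>(p - s) / (t - s) = 1 + (p - t) / (t - s)\<close>, \<open>sym2\<close> equals
  \<open>m (m - 1) + 2 (m - 1) (p - t) \<sigma> + (p - t)^2 (\<sigma>^2 - \<rho>)\<close> with
  \<open>m = N - 1\<close>. The derivatives of \<open>Q\<close> at \<open>t\<close> are
  \<open>c q\<close>, \<open>2 c q \<sigma>\<close> and \<open>3 c q (\<sigma>^2 - \<rho>)\<close>.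
  Matching the two lists gives the coefficients in \<open>trace_num\<close>.\<close>

lemma sym2_eq:
  assumes S: "finite S" "card S = N" "N \<ge> 1" "t \<in> S"
    and u: "smult c (\<Prod>s\<in>S. [:-s, 1:]) = (a + smult p b) * f"
    and t: "poly (a + smult p b) t = 0"
  shows "poly (trace_num N a b f) t = - 3 * (poly b t)\<^sup>2 * sym2 S p t * poly (wron a b * f) t"
proof -
  define q where "q = (\<Prod>s\<in>S-{t}. [:-s, 1:])"
  define \<sigma> \<rho> where "\<sigma> = (\<Sum>s\<in>S-{t}. 1 / (t - s))" and "\<rho> = (\<Sum>s\<in>S-{t}. 1 / (t - s)\<^sup>2)"
  define Q where "Q = (a + smult p b) * f"
  define m :: complex where "m = of_nat N - 1"
  have Q: "Q = smult c ([:-t, 1:] * q)"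
    using u S by (simp add: Q_def q_def prod.remove[OF S(1,4)] del: mult_pCons_left)
  have q: "poly (pderiv q) t = poly q t * \<sigma>" "poly (pderiv (pderiv q)) t = poly q t * (\<sigma>\<^sup>2 - \<rho>)"
    using pderiv_prod_linear[of "S - {t}" t] S(1) by (auto simp: q_def \<sigma>_def \<rho>_def)
  have dQ: "poly (pderiv Q) t = c * poly q t" "poly (pderiv (pderiv Q)) t = 2 * c * poly (pderiv q) t"
    "poly (pderiv (pderiv (pderiv Q))) t = 3 * c * poly (pderiv (pderiv q)) t"
    by (simp_all add: Q pderiv_mult pderiv_smult pderiv_add pderiv_pCons algebra_simps
        del: mult_pCons_left mult_pCons_right)
  have at: "poly a t = - p * poly b t" using t by (simp add: eq_neg_iff_add_eq_0)
  have X: "poly b t * poly (pderiv (a * f)) t - poly a t * poly (pderiv (b * f)) t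
             = poly b t * poly (pderiv Q) t"
    "poly b t * poly (pderiv (pderiv (a * f))) t - poly a t * poly (pderiv (pderiv (b * f))) t
             = poly b t * poly (pderiv (pderiv Q)) t"
    "poly b t * poly (pderiv (pderiv (pderiv (a * f)))) t
       - poly a t * poly (pderiv (pderiv (pderiv (b * f)))) t
             = poly b t * poly (pderiv (pderiv (pderiv Q))) t"
    by (simp_all add: Q_def at distrib_right pderiv_add pderiv_smult algebra_simps)
  have J: "poly (wron a b * f) t = - (poly b t * poly (pderiv Q) t)"
    unfolding Q_def by (rule wron_at_root[OF t])
  have C: "poly (tangent_cone a b) t = - (p - t) * poly b t"
    by (simp add: tangent_cone_def at algebra_simps)
  have s1: "(p - s) / (t - s) = 1 + (p - t) * (1 / (t - s))" if "s \<in> S - {t}" for s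
    using that by (auto simp: field_simps)
  have s2: "((p - s) / (t - s))\<^sup>2 = 1 + 2 * (p - t) * (1 / (t - s)) + (p - t)\<^sup>2 * (1 / (t - s)\<^sup>2)"
    if "s \<in> S - {t}" for s
    unfolding s1[OF that] power_one_over[symmetric] by algebra
  have cm: "of_nat (card (S - {t})) = m"
    using S by (simp add: m_def of_nat_diff)
  have "(\<Sum>s\<in>S-{t}. (p - s) / (t - s)) = (\<Sum>s\<in>S-{t}. 1 + (p - t) * (1 / (t - s)))"
    by (intro sum.cong s1) auto
  also have "\<dots> = m + (p - t) * \<sigma>"
    unfolding sum.distrib sum_distrib_left[symmetric] \<sigma>_def by (simp add: cm)
  finally have e1: "(\<Sum>s\<in>S-{t}. (p - s) / (t - s)) = m + (p - t) * \<sigma>" .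
  have "(\<Sum>s\<in>S-{t}. ((p - s) / (t - s))\<^sup>2)
      = (\<Sum>s\<in>S-{t}. 1 + 2 * (p - t) * (1 / (t - s)) + (p - t)\<^sup>2 * (1 / (t - s)\<^sup>2))"
    by (intro sum.cong s2) auto
  also have "\<dots> = m + 2 * (p - t) * \<sigma> + (p - t)\<^sup>2 * \<rho>"
    unfolding sum.distrib sum_distrib_left[symmetric] \<sigma>_def \<rho>_def by (simp add: cm)
  finally have e2: "(\<Sum>s\<in>S-{t}. ((p - s) / (t - s))\<^sup>2) = m + 2 * (p - t) * \<sigma> + (p - t)\<^sup>2 * \<rho>" .
  show ?thesis
    unfolding sym2_def e1 e2 J
    unfolding trace_num_def Let_def poly_add poly_diff poly_smult poly_mult[of "b\<^sup>2"]
      poly_mult[of "_ * tangent_cone a b"] poly_mult[of "b" "tangent_cone a b"] poly_mult[of "(tangent_cone a b)\<^sup>2"]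
      poly_mult[of b "pderiv _"] poly_mult[of a "pderiv _"] poly_power X C
    unfolding dQ q m_def by algebra
qed

text \<open>Differentiating \<open>a(t) + p b(t) = 0\<close> gives
  \<open>dt/dp = - b / (a' + p b')\<close>, the first factor of a summand. Constant slopes are not
  summed over but still enter \<open>sym2\<close> through \<open>S\<close>.\<close>

definition slope_trace :: "complex poly \<Rightarrow> complex poly \<Rightarrow> complex set \<Rightarrow> complex \<Rightarrow> complex" where
  "slope_trace a b S p = (\<Sum>t | t \<in> S \<and> poly (a + smult p b) t = 0.
     - poly b t / poly (pderiv (a + smult p b)) t * sym2 S p t)"

text \<open>The set \<open>S\<close> is as large as the degrees allow, so the count
  \<open>card A + card B = card S + card (A \<inter> B)\<close> leaves no room for multiple or
  shared roots.\<close>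

lemma simple_roots_product:
  fixes R f :: "complex poly"
  assumes "S = {t. poly (R * f) t = 0}" "R * f \<noteq> 0" "degree R \<le> n" "card S = n + degree f"
  shows "card {t\<in>S. poly R t = 0} = n" "degree R = n" "{t\<in>S. poly R t = 0} = {t. poly R t = 0}"
    "finite S" "\<And>t. poly R t = 0 \<Longrightarrow> poly f t \<noteq> 0" "card {t. poly f t = 0} = degree f"
proof -
  have nz: "R \<noteq> 0" "f \<noteq> 0" using assms(2) by auto
  define A B where "A = {t. poly R t = 0}" and "B = {t. poly f t = 0}"
  have S: "S = A \<union> B" using assms(1) by (auto simp: A_def B_def)
  have fin: "finite A" "finite B" using nz by (auto simp: A_def B_def poly_roots_finite)
  have c: "card A \<le> degree R" "card B \<le> degree f"
    unfolding A_def B_def using nz by (auto intro: card_poly_roots_bound)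
  have "card A + card B = card S + card (A \<inter> B)" unfolding S by (rule card_Un_Int[OF fin])
  then have *: "card A = n" "degree R = n" "card (A \<inter> B) = 0" "card B = degree f"
    using c assms(3,4) by auto
  have "{t\<in>S. poly R t = 0} = A" by (auto simp: S A_def)
  then show "card {t\<in>S. poly R t = 0} = n" "degree R = n" "card {t. poly f t = 0} = degree f"
     "{t\<in>S. poly R t = 0} = {t. poly R t = 0}" using * by (auto simp: A_def B_def)
  show "finite S" using fin S by simp
  have "A \<inter> B = {}" using * fin by simp
  then show "\<And>t. poly R t = 0 \<Longrightarrow> poly f t \<noteq> 0" by (auto simp: A_def B_def)
qed

text \<open>Turns a summand of the trace into a residue. At a root of one of the two polynomials
  \<open>a + p b\<close>, \<open>B\<close> is the value of \<open>b\<close>, \<open>r\<close> the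
  derivative of that polynomial, \<open>R\<close> the value of the other one, and \<open>D\<close>
  the product of the differences to all other roots.\<close>

lemma residue_quotient:
  fixes x B r \<kappa> c D :: complex
  assumes "\<kappa> * (3 * c) = P" "P * B = R" "c * D = R * r" "c \<noteq> 0" "D \<noteq> 0"
  shows "x / (3 * B * r) = \<kappa> * (x / D)"
proof -
  have "c * (3 * B * r * \<kappa>) = (\<kappa> * (3 * c)) * B * r" by simp
  also have "\<dots> = c * D" using assms by simp
  finally have "D = 3 * B * r * \<kappa>" using assms(4) by simp
  then show ?thesis using assms(5) by simp
qed

text \<open>The conditions \<open>degree b = n\<close> and
  \<open>degree (wron a b) = 2 * n - 2\<close> say that infinity is neither a fixed nor a critical
  point of the Gauss map. The cardinalities of \<open>S1\<close> and \<open>S2\<close> make all the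
  poles involved simple.\<close>

theorem slope_trace_const:
  fixes a b f :: "complex poly"
  assumes n: "n \<ge> 1" and a: "degree a \<le> n" and b: "degree b = n"
    and J: "wron a b \<noteq> 0" "degree (wron a b) = 2 * n - 2"
    and cop: "\<And>c. \<not> (poly a c = 0 \<and> poly b c = 0)"
    and crit: "\<And>c. poly (wron a b) c = 0 \<Longrightarrow> poly (tangent_cone a b) c = 0"
    and inv: "\<And>c. poly f c = 0 \<Longrightarrow> poly (tangent_cone a b) c = 0"
    and S1: "S1 = {t. poly ((a + smult p1 b) * f) t = 0}" "(a + smult p1 b) * f \<noteq> 0"
      "card S1 = n + degree f"
    and S2: "S2 = {t. poly ((a + smult p2 b) * f) t = 0}" "(a + smult p2 b) * f \<noteq> 0"
      "card S2 = n + degree f"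
  shows "slope_trace a b S1 p1 = slope_trace a b S2 p2"
proof (cases "p1 = p2")
  case True
  then show ?thesis using S1 S2 by simp
next
  case neq: False
  define N where "N = n + degree f"
  define R where "R p = a + smult p b" for p
  define Z where "Z p = {t. poly (R p) t = 0}" for p
  have dR: "degree (R p) \<le> n" for p
    unfolding R_def using a b by (intro degree_add_le order_trans[OF degree_smult_le]) auto
  note 1 = simple_roots_product[OF S1(1,2) dR[unfolded R_def] S1(3), folded R_def]
  note 2 = simple_roots_product[OF S2(1,2) dR[unfolded R_def] S2(3), folded R_def]
  show ?thesis
  proof (cases "N \<ge> 3")
    case False
    \<comment> \<open>With at most one other slope, the square of the sum is the sum of the
      squares.\<close>
    have "sym2 S p t = 0" if S: "t \<in> S" "card S \<le> 2" "finite S" for S p t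
    proof -
      have "card (S - {t}) \<le> Suc 0" using S by simp
      then have "S - {t} = {} \<or> (\<exists>x. S - {t} = {x})"
        using S(3) by (cases "card (S - {t})") (auto simp: card_1_singleton_iff)
      then show ?thesis by (elim disjE exE) (simp_all only: sym2_def, simp_all)
    qed
    then have "\<And>t. t \<in> S1 \<Longrightarrow> sym2 S1 p1 t = 0" "\<And>t. t \<in> S2 \<Longrightarrow> sym2 S2 p2 t = 0"
      using False S1(3) S2(3) 1(4) 2(4) by (auto simp: N_def)
    then have "slope_trace a b S1 p1 = 0" "slope_trace a b S2 p2 = 0"
      by (auto simp: slope_trace_def intro!: sum.neutral)
    then show ?thesis by simp
  next
    case True
    have f: "f \<noteq> 0" using S1 by auto
    obtain G where G: "trace_num N a b f = wron a b * f * G"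
      using trace_num_dvd[OF J(1) f cop crit inv] by (rule dvdE)
    \<comment> \<open>Of the bound \<open>4 n + N - 3\<close>, the factor
      \<open>tangent_cone a b\<close> takes exactly \<open>n + 1\<close>, \<open>wron a b\<close>
      exactly \<open>2 n - 2\<close> and \<open>f\<close> exactly \<open>N - n\<close>. This leaves
      \<open>2 n - 2\<close> for \<open>G\<close>.\<close>
    have dG: "degree G + 2 \<le> 2 * n"
    proof (cases "G = 0")
      case nz: False
      have C: "degree (tangent_cone a b) = n + 1"
        unfolding tangent_cone_def using a b n
        by (subst degree_add_eq_right) (auto simp: degree_pCons_eq_if)
      then have "tangent_cone a b \<noteq> 0" by auto
      then have "degree (tangent_cone a b * trace_num N a b f) = (n + 1) + (2 * n - 2) + degree f + degree G"
        using J f nz C by (simp add: G degree_mult_eq)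
      then show ?thesis
        using degree_cone_trace_num[OF a eq_refl[OF b] True N_def[symmetric]] n
        unfolding N_def by linarith
    qed (use n in simp)
    have summand: "- poly b t / poly (pderiv (R p)) t * sym2 S p t = poly G t / (3 * poly b t * poly (pderiv (R p)) t)"
      if S: "S = {t. poly (R p * f) t = 0}" "R p * f \<noteq> 0" "card S = N" and t: "poly (R p) t = 0"
      for S p t
    proof -
      note r = simple_roots_product[OF S(1,2) dR S(3)[unfolded N_def]]
      have "t \<in> S" using t S by auto
      have dN: "degree (R p * f) = N" using S(2) r(2) by (simp add: degree_mult_eq N_def)
      have spl: "R p * f = smult (lead_coeff (R p * f)) (\<Prod>s\<in>S. [:-s, 1:])"
        by (rule poly_eq_smult_prod_roots) (use S dN in auto)
      have bt: "poly b t \<noteq> 0" using t cop[of t] by (auto simp: R_def)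
      have "finite S" by (rule r(4))
      have "poly (pderiv (R p * f)) t \<noteq> 0"
        using S(2) \<open>finite S\<close> \<open>t \<in> S\<close>
        by (subst spl, subst pderiv_at_simple_root) auto
      then have "poly (wron a b * f) t \<noteq> 0"
        using bt wron_at_root[of a p b t f] t by (simp add: R_def)
      moreover have "poly (trace_num N a b f) t
          = - 3 * (poly b t)\<^sup>2 * sym2 S p t * poly (wron a b * f) t"
        by (rule sym2_eq[where c = "lead_coeff (R p * f)"])
          (use spl[symmetric] S(3) t \<open>t \<in> S\<close> \<open>finite S\<close> True in \<open>simp_all add: R_def\<close>)
      ultimately have G_t: "poly G t = - 3 * (poly b t)\<^sup>2 * sym2 S p t"
        unfolding G poly_mult[of _ G] by (metis mult.commute mult_left_cancel)
      show ?thesis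
        unfolding G_t power2_eq_square using bt by simp
    qed
    \<comment> \<open>On the roots of \<open>R p1\<close> the polynomial \<open>b\<close> is proportional to \<open>R p2\<close>, and conversely: the difference
      of the two traces is the sum of all residues of \<open>G / (R p1 R p2)\<close>.\<close>
    define c1 c2 where "c1 = lead_coeff (R p1)" and "c2 = lead_coeff (R p2)"
    have nzR: "R p1 \<noteq> 0" "R p2 \<noteq> 0" using S1(2) S2(2) unfolding R_def by auto
    have dZ: "card (Z p1) = degree (R p1)" "card (Z p2) = degree (R p2)"
      using 1(1-3) 2(1-3) unfolding Z_def by auto
    have R1: "R p1 = smult c1 (\<Prod>z\<in>Z p1. [:-z, 1:])"
      unfolding c1_def by (rule poly_eq_smult_prod_roots) (simp_all add: nzR dZ Z_def[symmetric])
    have R2: "R p2 = smult c2 (\<Prod>z\<in>Z p2. [:-z, 1:])"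
      unfolding c2_def by (rule poly_eq_smult_prod_roots) (simp_all add: nzR dZ Z_def[symmetric])
    have c: "c1 \<noteq> 0" "c2 \<noteq> 0" using nzR by (auto simp: c1_def c2_def)
    have fin: "finite (Z p1)" "finite (Z p2)"
      unfolding Z_def using nzR by (auto intro: poly_roots_finite)
    have disj: "Z p1 \<inter> Z p2 = {}"
    proof -
      have False if "poly (R p1) x = 0" "poly (R p2) x = 0" for x
      proof -
        have "(p1 - p2) * poly b x = 0"
          using that unfolding R_def poly_add poly_smult by algebra
        then have "poly b x = 0" using neq by simp
        with that cop[of x] show False by (simp add: R_def)
      qed
      then show ?thesis by (auto simp: Z_def)
    qed
    \<comment> \<open>The 3 is the one in \<open>sym2_eq\<close>; \<open>c1 * c2\<close> accounts
      for the leading coefficients, which the product \<open>D\<close> of root differences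
      omits.\<close>
    define \<kappa> where "\<kappa> = (p1 - p2) / (3 * c1 * c2)"
    have cc: "c1 * c2 \<noteq> 0" using c by simp
    have \<kappa>: "\<kappa> * (3 * (c1 * c2)) = p1 - p2" using c by (simp add: \<kappa>_def)
    define D where "D t = (\<Prod>s\<in>Z p1 \<union> Z p2 - {t}. t - s)" for t
    have b1: "(p2 - p1) * poly b t = poly (R p2) t" if "t \<in> Z p1" for t
      using that unfolding Z_def mem_Collect_eq R_def poly_add poly_smult by algebra
    have b2: "(p1 - p2) * poly b t = poly (R p1) t" if "t \<in> Z p2" for t
      using that unfolding Z_def mem_Collect_eq R_def poly_add poly_smult by algebra
    have D1: "c1 * c2 * D t = poly (R p2) t * poly (pderiv (R p1)) t" if t: "t \<in> Z p1" for t
    proof -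
      have "Z p1 \<union> Z p2 - {t} = (Z p1 - {t}) \<union> Z p2" using disj t by auto
      then have "D t = (\<Prod>s\<in>Z p1 - {t}. t - s) * (\<Prod>s\<in>Z p2. t - s)"
        unfolding D_def using fin disj by (auto intro!: prod.union_disjoint)
      then show ?thesis
        unfolding R1 R2 pderiv_at_simple_root[OF fin(1) t] by (simp add: poly_prod)
    qed
    have D2: "c1 * c2 * D t = poly (R p1) t * poly (pderiv (R p2)) t" if t: "t \<in> Z p2" for t
    proof -
      have "Z p1 \<union> Z p2 - {t} = Z p1 \<union> (Z p2 - {t})" using disj t by auto
      then have "D t = (\<Prod>s\<in>Z p1. t - s) * (\<Prod>s\<in>Z p2 - {t}. t - s)"
        unfolding D_def using fin disj by (auto intro!: prod.union_disjoint)
      then show ?thesis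
        unfolding R1 R2 pderiv_at_simple_root[OF fin(2) t] by (simp add: poly_prod)
    qed
    have Dnz: "D t \<noteq> 0" for t unfolding D_def using fin by auto
    have T1: "slope_trace a b S1 p1 = (\<Sum>t\<in>Z p1. - \<kappa> * (poly G t / D t))"
      unfolding slope_trace_def 1(3) R_def[symmetric]
    proof (rule sum.cong)
      fix t assume t: "t \<in> Z p1"
      have "- poly b t / poly (pderiv (R p1)) t * sym2 S1 p1 t
          = poly G t / (3 * poly b t * poly (pderiv (R p1)) t)"
        using t unfolding Z_def mem_Collect_eq
        by (rule summand[OF S1(1)[folded R_def] S1(2)[folded R_def] S1(3)[folded N_def]])
      also have "\<dots> = - \<kappa> * (poly G t / D t)"
        by (rule residue_quotient[OF _ b1[OF t] D1[OF t] cc Dnz]) (simp add: \<kappa>)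
      finally show "- poly b t / poly (pderiv (R p1)) t * sym2 S1 p1 t = - \<kappa> * (poly G t / D t)" .
    qed (auto simp: Z_def)
    have T2: "slope_trace a b S2 p2 = (\<Sum>t\<in>Z p2. \<kappa> * (poly G t / D t))"
      unfolding slope_trace_def 2(3) R_def[symmetric]
    proof (rule sum.cong)
      fix t assume t: "t \<in> Z p2"
      have "- poly b t / poly (pderiv (R p2)) t * sym2 S2 p2 t
          = poly G t / (3 * poly b t * poly (pderiv (R p2)) t)"
        using t unfolding Z_def mem_Collect_eq
        by (rule summand[OF S2(1)[folded R_def] S2(2)[folded R_def] S2(3)[folded N_def]])
      also have "\<dots> = \<kappa> * (poly G t / D t)"
        by (rule residue_quotient[OF _ b2[OF t] D2[OF t] cc Dnz]) (simp add: \<kappa>)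
      finally show "- poly b t / poly (pderiv (R p2)) t * sym2 S2 p2 t = \<kappa> * (poly G t / D t)" .
    qed (auto simp: Z_def)
    have "card (Z p1 \<union> Z p2) = 2 * n"
      using card_Un_disjoint[OF fin disj] 1(1,3) 2(1,3) by (simp add: Z_def)
    then have "(\<Sum>t\<in>Z p1 \<union> Z p2. poly G t / D t) = 0"
      unfolding D_def using dG fin by (intro sum_residues_eq_0) auto
    then have "(\<Sum>t\<in>Z p1. poly G t / D t) + (\<Sum>t\<in>Z p2. poly G t / D t) = 0"
      using fin disj by (simp add: sum.union_disjoint)
    then show ?thesis
      unfolding T1 T2 sum_distrib_left[symmetric] by algebra
  qed
qed

section \<open>Webs whose slopes depend on one variable\<close>

definition has_grad :: "(complex \<times> complex \<Rightarrow> complex) \<Rightarrow> complex \<times> complex \<Rightarrow> complex \<times> complex \<Rightarrow> bool" where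
  "has_grad f g z \<longleftrightarrow> (f has_derivative (\<lambda>h. fst g * fst h + snd g * snd h)) (at z)"

definition cscale :: "complex \<Rightarrow> complex \<times> complex \<Rightarrow> complex \<times> complex" where
  "cscale c v = (c * fst v, c * snd v)"

lemma cscale_simps [simp]: "fst (cscale c v) = c * fst v" "snd (cscale c v) = c * snd v"
  by (simp_all add: cscale_def)

lemma holomorphic2_iff: "holomorphic2 U f \<longleftrightarrow> open U \<and> (\<forall>z\<in>U. \<exists>g. has_grad f g z)"
  unfolding holomorphic2_def has_grad_def by auto

lemma has_grad_const: "has_grad (\<lambda>z. c) 0 z"
  by (simp add: has_grad_def)

lemma has_grad_fst: "has_grad fst (1, 0) z" and has_grad_snd: "has_grad snd (0, 1) z"
  by (auto simp: has_grad_def intro!: derivative_eq_intros)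

lemma has_grad_add: "has_grad f a z \<Longrightarrow> has_grad g b z \<Longrightarrow> has_grad (\<lambda>z. f z + g z) (a + b) z"
  unfolding has_grad_def by (auto intro!: derivative_eq_intros simp: algebra_simps)

lemma has_grad_diff: "has_grad f a z \<Longrightarrow> has_grad g b z \<Longrightarrow> has_grad (\<lambda>z. f z - g z) (a - b) z"
  unfolding has_grad_def by (auto intro!: derivative_eq_intros simp: algebra_simps)

lemma has_grad_mult:
  "has_grad f a z \<Longrightarrow> has_grad g b z \<Longrightarrow> has_grad (\<lambda>z. f z * g z) (cscale (f z) b + cscale (g z) a) z"
  unfolding has_grad_def by (auto intro!: derivative_eq_intros simp: algebra_simps)

lemma has_grad_inverse:
  "has_grad f a z \<Longrightarrow> f z \<noteq> 0 \<Longrightarrow> has_grad (\<lambda>z. inverse (f z)) (cscale (- (inverse (f z))\<^sup>2) a) z"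
  unfolding has_grad_def
  by (auto intro!: derivative_eq_intros simp: algebra_simps power2_eq_square)

lemma has_grad_poly:
  assumes "has_grad f a z"
  shows "has_grad (\<lambda>z. poly r (f z)) (cscale (poly (pderiv r) (f z)) a) z"
proof -
  have "(poly r has_derivative (*) (poly (pderiv r) (f z))) (at (f z))"
    using poly_DERIV[of r "f z"] by (simp add: has_field_derivative_def)
  from has_derivative_compose[OF assms[unfolded has_grad_def] this] show ?thesis
    by (simp add: has_grad_def algebra_simps)
qed

lemma has_grad_sum:
  "(\<And>i. i \<in> I \<Longrightarrow> has_grad (f i) (g i) z) \<Longrightarrow> has_grad (\<lambda>z. \<Sum>i\<in>I. f i z) (\<Sum>i\<in>I. g i) z"
proof (induction I rule: infinite_finite_induct)
  case (insert i I)
  then show ?case by (auto intro: has_grad_add)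
qed (auto intro: has_grad_const)

lemma has_grad_cong_open:
  "has_grad f g z \<Longrightarrow> open U \<Longrightarrow> z \<in> U \<Longrightarrow> (\<And>z. z \<in> U \<Longrightarrow> f z = f' z) \<Longrightarrow> has_grad f' g z"
  unfolding has_grad_def by (rule has_derivative_transform_within_open)

lemma has_grad_partials:
  assumes "has_grad f g z"
  shows "((\<lambda>p. f (p, snd z)) has_field_derivative fst g) (at (fst z))"
    and "((\<lambda>q. f (fst z, q)) has_field_derivative snd g) (at (snd z))"
proof -
  have "((\<lambda>p. (p, snd z)) has_derivative (\<lambda>h. (h, 0))) (at (fst z))"
    "((\<lambda>q. (fst z, q)) has_derivative (\<lambda>h. (0, h))) (at (snd z))"
    by (auto intro!: derivative_eq_intros)
  then show "((\<lambda>p. f (p, snd z)) has_field_derivative fst g) (at (fst z))"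
    "((\<lambda>q. f (fst z, q)) has_field_derivative snd g) (at (snd z))"
    using assms unfolding has_grad_def has_field_derivative_def
    by (auto dest: has_derivative_compose[where g = f])
qed

lemma has_grad_unique: "has_grad f g z \<Longrightarrow> has_grad f g' z \<Longrightarrow> g = g'"
  using has_grad_partials[of f g z] has_grad_partials[of f g' z] DERIV_unique
  by (metis prod.expand)

lemma ext_deriv_eq:
  assumes "has_grad (\<lambda>z. fst (\<omega> z)) a z" "has_grad (\<lambda>z. snd (\<omega> z)) b z"
  shows "ext_deriv \<omega> z = fst b - snd a"
  unfolding ext_deriv_def
  using has_grad_partials[OF assms(1)] has_grad_partials[OF assms(2)] by (simp add: DERIV_imp_deriv)

lemma holomorphic_formD:
  assumes "holomorphic_form U \<omega>" "z \<in> U"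
  obtains a b where "has_grad (\<lambda>z. fst (\<omega> z)) a z" "has_grad (\<lambda>z. snd (\<omega> z)) b z"
  using assms unfolding holomorphic_form_def holomorphic2_iff by blast

lemma ext_deriv_scale:
  assumes "holomorphic_form U \<omega>" "z \<in> U" "has_grad f g z"
  shows "ext_deriv (\<lambda>z. cscale (f z) (\<omega> z)) z = wedge g (\<omega> z) + f z * ext_deriv \<omega> z"
proof -
  obtain a b where ab: "has_grad (\<lambda>z. fst (\<omega> z)) a z" "has_grad (\<lambda>z. snd (\<omega> z)) b z"
    using holomorphic_formD[OF assms(1,2)] .
  have "ext_deriv (\<lambda>z. cscale (f z) (\<omega> z)) z
      = fst (cscale (f z) b + cscale (snd (\<omega> z)) g) - snd (cscale (f z) a + cscale (fst (\<omega> z)) g)"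
    by (rule ext_deriv_eq) (use assms(3) ab in \<open>auto intro: has_grad_mult\<close>)
  then show ?thesis
    unfolding ext_deriv_eq[OF ab] by (simp add: wedge_def algebra_simps)
qed

lemma ext_deriv_add:
  assumes "holomorphic_form U \<omega>" "holomorphic_form U \<omega>'" "z \<in> U"
  shows "ext_deriv (\<lambda>z. \<omega> z + \<omega>' z) z = ext_deriv \<omega> z + ext_deriv \<omega>' z"
proof -
  obtain a b where ab: "has_grad (\<lambda>z. fst (\<omega> z)) a z" "has_grad (\<lambda>z. snd (\<omega> z)) b z"
    using holomorphic_formD[OF assms(1,3)] .
  obtain a' b' where ab': "has_grad (\<lambda>z. fst (\<omega>' z)) a' z" "has_grad (\<lambda>z. snd (\<omega>' z)) b' z"
    using holomorphic_formD[OF assms(2,3)] .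
  have "ext_deriv (\<lambda>z. \<omega> z + \<omega>' z) z = fst (b + b') - snd (a + a')"
    by (rule ext_deriv_eq) (use ab ab' in \<open>simp_all add: has_grad_add\<close>)
  then show ?thesis
    using ext_deriv_eq[OF ab] ext_deriv_eq[OF ab'] by simp
qed

lemma holomorphic2_const: "open U \<Longrightarrow> holomorphic2 U (\<lambda>z. c)"
  unfolding holomorphic2_iff using has_grad_const by blast

lemma holomorphic2_add: "holomorphic2 U f \<Longrightarrow> holomorphic2 U g \<Longrightarrow> holomorphic2 U (\<lambda>z. f z + g z)"
  unfolding holomorphic2_iff using has_grad_add by blast

lemma holomorphic2_mult: "holomorphic2 U f \<Longrightarrow> holomorphic2 U g \<Longrightarrow> holomorphic2 U (\<lambda>z. f z * g z)"
  unfolding holomorphic2_iff using has_grad_mult by blast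

lemma holomorphic2_inverse:
  "holomorphic2 U f \<Longrightarrow> (\<And>z. z \<in> U \<Longrightarrow> f z \<noteq> 0) \<Longrightarrow> holomorphic2 U (\<lambda>z. inverse (f z))"
  unfolding holomorphic2_iff using has_grad_inverse by blast

lemma holomorphic2_diff: "holomorphic2 U f \<Longrightarrow> holomorphic2 U g \<Longrightarrow> holomorphic2 U (\<lambda>z. f z - g z)"
  unfolding holomorphic2_iff using has_grad_diff by blast

lemma holomorphic2_divide:
  "holomorphic2 U f \<Longrightarrow> holomorphic2 U g \<Longrightarrow> (\<And>z. z \<in> U \<Longrightarrow> g z \<noteq> 0) \<Longrightarrow> holomorphic2 U (\<lambda>z. f z / g z)"
  unfolding divide_inverse by (intro holomorphic2_mult holomorphic2_inverse)

lemma holomorphic2_continuous_on: "holomorphic2 U f \<Longrightarrow> continuous_on U f"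
  unfolding holomorphic2_def
  by (meson continuous_at_imp_continuous_on has_derivative_continuous)

lemma holomorphic_form_scale:
  "holomorphic2 U f \<Longrightarrow> holomorphic_form U \<omega> \<Longrightarrow> holomorphic_form U (\<lambda>z. cscale (f z) (\<omega> z))"
  by (simp add: holomorphic_form_def holomorphic2_mult)

lemma holomorphic_form_add:
  "holomorphic_form U \<omega> \<Longrightarrow> holomorphic_form U \<omega>' \<Longrightarrow> holomorphic_form U (\<lambda>z. \<omega> z + \<omega>' z)"
  by (simp add: holomorphic_form_def holomorphic2_add)


lemma holomorphic2_cong:
  "holomorphic2 U f \<Longrightarrow> (\<And>z. z \<in> U \<Longrightarrow> f z = g z) \<Longrightarrow> holomorphic2 U g"
  unfolding holomorphic2_iff by (meson has_grad_cong_open)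

lemma holomorphic_form_cong:
  assumes "holomorphic_form U \<omega>" "\<And>z. z \<in> U \<Longrightarrow> \<omega> z = \<omega>' z"
  shows "holomorphic_form U \<omega>'"
  using assms unfolding holomorphic_form_def
  by (auto intro: holomorphic2_cong[of U "\<lambda>z. fst (\<omega> z)"] holomorphic2_cong[of U "\<lambda>z. snd (\<omega> z)"])

text \<open>Says \<open>df = k \<pi>\<close> at \<open>z\<close>. For \<open>\<pi> = dp\<close> the
  number \<open>k\<close> is the derivative of \<open>f\<close> with respect to \<open>p\<close>,
  obtained without making \<open>p\<close> a coordinate.\<close>

definition deriv_along :: "(complex \<times> complex \<Rightarrow> complex \<times> complex) \<Rightarrow> (complex \<times> complex \<Rightarrow> complex) \<Rightarrow>
    complex \<Rightarrow> complex \<times> complex \<Rightarrow> bool" where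
  "deriv_along \<pi> f k z \<longleftrightarrow> has_grad f (cscale k (\<pi> z)) z"

text \<open>The basic functions of the foliation \<open>\<pi> = 0\<close>, that is, those locally
  constant along its leaves. For \<open>\<pi> = dp\<close> they are locally the functions of
  \<open>p\<close>.\<close>

definition basic :: "(complex \<times> complex) set \<Rightarrow> (complex \<times> complex \<Rightarrow> complex \<times> complex) \<Rightarrow>
    (complex \<times> complex \<Rightarrow> complex) \<Rightarrow> bool" where
  "basic U \<pi> f \<longleftrightarrow> open U \<and> (\<forall>z\<in>U. \<exists>k. deriv_along \<pi> f k z)"

lemma cscale_alg: "cscale a v + cscale b v = cscale (a + b) v" "cscale a v - cscale b v = cscale (a - b) v"
  "cscale a (cscale b v) = cscale (a * b) v"
  by (simp_all add: cscale_def algebra_simps)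

lemma basic_holomorphic2: "basic U \<pi> f \<Longrightarrow> holomorphic2 U f"
  unfolding basic_def deriv_along_def holomorphic2_iff by blast

lemma basic_const: "open U \<Longrightarrow> basic U \<pi> (\<lambda>z. c)"
proof -
  assume "open U"
  moreover have "has_grad (\<lambda>z. c) (cscale 0 (\<pi> z)) z" for z
    using has_grad_const[of c z] by (simp add: cscale_def zero_prod_def)
  ultimately show ?thesis unfolding basic_def deriv_along_def by blast
qed

lemma deriv_along_add:
  "deriv_along \<pi> f k z \<Longrightarrow> deriv_along \<pi> g l z \<Longrightarrow> deriv_along \<pi> (\<lambda>z. f z + g z) (k + l) z"
  unfolding deriv_along_def cscale_alg(1)[symmetric] by (rule has_grad_add)

lemma deriv_along_diff:
  "deriv_along \<pi> f k z \<Longrightarrow> deriv_along \<pi> g l z \<Longrightarrow> deriv_along \<pi> (\<lambda>z. f z - g z) (k - l) z"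
  unfolding deriv_along_def cscale_alg(2)[symmetric] by (rule has_grad_diff)

lemma deriv_along_mult:
  "deriv_along \<pi> f k z \<Longrightarrow> deriv_along \<pi> g l z \<Longrightarrow>
   deriv_along \<pi> (\<lambda>z. f z * g z) (f z * l + g z * k) z"
  unfolding deriv_along_def cscale_alg(1,3)[symmetric] by (rule has_grad_mult)

lemma deriv_along_inverse:
  "deriv_along \<pi> f k z \<Longrightarrow> f z \<noteq> 0 \<Longrightarrow>
   deriv_along \<pi> (\<lambda>z. inverse (f z)) (- (inverse (f z))\<^sup>2 * k) z"
  unfolding deriv_along_def cscale_alg(3)[symmetric] by (rule has_grad_inverse)

lemma deriv_along_poly:
  "deriv_along \<pi> f k z \<Longrightarrow> deriv_along \<pi> (\<lambda>z. poly r (f z)) (poly (pderiv r) (f z) * k) z"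
  unfolding deriv_along_def cscale_alg(3)[symmetric] by (rule has_grad_poly)

lemma basic_add: "basic U \<pi> f \<Longrightarrow> basic U \<pi> g \<Longrightarrow> basic U \<pi> (\<lambda>z. f z + g z)"
  unfolding basic_def by (blast intro: deriv_along_add)

lemma basic_diff: "basic U \<pi> f \<Longrightarrow> basic U \<pi> g \<Longrightarrow> basic U \<pi> (\<lambda>z. f z - g z)"
  unfolding basic_def by (blast intro: deriv_along_diff)

lemma basic_mult: "basic U \<pi> f \<Longrightarrow> basic U \<pi> g \<Longrightarrow> basic U \<pi> (\<lambda>z. f z * g z)"
  unfolding basic_def by (blast intro: deriv_along_mult)

lemma basic_divide:
  assumes "basic U \<pi> f" "basic U \<pi> g" "\<And>z. z \<in> U \<Longrightarrow> g z \<noteq> 0"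
  shows "basic U \<pi> (\<lambda>z. f z / g z)"
proof -
  have "basic U \<pi> (\<lambda>z. inverse (g z))"
    using assms(2,3) unfolding basic_def by (blast intro: deriv_along_inverse)
  then show ?thesis unfolding divide_inverse by (rule basic_mult[OF assms(1)])
qed

lemma basic_poly: "basic U \<pi> f \<Longrightarrow> basic U \<pi> (\<lambda>z. poly r (f z))"
  unfolding basic_def by (blast intro: deriv_along_poly)

text \<open>\<open>E\<^sub>1 = d\<mu>\<^sub>1\<close> and \<open>E\<^sub>2 = dm\<close> for affine coordinates \<open>(\<mu>\<^sub>1, m)\<close> of the dual plane, \<open>p = - \<mu>\<^sub>1 / m\<close> and \<open>\<pi> = dp\<close>.\<close>

locale slope_coframe =
  fixes U :: "(complex \<times> complex) set" and E1 E2 \<pi> :: form1 and m p :: "complex \<times> complex \<Rightarrow> complex"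
  assumes open_U: "open U"
    and hol: "holomorphic_form U E1" "holomorphic_form U E2"
    and closed: "\<And>z. z \<in> U \<Longrightarrow> ext_deriv E1 z = 0" "\<And>z. z \<in> U \<Longrightarrow> ext_deriv E2 z = 0"
    and grad_m: "\<And>z. z \<in> U \<Longrightarrow> has_grad m (E2 z) z"
    and m_nz: "\<And>z. z \<in> U \<Longrightarrow> m z \<noteq> 0"
    and grad_p: "\<And>z. z \<in> U \<Longrightarrow> deriv_along \<pi> p 1 z"
    and \<pi>_eq: "\<And>z. z \<in> U \<Longrightarrow> \<pi> z = cscale (- 1 / m z) (E1 z + cscale (p z) (E2 z))"
begin

definition slope_form :: "(complex \<times> complex \<Rightarrow> complex) \<Rightarrow> form1" where
  "slope_form t z = E1 z + cscale (t z) (E2 z)"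

lemma hol_m: "holomorphic2 U m" and basic_p: "basic U \<pi> p"
  using grad_m grad_p open_U unfolding holomorphic2_iff basic_def by blast+

lemma hol_slope_form: "holomorphic2 U t \<Longrightarrow> holomorphic_form U (slope_form t)"
  unfolding slope_form_def[abs_def] by (intro holomorphic_form_add holomorphic_form_scale hol)

lemma hol_\<pi>: "holomorphic_form U \<pi>"
proof (rule holomorphic_form_cong)
  show "holomorphic_form U (\<lambda>z. cscale (- 1 / m z) (slope_form p z))"
    using m_nz by (intro holomorphic_form_scale hol_slope_form basic_holomorphic2[OF basic_p]
        holomorphic2_divide holomorphic2_const open_U hol_m)
qed (simp add: \<pi>_eq slope_form_def)

text \<open>The source of all factors \<open>p - t\<close>: up to \<open>- 1 / m\<close> the form
  \<open>\<pi>\<close> is itself the slope form of slope \<open>p\<close>.\<close>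

lemma wedge_\<pi>: "z \<in> U \<Longrightarrow> wedge (cscale c (\<pi> z)) (slope_form t z) = c * (p z - t z) / m z * wedge (E1 z) (E2 z)"
  "z \<in> U \<Longrightarrow> wedge (cscale c (\<pi> z)) (E2 z) = - c / m z * wedge (E1 z) (E2 z)"
  using m_nz[of z] by (auto simp: \<pi>_eq slope_form_def wedge_def field_simps)

text \<open>Closedness is computed from \<open>\<pi> = - (E1 + p E2) / m\<close>, using first
  derivatives of \<open>m\<close> and \<open>p\<close> only, instead of the symmetry of second
  derivatives.\<close>

lemma ext_deriv_\<pi>: "z \<in> U \<Longrightarrow> ext_deriv \<pi> z = 0"
proof -
  assume z: "z \<in> U"
  have g1: "has_grad (\<lambda>z. - 1 / m z) (cscale (1 / (m z)^2) (E2 z)) z"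
    using has_grad_mult[OF has_grad_const[of "-1"] has_grad_inverse[OF grad_m[OF z] m_nz[OF z]]]
    by (simp add: divide_inverse cscale_def power2_eq_square zero_prod_def)
  have g2: "has_grad p (\<pi> z) z"
    using grad_p[OF z] by (simp add: deriv_along_def cscale_def)
  have h2: "holomorphic_form U (\<lambda>z. cscale (p z) (E2 z))"
    by (intro holomorphic_form_scale basic_holomorphic2[OF basic_p] hol)
  have "ext_deriv (\<lambda>z. cscale (- 1 / m z) (slope_form p z)) z
      = wedge (cscale (1 / (m z)^2) (E2 z)) (slope_form p z) - wedge (\<pi> z) (E2 z) / m z"
    by (subst ext_deriv_scale[OF hol_slope_form[OF basic_holomorphic2[OF basic_p]] z g1])
      (simp add: slope_form_def[abs_def] ext_deriv_add[OF hol(1) h2 z] ext_deriv_scale[OF hol(2) z g2]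
        closed z)
  also have "\<dots> = 0"
    using wedge_\<pi>(2)[OF z, of 1] m_nz[OF z]
    by (simp add: slope_form_def wedge_def field_simps power2_eq_square) algebra
  finally have 0: "ext_deriv (\<lambda>z. cscale (- 1 / m z) (slope_form p z)) z = 0" .
  obtain a b where ab: "has_grad (\<lambda>z. fst (\<pi> z)) a z" "has_grad (\<lambda>z. snd (\<pi> z)) b z"
    using holomorphic_formD[OF hol_\<pi> z] .
  have "has_grad (\<lambda>z. fst (cscale (- 1 / m z) (slope_form p z))) a z"
    "has_grad (\<lambda>z. snd (cscale (- 1 / m z) (slope_form p z))) b z"
    using has_grad_cong_open[OF ab(1) open_U z] has_grad_cong_open[OF ab(2) open_U z] \<pi>_eq
    by (simp_all add: slope_form_def)
  from ext_deriv_eq[OF this] ext_deriv_eq[OF ab] 0 show ?thesis by simp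
qed

lemma ext_deriv_slope_form:
  assumes z: "z \<in> U" and g: "deriv_along \<pi> g \<gamma> z" and t: "deriv_along \<pi> t \<tau> z" "holomorphic2 U t"
  shows "ext_deriv (\<lambda>z. cscale (g z) (slope_form t z)) z
    = (\<gamma> * (p z - t z) - g z * \<tau>) / m z * wedge (E1 z) (E2 z)"
proof -
  have h2: "holomorphic_form U (\<lambda>z. cscale (t z) (E2 z))"
    by (intro holomorphic_form_scale t hol)
  have "ext_deriv (slope_form t) z = wedge (cscale \<tau> (\<pi> z)) (E2 z)"
    using ext_deriv_add[OF hol(1) h2 z] ext_deriv_scale[OF hol(2) z t(1)[unfolded deriv_along_def]]
    by (simp add: slope_form_def[abs_def] closed z)
  then show ?thesis
    using ext_deriv_scale[OF hol_slope_form[OF t(2)] z g[unfolded deriv_along_def]] m_nz[OF z]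
    by (simp add: wedge_\<pi>[OF z] field_simps)
qed

end

text \<open>The Lagrange basis polynomial for the node \<open>t1\<close> among \<open>t1\<close>,
  \<open>t2\<close>, \<open>t3\<close>, evaluated at \<open>p\<close>.\<close>

definition lagrange2 :: "complex \<Rightarrow> complex \<Rightarrow> complex \<Rightarrow> complex \<Rightarrow> complex" where
  "lagrange2 p t1 t2 t3 = (p - t2) * (p - t3) / ((t1 - t2) * (t1 - t3))"

text \<open>This is \<open>- Q(p)\<close>, where \<open>Q\<close> is the polynomial of degree at
  most 2 with the values \<open>s1\<close>, \<open>s2\<close>, \<open>s3\<close> at
  \<open>t1\<close>, \<open>t2\<close>, \<open>t3\<close>.\<close>

definition eta_b :: "complex \<Rightarrow> complex \<Rightarrow> complex \<Rightarrow> complex \<Rightarrow> complex \<Rightarrow> complex \<Rightarrow> complex \<Rightarrow> complex" where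
  "eta_b p t1 t2 t3 s1 s2 s3 =
     - (s1 * lagrange2 p t1 t2 t3 + s2 * lagrange2 p t2 t1 t3 + s3 * lagrange2 p t3 t1 t2)"

text \<open>With the same \<open>Q\<close>, the sum of the divided differences
  \<open>Q[t1, p]\<close> and \<open>Q[t2, t3]\<close>: the last bracket is the leading coefficient
  of \<open>Q\<close>, and \<open>Q[t1, p] = Q[t1, t2] + (p - t2) Q[t1, t2, t3]\<close>. The value
  is symmetric in the three nodes.\<close>

definition eta_a :: "complex \<Rightarrow> complex \<Rightarrow> complex \<Rightarrow> complex \<Rightarrow> complex \<Rightarrow> complex \<Rightarrow> complex \<Rightarrow> complex" where
  "eta_a p t1 t2 t3 s1 s2 s3 = (s1 - s2) / (t1 - t2) + (s2 - s3) / (t2 - t3)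
     + (p - t2) * (s1 / ((t1 - t2) * (t1 - t3)) + s2 / ((t2 - t1) * (t2 - t3)) + s3 / ((t3 - t1) * (t3 - t2)))"

text \<open>These are the equations
  \<open>d\<omega>\<^sub>i = \<eta> \<and> \<omega>\<^sub>i\<close> for
  \<open>\<omega>\<^sub>1 = (t2 - t3) (E1 + t1 E2)\<close> and its cyclic mates, with the factor
  \<open>E1 \<and> E2 / m\<close> removed. Divided by \<open>t2 - t3\<close>, the first one reads
  \<open>Q[t1, p] (p - t1) = Q(p) - Q(t1)\<close>.\<close>

lemma eta_identity:
  fixes p t1 t2 t3 s1 s2 s3 :: complex
  assumes "t1 \<noteq> t2" "t2 \<noteq> t3" "t1 \<noteq> t3"
  defines "a \<equiv> eta_a p t1 t2 t3 s1 s2 s3" and "b \<equiv> eta_b p t1 t2 t3 s1 s2 s3"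
  shows "(t2 - t3) * (a * (p - t1) + b) = (s2 - s3) * (p - t1) - (t2 - t3) * s1"
    and "(t3 - t1) * (a * (p - t2) + b) = (s3 - s1) * (p - t2) - (t3 - t1) * s2"
    and "(t1 - t2) * (a * (p - t3) + b) = (s1 - s2) * (p - t3) - (t1 - t2) * s3"
proof -
  define x y w where "x = 1 / (t1 - t2)" and "y = 1 / (t2 - t3)" and "w = 1 / (t1 - t3)"
  have xyw: "(t1 - t2) * x = 1" "(t2 - t3) * y = 1" "(t1 - t3) * w = 1"
    using assms by (auto simp: x_def y_def w_def)
  have m: "1 / (t2 - t1) = - x" "1 / (t3 - t2) = - y" "1 / (t3 - t1) = - w"
    using assms by (auto simp: x_def y_def w_def field_simps)
  have a: "a = (s1 - s2) * x + (s2 - s3) * y + (p - t2) * (s1 * x * w - s2 * x * y + s3 * w * y)"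
    unfolding a_def eta_a_def using m
    by (simp add: divide_inverse x_def y_def w_def)
  have b: "b = - (s1 * (p - t2) * (p - t3) * x * w - s2 * (p - t1) * (p - t3) * x * y
      + s3 * (p - t1) * (p - t2) * w * y)"
    unfolding b_def eta_b_def lagrange2_def using m
    by (simp add: divide_inverse x_def y_def w_def)
  show "(t2 - t3) * (a * (p - t1) + b) = (s2 - s3) * (p - t1) - (t2 - t3) * s1"
    unfolding a b using xyw by algebra
  show "(t3 - t1) * (a * (p - t2) + b) = (s3 - s1) * (p - t2) - (t3 - t1) * s2"
    unfolding a b using xyw by algebra
  show "(t1 - t2) * (a * (p - t3) + b) = (s1 - s2) * (p - t3) - (t1 - t2) * s3"
    unfolding a b using xyw by algebra
qed

text \<open>Each triple contributes one term per member. Grouped by that member \<open>i\<close>,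
  the terms run over unordered pairs of other indices, while the sum of \<open>a i j * a i l\<close>
  over ordered pairs of distinct indices is the square of the sum minus the sum of squares. This
  accounts for the factor 1/2.\<close>

lemma sum_triples_eta_b:
  fixes t \<tau> :: "nat \<Rightarrow> complex"
  assumes inj: "inj_on t {..<d}"
  shows "(\<Sum>(i, j, l)\<in>{(i, j, l). i < j \<and> j < l \<and> l < d}. eta_b p (t i) (t j) (t l) (\<tau> i) (\<tau> j) (\<tau> l))
    = - (1 / 2) * (\<Sum>i<d. \<tau> i * sym2 (t ` {..<d}) p (t i))"
proof -
  define g where "g i j l = \<tau> i * lagrange2 p (t i) (t j) (t l)" for i j l
  define a where "a i j = (p - t j) / (t i - t j)" for i j
  define T where "T = {(i, j, l). i < j \<and> j < l \<and> l < (d::nat)}"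
  define Q where "Q = {(i, j, l). i < d \<and> j < d \<and> l < (d::nat) \<and> i \<noteq> j \<and> i \<noteq> l \<and> j \<noteq> l}"
  have Qsub: "Q \<subseteq> {..<d} \<times> {..<d} \<times> {..<d}" by (auto simp: Q_def)
  have fin: "finite Q" by (rule finite_subset[OF Qsub]) auto
  have g_sym: "g i l j = g i j l" for i j l
    by (simp add: g_def lagrange2_def mult.commute)
  let ?g = "\<lambda>(i, j, l). g i j l"
  have split: "(\<Sum>x\<in>Q. ?g x) = (\<Sum>x\<in>{(i, j, l)\<in>Q. j < l}. ?g x) + (\<Sum>x\<in>{(i, j, l)\<in>Q. l < j}. ?g x)"
    by (subst sum.union_disjoint[symmetric]) (auto intro!: sum.cong finite_subset[OF _ fin] simp: Q_def)
  have sw: "(\<Sum>x\<in>{(i, j, l)\<in>Q. l < j}. ?g x) = (\<Sum>x\<in>{(i, j, l)\<in>Q. j < l}. ?g x)"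
    by (rule sum.reindex_bij_witness[of _ "\<lambda>(i, j, l). (i, l, j)" "\<lambda>(i, j, l). (i, l, j)"])
      (auto simp: Q_def g_sym)
  \<comment> \<open>The distinguished index \<open>i\<close> lies below, between or above
    \<open>j < l\<close>; each case is reindexed by the increasing triples \<open>T\<close>.\<close>
  have "(\<Sum>x\<in>{(i, j, l)\<in>Q. j < l}. ?g x) =
      (\<Sum>x\<in>{(i, j, l)\<in>Q. i < j \<and> j < l} \<union> {(i, j, l)\<in>Q. j < i \<and> i < l} \<union> {(i, j, l)\<in>Q. j < l \<and> l < i}. ?g x)"
    by (rule sum.cong) (auto simp: Q_def)
  also have "\<dots> = (\<Sum>x\<in>{(i, j, l)\<in>Q. i < j \<and> j < l}. ?g x) + (\<Sum>x\<in>{(i, j, l)\<in>Q. j < i \<and> i < l}. ?g x)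
      + (\<Sum>x\<in>{(i, j, l)\<in>Q. j < l \<and> l < i}. ?g x)"
    by (subst sum.union_disjoint, (auto intro!: finite_subset[OF _ fin])[3],
        subst sum.union_disjoint) (auto intro!: finite_subset[OF _ fin])
  also have "(\<Sum>x\<in>{(i, j, l)\<in>Q. i < j \<and> j < l}. ?g x) = (\<Sum>(i, j, l)\<in>T. g i j l)"
    by (rule sum.cong) (auto simp: Q_def T_def)
  also have "(\<Sum>x\<in>{(i, j, l)\<in>Q. j < i \<and> i < l}. ?g x) = (\<Sum>(i, j, l)\<in>T. g j i l)"
    by (rule sum.reindex_bij_witness[of _ "\<lambda>(i, j, l). (j, i, l)" "\<lambda>(i, j, l). (j, i, l)"])
      (auto simp: Q_def T_def)
  also have "(\<Sum>x\<in>{(i, j, l)\<in>Q. j < l \<and> l < i}. ?g x) = (\<Sum>(i, j, l)\<in>T. g l i j)"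
    by (rule sum.reindex_bij_witness[of _ "\<lambda>(i, j, l). (l, i, j)" "\<lambda>(i, j, l). (j, l, i)"])
      (auto simp: Q_def T_def)
  finally have half: "(\<Sum>x\<in>{(i, j, l)\<in>Q. j < l}. ?g x)
      = (\<Sum>(i, j, l)\<in>T. g i j l + g j i l + g l i j)"
    by (simp add: split_def sum.distrib)
  have "(\<Sum>x\<in>Q. ?g x) = (\<Sum>i<d. \<Sum>j\<in>{..<d}-{i}. \<Sum>l\<in>{..<d}-{i}-{j}. g i j l)"
    by (simp add: sum.Sigma) (rule sum.cong, auto simp: Q_def)
  also have "\<dots> = (\<Sum>i<d. \<tau> i * sym2 (t ` {..<d}) p (t i))"
  proof (rule sum.cong)
    fix i assume i: "i \<in> {..<d}"
    let ?I = "{..<d} - {i}"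
    have img: "t ` {..<d} - {t i} = t ` ?I"
      using inj i by (auto simp: inj_on_def)
    have injI: "inj_on t ?I" using inj by (rule inj_on_subset) auto
    have "(\<Sum>j\<in>?I. \<Sum>l\<in>?I-{j}. g i j l) = (\<Sum>j\<in>?I. \<tau> i * (a i j * ((\<Sum>l\<in>?I. a i l) - a i j)))"
    proof (rule sum.cong)
      fix j assume j: "j \<in> ?I"
      have "g i j l = \<tau> i * a i j * a i l" for l
        by (simp add: g_def lagrange2_def a_def mult.assoc)
      then have "(\<Sum>l\<in>?I-{j}. g i j l) = \<tau> i * a i j * (\<Sum>l\<in>?I-{j}. a i l)"
        by (simp add: sum_distrib_left)
      also have "(\<Sum>l\<in>?I-{j}. a i l) = (\<Sum>l\<in>?I. a i l) - a i j"
        using j by (subst sum_diff1) auto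
      finally show "(\<Sum>l\<in>?I-{j}. g i j l) = \<tau> i * (a i j * ((\<Sum>l\<in>?I. a i l) - a i j))" by simp
    qed auto
    also have "\<dots> = \<tau> i * ((\<Sum>j\<in>?I. a i j)\<^sup>2 - (\<Sum>j\<in>?I. (a i j)\<^sup>2))"
      unfolding sum_distrib_left[symmetric] right_diff_distrib sum_subtractf sum_distrib_right[symmetric]
        power2_eq_square ..
    also have "\<dots> = \<tau> i * sym2 (t ` {..<d}) p (t i)"
      unfolding sym2_def img by (simp add: sum.reindex[OF injI] a_def)
    finally show "(\<Sum>j\<in>?I. \<Sum>l\<in>?I-{j}. g i j l) = \<tau> i * sym2 (t ` {..<d}) p (t i)" .
  qed auto
  finally have "(\<Sum>i<d. \<tau> i * sym2 (t ` {..<d}) p (t i)) = 2 * (\<Sum>(i, j, l)\<in>T. g i j l + g j i l + g l i j)"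
    using split sw half by simp
  moreover have "(\<Sum>(i, j, l)\<in>T. eta_b p (t i) (t j) (t l) (\<tau> i) (\<tau> j) (\<tau> l))
     = - (\<Sum>(i, j, l)\<in>T. g i j l + g j i l + g l i j)"
    unfolding sum_negf[symmetric] by (rule sum.cong) (auto simp: eta_b_def g_def)
  ultimately show ?thesis by (simp add: T_def)
qed

context slope_coframe
begin

text \<open>Weighting each slope form by the difference of the other two slopes makes the three
  forms add up to zero. The resulting \<open>d\<eta>\<close> is the derivative \<open>k\<close> of
  \<open>b\<close> times a factor that is the same for all triples, so curvatures are added by
  adding the \<open>k\<close>.\<close>

lemma web3_slopes:
  fixes t1 t2 t3 s1 s2 s3 :: "complex \<times> complex \<Rightarrow> complex"
  assumes d: "\<And>z. z \<in> U \<Longrightarrow> deriv_along \<pi> t1 (s1 z) z" "\<And>z. z \<in> U \<Longrightarrow> deriv_along \<pi> t2 (s2 z) z"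
      "\<And>z. z \<in> U \<Longrightarrow> deriv_along \<pi> t3 (s3 z) z"
    and s: "basic U \<pi> s1" "basic U \<pi> s2" "basic U \<pi> s3"
    and neq: "\<And>z. z \<in> U \<Longrightarrow> t1 z \<noteq> t2 z" "\<And>z. z \<in> U \<Longrightarrow> t2 z \<noteq> t3 z" "\<And>z. z \<in> U \<Longrightarrow> t1 z \<noteq> t3 z"
    and w: "\<And>z. z \<in> U \<Longrightarrow> wedge (E1 z) (E2 z) \<noteq> 0"
    and \<theta>: "\<And>z. z \<in> U \<Longrightarrow> wedge (slope_form t1 z) (\<theta>1 z) = 0"
      "\<And>z. z \<in> U \<Longrightarrow> wedge (slope_form t2 z) (\<theta>2 z) = 0"
      "\<And>z. z \<in> U \<Longrightarrow> wedge (slope_form t3 z) (\<theta>3 z) = 0"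
  defines "a \<equiv> \<lambda>z. eta_a (p z) (t1 z) (t2 z) (t3 z) (s1 z) (s2 z) (s3 z)"
    and "b \<equiv> \<lambda>z. eta_b (p z) (t1 z) (t2 z) (t3 z) (s1 z) (s2 z) (s3 z)"
  defines "\<eta> \<equiv> \<lambda>z. cscale (a z) (\<pi> z) + cscale (- b z / m z) (E2 z)"
  shows "web3_connection U \<theta>1 \<theta>2 \<theta>3 \<eta>" "basic U \<pi> b"
    "\<And>z k. z \<in> U \<Longrightarrow> deriv_along \<pi> b k z \<Longrightarrow> ext_deriv \<eta> z = k / (m z)\<^sup>2 * wedge (E1 z) (E2 z)"
proof -
  have t: "basic U \<pi> t1" "basic U \<pi> t2" "basic U \<pi> t3"
    using d open_U unfolding basic_def by blast+
  note ht = t[THEN basic_holomorphic2]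
  have ba: "basic U \<pi> a" and bb: "basic U \<pi> b"
    unfolding a_def b_def eta_a_def eta_b_def lagrange2_def minus_mult_left diff_0[symmetric]
    by (intro basic_add basic_diff basic_mult basic_divide s t basic_p basic_const open_U;
        use neq in \<open>force\<close>)+
  show "basic U \<pi> b" by (rule bb)
  have hbm: "holomorphic2 U (\<lambda>z. - b z / m z)"
    unfolding diff_0[symmetric] using m_nz
    by (intro holomorphic2_divide holomorphic2_diff holomorphic2_const open_U hol_m
        basic_holomorphic2[OF bb])
  have h1: "holomorphic_form U (\<lambda>z. cscale (a z) (\<pi> z))"
    "holomorphic_form U (\<lambda>z. cscale (- b z / m z) (E2 z))"
    by (intro holomorphic_form_scale basic_holomorphic2[OF ba] hol_\<pi> hbm hol)+
  show ext: "ext_deriv \<eta> z = k / (m z)\<^sup>2 * wedge (E1 z) (E2 z)"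
    if z: "z \<in> U" and k: "deriv_along \<pi> b k z" for z k
  proof -
    obtain l where l: "has_grad a (cscale l (\<pi> z)) z"
      using ba z unfolding basic_def deriv_along_def by blast
    have "has_grad (\<lambda>z. - b z * inverse (m z))
       (cscale (- b z) (cscale (- (inverse (m z))\<^sup>2) (E2 z)) + cscale (inverse (m z)) (- cscale k (\<pi> z))) z"
      using k has_grad_diff[OF has_grad_const[of 0 z], of b] has_grad_inverse[OF grad_m[OF z] m_nz[OF z]]
      unfolding deriv_along_def by (intro has_grad_mult) auto
    then have g: "has_grad (\<lambda>z. - b z / m z)
       (cscale (- b z) (cscale (- (inverse (m z))\<^sup>2) (E2 z)) + cscale (inverse (m z)) (- cscale k (\<pi> z))) z"
      by (simp add: divide_inverse)
    \<comment> \<open>The first term vanishes since \<open>a\<close> is basic and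
      \<open>\<pi>\<close> is closed. In the second, the part coming from \<open>1 / m\<close> is a
      multiple of \<open>E2\<close> and vanishes too.\<close>
    have "ext_deriv \<eta> z = wedge (cscale l (\<pi> z)) (\<pi> z)
       + wedge (cscale (- b z) (cscale (- (inverse (m z))\<^sup>2) (E2 z)) + cscale (inverse (m z)) (- cscale k (\<pi> z))) (E2 z)"
      unfolding \<eta>_def ext_deriv_add[OF h1 z] ext_deriv_scale[OF hol_\<pi> z l] ext_deriv_scale[OF hol(2) z g]
      by (simp add: ext_deriv_\<pi>[OF z] closed z)
    also have "\<dots> = - (1 / m z) * wedge (cscale k (\<pi> z)) (E2 z)"
      by (simp add: wedge_def algebra_simps divide_inverse)
    finally show ?thesis
      by (simp add: wedge_\<pi>[OF z] power2_eq_square)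
  qed
  define \<omega>1 where "\<omega>1 z = cscale (t2 z - t3 z) (slope_form t1 z)" for z
  define \<omega>2 where "\<omega>2 z = cscale (t3 z - t1 z) (slope_form t2 z)" for z
  define \<omega>3 where "\<omega>3 z = cscale (t1 z - t2 z) (slope_form t3 z)" for z
  have snz: "slope_form u z \<noteq> 0" if "z \<in> U" for u z
  proof
    assume "slope_form u z = 0"
    then have "wedge (slope_form u z) (E2 z) = 0" by (simp add: wedge_def zero_prod_def)
    then show False using w[OF that] by (simp add: slope_form_def wedge_def algebra_simps)
  qed
  have cs: "cscale c v \<noteq> 0" if "c \<noteq> 0" "v \<noteq> 0" for c v
    using that by (auto simp: cscale_def prod_eq_iff)
  have same: "defines_same_foliation U (\<lambda>z. cscale (g z) (slope_form u z)) \<theta>"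
    if "holomorphic2 U g" "holomorphic2 U u" "\<And>z. z \<in> U \<Longrightarrow> g z \<noteq> 0"
      "\<And>z. z \<in> U \<Longrightarrow> wedge (slope_form u z) (\<theta> z) = 0" for g u \<theta>
  proof -
    have wc: "wedge (cscale c v) w' = c * wedge v w'" for c v w' by (simp add: wedge_def algebra_simps)
    show ?thesis
      unfolding defines_same_foliation_def
    proof (intro conjI ballI)
      show "holomorphic_form U (\<lambda>z. cscale (g z) (slope_form u z))"
        by (intro holomorphic_form_scale hol_slope_form that)
      fix z assume z: "z \<in> U"
      show "cscale (g z) (slope_form u z) \<noteq> 0" by (intro cs snz that z)
      show "wedge (cscale (g z) (slope_form u z)) (\<theta> z) = 0" unfolding wc using that(4)[OF z] by simp
    qed
  qed
  have eta_wedge: "wedge (\<eta> z) (cscale g (slope_form u z))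
      = g * (a z * (p z - u z) + b z) / m z * wedge (E1 z) (E2 z)" if "z \<in> U" for z g u
  proof -
    have "wedge (\<eta> z) (cscale g (slope_form u z)) = g * (wedge (cscale (a z) (\<pi> z)) (slope_form u z)
       - b z / m z * wedge (E2 z) (slope_form u z))"
      by (simp add: \<eta>_def wedge_def algebra_simps)
    also have "wedge (E2 z) (slope_form u z) = - wedge (E1 z) (E2 z)"
      by (simp add: slope_form_def wedge_def algebra_simps)
    finally show ?thesis
      using m_nz[OF that] by (simp add: wedge_\<pi>[OF that] field_simps)
  qed
  show "web3_connection U \<theta>1 \<theta>2 \<theta>3 \<eta>"
    unfolding web3_connection_def
  proof (intro conjI exI ballI)
    show "holomorphic_form U \<eta>" unfolding \<eta>_def by (rule holomorphic_form_add[OF h1])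
    show "defines_same_foliation U \<omega>1 \<theta>1"
      unfolding \<omega>1_def[abs_def]
      by (rule same[OF holomorphic2_diff[OF ht(2,3)] ht(1) _ \<theta>(1)]) (use neq in force)
    show "defines_same_foliation U \<omega>2 \<theta>2"
      unfolding \<omega>2_def[abs_def]
      by (rule same[OF holomorphic2_diff[OF ht(3) ht(1)] ht(2) _ \<theta>(2)]) (use neq in force)
    show "defines_same_foliation U \<omega>3 \<theta>3"
      unfolding \<omega>3_def[abs_def]
      by (rule same[OF holomorphic2_diff[OF ht(1,2)] ht(3) _ \<theta>(3)]) (use neq in force)
    fix z assume z: "z \<in> U"
    show "\<omega>1 z + \<omega>2 z + \<omega>3 z = 0"
      by (simp add: \<omega>1_def \<omega>2_def \<omega>3_def slope_form_def prod_eq_iff algebra_simps)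
    have id: "(t2 z - t3 z) * (a z * (p z - t1 z) + b z) = (s2 z - s3 z) * (p z - t1 z) - (t2 z - t3 z) * s1 z"
      "(t3 z - t1 z) * (a z * (p z - t2 z) + b z) = (s3 z - s1 z) * (p z - t2 z) - (t3 z - t1 z) * s2 z"
      "(t1 z - t2 z) * (a z * (p z - t3 z) + b z) = (s1 z - s2 z) * (p z - t3 z) - (t1 z - t2 z) * s3 z"
      unfolding a_def b_def by (rule eta_identity[OF neq[OF z]])+
    show "ext_deriv \<omega>1 z = wedge (\<eta> z) (\<omega>1 z)"
      unfolding \<omega>1_def[abs_def] eta_wedge[OF z] id
      by (rule ext_deriv_slope_form[OF z deriv_along_diff[OF d(2)[OF z] d(3)[OF z]] d(1)[OF z] ht(1)])
    show "ext_deriv \<omega>2 z = wedge (\<eta> z) (\<omega>2 z)"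
      unfolding \<omega>2_def[abs_def] eta_wedge[OF z] id
      by (rule ext_deriv_slope_form[OF z deriv_along_diff[OF d(3)[OF z] d(1)[OF z]] d(2)[OF z] ht(2)])
    show "ext_deriv \<omega>3 z = wedge (\<eta> z) (\<omega>3 z)"
      unfolding \<omega>3_def[abs_def] eta_wedge[OF z] id
      by (rule ext_deriv_slope_form[OF z deriv_along_diff[OF d(1)[OF z] d(2)[OF z]] d(3)[OF z] ht(3)])
  qed
qed

text \<open>The \<open>\<tau> i\<close> are the derivatives of the slopes in \<open>p\<close>, by
  implicit differentiation of \<open>h0 + p h1 + p^2 h2 = 0\<close>. Being rational in
  \<open>p\<close> and the slope they are basic again, so the \<open>b\<close> of each triple can be
  differentiated. Degree 2 in \<open>p\<close> makes room for the line at infinity, which multiplies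
  \<open>a + p b\<close> by \<open>x - p\<close>.\<close>

lemma flat_of_const_trace:
  fixes t :: "nat \<Rightarrow> complex \<times> complex \<Rightarrow> complex" and h0 h1 h2 :: "complex poly"
  defines "\<tau> \<equiv> \<lambda>i z. - (poly h1 (t i z) + 2 * p z * poly h2 (t i z)) /
      (poly (pderiv h0) (t i z) + p z * poly (pderiv h1) (t i z) + (p z)\<^sup>2 * poly (pderiv h2) (t i z))"
  assumes dec: "decomposes d \<Phi> U \<theta>" and z0: "z0 \<in> U"
    and t: "\<And>i. i < d \<Longrightarrow> holomorphic2 U (t i)"
    and w: "\<And>z. z \<in> U \<Longrightarrow> wedge (E1 z) (E2 z) \<noteq> 0"
    and neq: "\<And>i j z. i < d \<Longrightarrow> j < d \<Longrightarrow> i \<noteq> j \<Longrightarrow> z \<in> U \<Longrightarrow> t i z \<noteq> t j z"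
    and par: "\<And>i z. i < d \<Longrightarrow> z \<in> U \<Longrightarrow> wedge (slope_form (t i) z) (\<theta> i z) = 0"
    and root: "\<And>i z. i < d \<Longrightarrow> z \<in> U \<Longrightarrow>
      poly h0 (t i z) + p z * poly h1 (t i z) + (p z)\<^sup>2 * poly h2 (t i z) = 0"
    and simple: "\<And>i z. i < d \<Longrightarrow> z \<in> U \<Longrightarrow>
      poly (pderiv h0) (t i z) + p z * poly (pderiv h1) (t i z) + (p z)\<^sup>2 * poly (pderiv h2) (t i z) \<noteq> 0"
    and const: "\<And>z. z \<in> U \<Longrightarrow>
      (\<Sum>i<d. \<tau> i z * sym2 ((\<lambda>i. t i z) ` {..<d}) (p z) (t i z)) = c"
  shows "web_curvature_at d \<Phi> z0 0"
proof -
  have dt: "deriv_along \<pi> (t i) (\<tau> i z) z" if i: "i < d" and z: "z \<in> U" for i z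
  proof -
    obtain g where g: "has_grad (t i) g z"
      using t[OF i] z unfolding holomorphic2_iff by blast
    have gp: "has_grad p (\<pi> z) z" using grad_p[OF z] by (simp add: deriv_along_def cscale_def)
    define x where "x = t i z"
    define hx where "hx = poly (pderiv h0) x + p z * poly (pderiv h1) x + (p z)\<^sup>2 * poly (pderiv h2) x"
    define hp where "hp = poly h1 x + 2 * p z * poly h2 x"
    let ?G = "cscale (poly (pderiv h0) x) g + (cscale (p z) (cscale (poly (pderiv h1) x) g)
        + cscale (poly h1 x) (\<pi> z)) + (cscale (p z * p z) (cscale (poly (pderiv h2) x) g)
        + cscale (poly h2 x) (cscale (p z) (\<pi> z) + cscale (p z) (\<pi> z)))"
    have "has_grad (\<lambda>z. poly h0 (t i z) + p z * poly h1 (t i z) + p z * p z * poly h2 (t i z)) ?G z"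
      unfolding x_def by (intro has_grad_add has_grad_mult has_grad_poly g gp)
    moreover have "has_grad (\<lambda>z. poly h0 (t i z) + p z * poly h1 (t i z) + p z * p z * poly h2 (t i z)) 0 z"
      by (rule has_grad_cong_open[OF has_grad_const[of 0] open_U z])
        (use root[OF i] in \<open>simp add: power2_eq_square\<close>)
    ultimately have "?G = 0" by (rule has_grad_unique)
    then have "hx * fst g + hp * fst (\<pi> z) = 0" "hx * snd g + hp * snd (\<pi> z) = 0"
      by (simp_all add: hx_def hp_def prod_eq_iff algebra_simps power2_eq_square)
    moreover have "hx \<noteq> 0" using simple[OF i z] by (simp add: hx_def x_def)
    ultimately have "g = cscale (- hp / hx) (\<pi> z)"
      by (simp add: prod_eq_iff field_simps eq_neg_iff_add_eq_0)
    with g show ?thesis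
      unfolding deriv_along_def \<tau>_def by (simp add: hp_def hx_def x_def)
  qed
  have bt: "basic U \<pi> (t i)" if "i < d" for i
    using dt[OF that] open_U unfolding basic_def by blast
  have b\<tau>: "basic U \<pi> (\<tau> i)" if "i < d" for i
    unfolding \<tau>_def power2_eq_square diff_0[symmetric]
    by (intro basic_add basic_diff basic_mult basic_divide basic_poly bt[OF that] basic_p basic_const open_U)
      (use simple[OF that] in \<open>simp add: power2_eq_square\<close>)
  define T where "T = {(i, j, l). i < j \<and> j < l \<and> l < d}"
  define b where "b i j l z = eta_b (p z) (t i z) (t j z) (t l z) (\<tau> i z) (\<tau> j z) (\<tau> l z)" for i j l z
  define \<eta> where "\<eta> i j l z = cscale (eta_a (p z) (t i z) (t j z) (t l z) (\<tau> i z) (\<tau> j z) (\<tau> l z)) (\<pi> z)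
      + cscale (- b i j l z / m z) (E2 z)" for i j l z
  note web3 = web3_slopes[OF dt dt dt b\<tau> b\<tau> b\<tau> neq neq neq w par par par]
  have conn: "web3_connection U (\<theta> i) (\<theta> j) (\<theta> l) (\<eta> i j l)"
    and bb: "basic U \<pi> (b i j l)"
    and ext: "\<And>z k. z \<in> U \<Longrightarrow> deriv_along \<pi> (b i j l) k z \<Longrightarrow>
      ext_deriv (\<eta> i j l) z = k / (m z)\<^sup>2 * wedge (E1 z) (E2 z)"
    if "(i, j, l) \<in> T" for i j l
    using that web3[of i j l] unfolding T_def b_def[abs_def] \<eta>_def[abs_def] by auto
  have "\<exists>k. deriv_along \<pi> (b i j l) k z0" if "(i, j, l) \<in> T" for i j l
    using bb[OF that] z0 unfolding basic_def by blast
  then obtain k where k: "\<And>i j l. (i, j, l) \<in> T \<Longrightarrow> deriv_along \<pi> (b i j l) (k i j l) z0"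
    by metis
  have "has_grad (\<lambda>z. \<Sum>(i, j, l)\<in>T. b i j l z) (\<Sum>(i, j, l)\<in>T. cscale (k i j l) (\<pi> z0)) z0"
    unfolding split_def using k unfolding deriv_along_def by (intro has_grad_sum) auto
  \<comment> \<open>Only the sum over all triples is known to be constant on \<open>U\<close>, not
    the single functions \<open>b i j l\<close>.\<close>
  moreover have "has_grad (\<lambda>z. \<Sum>(i, j, l)\<in>T. b i j l z) 0 z0"
  proof (rule has_grad_cong_open[OF has_grad_const[of "- (1 / 2) * c"] open_U z0])
    fix z assume z: "z \<in> U"
    have "inj_on (\<lambda>i. t i z) {..<d}"
      using neq[OF _ _ _ z] by (force simp: inj_on_def)
    from sum_triples_eta_b[OF this, of "p z" "\<lambda>i. \<tau> i z"] const[OF z]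
    show "- (1 / 2) * c = (\<Sum>(i, j, l)\<in>T. b i j l z)"
      by (simp add: T_def b_def)
  qed
  ultimately have sum0: "(\<Sum>(i, j, l)\<in>T. cscale (k i j l) (\<pi> z0)) = 0"
    by (rule has_grad_unique)
  have pi_nz: "\<pi> z0 \<noteq> 0"
  proof
    assume "\<pi> z0 = 0"
    then have "wedge (cscale 1 (\<pi> z0)) (E2 z0) = 0" by (simp add: wedge_def cscale_def)
    then show False using wedge_\<pi>(2)[OF z0, of 1] w[OF z0] m_nz[OF z0] by simp
  qed
  have "(\<Sum>(i, j, l)\<in>T. cscale (k i j l) (\<pi> z0)) = cscale (\<Sum>(i, j, l)\<in>T. k i j l) (\<pi> z0)"
    by (simp add: prod_eq_iff fst_sum snd_sum split_def sum_distrib_right)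
  with sum0 pi_nz have "(\<Sum>(i, j, l)\<in>T. k i j l) = 0"
    by (auto simp: prod_eq_iff)
  then have "(\<Sum>(i, j, l)\<in>T. k i j l) / (m z0)\<^sup>2 * wedge (E1 z0) (E2 z0) = 0" by simp
  then have "0 = (\<Sum>(i, j, l)\<in>T. ext_deriv (\<eta> i j l) z0)"
    unfolding sum_divide_distrib sum_distrib_right
    using ext[OF _ z0 k] by (auto simp: split_def intro!: sum.cong)
  then show ?thesis
    unfolding web_curvature_at_def T_def[symmetric]
    using dec z0 conn by (intro exI[of _ U] exI[of _ \<theta>] exI[of _ \<eta>]) (auto simp: T_def)
qed

end

section \<open>Homogeneous pre-foliations\<close>

no_notation fps_nth (infixl "$" 75)

section \<open>Binary and ternary forms as functions\<close>

definition eval_bform :: "nat \<Rightarrow> complex poly \<Rightarrow> complex \<Rightarrow> complex \<Rightarrow> complex" where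
  "eval_bform m r \<xi> \<eta> = (\<Sum>i\<le>m. coeff r i * \<xi> ^ i * \<eta> ^ (m - i))"

definition bform :: "nat \<Rightarrow> (complex \<Rightarrow> complex \<Rightarrow> complex) \<Rightarrow> bool" where
  "bform m g \<longleftrightarrow> (\<exists>r. degree r \<le> m \<and> (\<forall>\<xi> \<eta>. g \<xi> \<eta> = eval_bform m r \<xi> \<eta>))"

lemma eval_bform_nz:
  assumes "degree r \<le> m" "\<eta> \<noteq> 0"
  shows "eval_bform m r \<xi> \<eta> = \<eta> ^ m * poly r (\<xi> / \<eta>)"
proof -
  have "poly r (\<xi> / \<eta>) = (\<Sum>i\<le>m. coeff r i * (\<xi> / \<eta>) ^ i)"
    using assms(1) by (subst poly_altdef) (auto intro!: sum.mono_neutral_left intro: le_degree simp: coeff_eq_0)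
  then show ?thesis
    using assms(2)
    by (auto simp: eval_bform_def sum_distrib_left power_divide power_diff field_simps dest: le_degree intro!: sum.cong)
qed

lemma eval_bform_0: "eval_bform m r \<xi> 0 = coeff r m * \<xi> ^ m"
proof -
  have "eval_bform m r \<xi> 0 = (\<Sum>i\<le>m. if i = m then coeff r i * \<xi> ^ i else 0)"
    unfolding eval_bform_def by (intro sum.cong) (auto simp: power_0_left)
  then show ?thesis by simp
qed

lemma bform_const: "bform 0 (\<lambda>\<xi> \<eta>. c)"
  unfolding bform_def by (intro exI[of _ "[:c:]"]) (simp add: eval_bform_def)

lemma bform_linear: "bform 1 (\<lambda>\<xi> \<eta>. \<eta> * a + \<xi> * b)"
  unfolding bform_def by (intro exI[of _ "[:a, b:]"]) (simp add: eval_bform_def)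

lemma bform_add: "bform m g \<Longrightarrow> bform m h \<Longrightarrow> bform m (\<lambda>\<xi> \<eta>. g \<xi> \<eta> + h \<xi> \<eta>)"
  unfolding bform_def
  by (elim exE conjE, rule_tac x = "r + ra" in exI)
    (auto simp: eval_bform_def degree_add_le sum.distrib algebra_simps)

lemma bform_mult:
  assumes "bform m g" "bform n h"
  shows "bform (m + n) (\<lambda>\<xi> \<eta>. g \<xi> \<eta> * h \<xi> \<eta>)"
proof -
  obtain r s where r: "degree r \<le> m" "\<And>\<xi> \<eta>. g \<xi> \<eta> = eval_bform m r \<xi> \<eta>"
    and s: "degree s \<le> n" "\<And>\<xi> \<eta>. h \<xi> \<eta> = eval_bform n s \<xi> \<eta>"
    using assms unfolding bform_def by blast
  have d: "degree (r * s) \<le> m + n" by (rule degree_mult_le'[OF r(1) s(1)])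
  \<comment> \<open>At \<open>\<eta> = 0\<close> a binary form of degree \<open>m\<close> retains
    only its coefficient of degree \<open>m\<close>, so this place is compared through top
    coefficients.\<close>
  have top: "coeff (r * s) (m + n) = coeff r m * coeff s n"
  proof -
    have "coeff (r * s) (m + n) = (\<Sum>i\<le>m+n. if i = m then coeff r m * coeff s n else 0)"
      unfolding coeff_mult
    proof (rule sum.cong)
      fix i assume "i \<in> {..m+n}"
      then show "coeff r i * coeff s (m + n - i) = (if i = m then coeff r m * coeff s n else 0)"
        using r(1) s(1) by (cases i m rule: linorder_cases) (auto simp: coeff_eq_0)
    qed auto
    then show ?thesis by simp
  qed
  show ?thesis
    unfolding bform_def
  proof (intro exI[of _ "r * s"] conjI d allI)
    fix \<xi> \<eta>
    show "g \<xi> \<eta> * h \<xi> \<eta> = eval_bform (m + n) (r * s) \<xi> \<eta>"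
      by (cases "\<eta> = 0")
        (simp_all add: r(2) s(2) eval_bform_0 top power_add eval_bform_nz[OF r(1)]
          eval_bform_nz[OF s(1)] eval_bform_nz[OF d])
  qed
qed

lemma bform_power: "bform 1 g \<Longrightarrow> bform k (\<lambda>\<xi> \<eta>. g \<xi> \<eta> ^ k)"
proof (induction k)
  case (Suc k)
  then show ?case using bform_mult[of 1 g k "\<lambda>\<xi> \<eta>. g \<xi> \<eta> ^ k"] by simp
qed (simp add: bform_const)

lemma bform_zero: "bform m (\<lambda>\<xi> \<eta>. 0)"
  unfolding bform_def by (intro exI[of _ 0]) (simp add: eval_bform_def)

lemma bform_sum: "(\<And>i. i \<in> I \<Longrightarrow> bform m (g i)) \<Longrightarrow> bform m (\<lambda>\<xi> \<eta>. \<Sum>i\<in>I. g i \<xi> \<eta>)"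
  by (induction I rule: infinite_finite_induct) (auto intro: bform_zero bform_add)

text \<open>Being a form of degree \<open>m\<close> is tested on all parametrized planes. In this
  shape it passes through linear substitutions without composing polynomials.\<close>

definition form3 :: "nat \<Rightarrow> (complex^3 \<Rightarrow> complex) \<Rightarrow> bool" where
  "form3 m g \<longleftrightarrow> (\<forall>a b. bform m (\<lambda>\<xi> \<eta>. g (\<eta> *s a + \<xi> *s b)))"

lemma eval3_altdef:
  "eval3 P v = (\<Sum>i\<le>degree P. \<Sum>j\<le>degree (coeff P i). \<Sum>k\<le>degree (coeff (coeff P i) j).
      coeff (coeff (coeff P i) j) k * (v$3 ^ k * (v$2 ^ j * v$1 ^ i)))"
proof -
  have p: "[:a:] ^ i = [:a ^ i:]" for a :: "'a::comm_semiring_1" and i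
    by (induction i) (auto simp: one_pCons mult.commute)
  show ?thesis
    unfolding eval3_def
    by (simp add: poly_altdef[of P] poly_sum p poly_altdef[of "coeff P _"] sum_distrib_left
        poly_altdef[of "coeff (coeff P _) _"] mult_ac)
qed

lemma form3_eval3:
  assumes "homogeneous3 m P"
  shows "form3 m (eval3 P)"
  unfolding form3_def
proof (intro allI)
  fix a b :: "complex^3"
  have lin: "bform 1 (\<lambda>\<xi> \<eta>. (\<eta> *s a + \<xi> *s b) $ i)" for i
    using bform_linear[of "a$i" "b$i"] by simp
  show "bform m (\<lambda>\<xi> \<eta>. eval3 P (\<eta> *s a + \<xi> *s b))"
    unfolding eval3_altdef
  proof (intro bform_sum)
    fix i j k
    let ?v = "\<lambda>\<xi> \<eta>. \<eta> *s a + \<xi> *s b"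
    show "bform m (\<lambda>\<xi> \<eta>. coeff (coeff (coeff P i) j) k * (?v \<xi> \<eta> $ 3 ^ k * (?v \<xi> \<eta> $ 2 ^ j * ?v \<xi> \<eta> $ 1 ^ i)))"
    proof (cases "coeff (coeff (coeff P i) j) k = 0")
      case False
      then have "m = 0 + (k + (j + i))"
        using assms unfolding homogeneous3_def by force
      then show ?thesis
        by (simp only:) (intro bform_mult bform_const bform_power lin)
    qed (simp add: bform_zero)
  qed
qed

lemma form3_cmult: "form3 m g \<Longrightarrow> form3 m (\<lambda>v. c * g v)"
  unfolding form3_def using bform_mult[OF bform_const[of c], of m] by simp

lemma form3_sum: "(\<And>i. i \<in> I \<Longrightarrow> form3 m (g i)) \<Longrightarrow> form3 m (\<lambda>v. \<Sum>i\<in>I. g i v)"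
  unfolding form3_def by (auto intro: bform_sum)

lemma form3_linear: "form3 m g \<Longrightarrow> form3 m (\<lambda>v. g (A *v v))"
  unfolding form3_def by (simp add: matrix_vector_right_distrib vector_scalar_commute)

lemma form3_line:
  assumes "form3 m g"
  shows "\<exists>r. degree r \<le> m \<and> (\<forall>\<xi>. g (a + \<xi> *s b) = poly r \<xi>)"
proof -
  obtain r where r: "degree r \<le> m" "\<And>\<xi> \<eta>. g (\<eta> *s a + \<xi> *s b) = eval_bform m r \<xi> \<eta>"
    using assms unfolding form3_def bform_def by blast
  have "g (a + \<xi> *s b) = poly r \<xi>" for \<xi>
    using r(2)[of 1 \<xi>] eval_bform_nz[OF r(1), of 1 \<xi>] by simp
  then show ?thesis using r(1) by blast
qed

lemma form3_scale:
  assumes "form3 m g"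
  shows "g (c *s v) = c ^ m * g v"
proof -
  obtain r where r: "\<And>\<xi> \<eta>. g (\<eta> *s v + \<xi> *s 0) = eval_bform m r \<xi> \<eta>"
    using assms unfolding form3_def bform_def by blast
  have e: "eval_bform m r 0 \<eta> = coeff r 0 * \<eta> ^ m" for \<eta>
    unfolding eval_bform_def by (subst sum.remove[of _ 0]) (auto simp: power_0_left intro!: sum.neutral)
  show ?thesis using r[of c 0] r[of 1 0] by (simp add: e)
qed

section \<open>A foliation has no line of singular points\<close>

lemma poly2_eq_0:
  fixes Q :: "complex poly poly"
  assumes "\<And>y z. poly (poly Q [:y:]) z = 0"
  shows "Q = 0"
proof (rule ccontr)
  assume "Q \<noteq> 0"
  have "poly Q [:y:] = 0" for y using assms[of y] by (simp add: poly_all_0_iff_0[symmetric])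
  then have "range (\<lambda>y::complex. [:y:]) \<subseteq> {x. poly Q x = 0}" by auto
  then have "finite (range (\<lambda>y::complex. [:y:]))"
    using poly_roots_finite[OF \<open>Q \<noteq> 0\<close>] finite_subset by blast
  moreover have "inj (\<lambda>y::complex. [:y:])" by (auto simp: inj_def)
  ultimately show False using finite_imageD infinite_UNIV_char_0 by blast
qed

lemma poly_map_poly_eval:
  fixes Q :: "complex poly poly"
  shows "poly (map_poly (\<lambda>u. poly u z) Q) y = poly (poly Q [:y:]) z"
  by (induction Q) (auto simp: map_poly_pCons)

lemma eval3_map_poly:
  "poly (map_poly (\<lambda>q. poly (poly q [:y:]) z) P) x = poly (poly (poly P [:[:x:]:]) [:y:]) z"
  by (induction P) (auto simp: map_poly_pCons)

text \<open>The factor is the linear form itself, normalized at its first nonzero coefficient; the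
  cases follow the nesting of the variables. One \<open>h\<close> has to serve all \<open>P\<close>,
  since it is to be a common divisor of the three coefficients of a foliation.\<close>

lemma linear_factor:
  fixes P :: poly3 and l :: "complex^3"
  assumes "l \<noteq> 0"
  obtains h :: poly3 where "\<not> h dvd 1"
    "\<And>P. (\<And>v. l$1 * v$1 + l$2 * v$2 + l$3 * v$3 = 0 \<Longrightarrow> eval3 P v = 0) \<Longrightarrow> h dvd P"
proof -
  have vec: "eval3 P (vector [x, y, z]) = poly (poly (poly P [:[:x:]:]) [:y:]) z" for P x y z
    by (simp add: eval3_def)
  consider "l$1 \<noteq> 0" | "l$1 = 0" "l$2 \<noteq> 0" | "l$1 = 0" "l$2 = 0" "l$3 \<noteq> 0"
    using assms by (metis (full_types) exhaust_3 vec_eq_iff zero_index)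
  then show ?thesis
  proof cases
    case 1
    define \<rho> :: "complex poly poly" where "\<rho> = [:[:0, - l$3 / l$1:], [:- l$2 / l$1:]:]"
    have hom: "poly (poly (poly P \<rho>) [:y:]) z
        = poly (poly (poly P [:[:poly (poly \<rho> [:y:]) z:]:]) [:y:]) z" for P :: poly3 and y z
      by (induction P) auto
    show ?thesis
    proof (rule that[of "[:-\<rho>, 1:]"])
      show "\<not> [:-\<rho>, 1:] dvd 1"
        by (metis poly_1 poly_eq_0_iff_dvd zero_neq_one)
      fix P :: poly3 assume P: "\<And>v. l$1 * v$1 + l$2 * v$2 + l$3 * v$3 = 0 \<Longrightarrow> eval3 P v = 0"
      have "poly P \<rho> = 0"
      proof (rule poly2_eq_0)
        fix y z
        have "eval3 P (vector [poly (poly \<rho> [:y:]) z, y, z]) = 0"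
          using 1 by (intro P) (simp add: \<rho>_def field_simps)
        then show "poly (poly (poly P \<rho>) [:y:]) z = 0" by (simp add: hom vec)
      qed
      then show "[:-\<rho>, 1:] dvd P" by (simp add: poly_eq_0_iff_dvd)
    qed
  next
    case 2
    define \<rho> :: "complex poly" where "\<rho> = [:0, - l$3 / l$2:]"
    have hom: "poly (poly Q \<rho>) z = poly (poly Q [:poly \<rho> z:]) z" for Q :: "complex poly poly" and z
      by (induction Q) auto
    show ?thesis
    proof (rule that[of "[:[:-\<rho>, 1:]:]"])
      have "poly [:-\<rho>, 1:] \<rho> = 0" by simp
      then show "\<not> [:[:-\<rho>, 1:]:] dvd 1"
        by (metis const_poly_dvd_const_poly_iff one_pCons poly_1 poly_eq_0_iff_dvd zero_neq_one)
      fix P :: poly3 assume P: "\<And>v. l$1 * v$1 + l$2 * v$2 + l$3 * v$3 = 0 \<Longrightarrow> eval3 P v = 0"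
      have "poly (coeff P i) \<rho> = 0" for i
      proof -
        have "poly (poly (coeff P i) [:poly \<rho> z:]) z = 0" for z
        proof -
          have "map_poly (\<lambda>q. poly (poly q [:poly \<rho> z:]) z) P = 0"
            unfolding poly_all_0_iff_0[symmetric] eval3_map_poly vec[symmetric]
            using 2 by (intro allI P) (simp add: \<rho>_def)
          then have "coeff (map_poly (\<lambda>q. poly (poly q [:poly \<rho> z:]) z) P) i = 0" by simp
          then show ?thesis by (simp add: coeff_map_poly)
        qed
        then show ?thesis by (simp add: poly_all_0_iff_0[symmetric] hom)
      qed
      then show "[:[:-\<rho>, 1:]:] dvd P" by (simp add: const_poly_dvd_iff poly_eq_0_iff_dvd)
    qed
  next
    case 3
    show ?thesis
    proof (rule that[of "[:[:[:0, 1:]:]:]"])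
      show "\<not> [:[:[:0, 1::complex:]:]:] dvd 1"
        proof -
        have "\<not> [:0, 1::complex:] dvd 1"
          by (metis minus_zero poly_1 poly_eq_0_iff_dvd zero_neq_one)
        then show ?thesis by (simp add: one_pCons const_poly_dvd_const_poly_iff)
      qed
      fix P :: poly3 assume P: "\<And>v. l$1 * v$1 + l$2 * v$2 + l$3 * v$3 = 0 \<Longrightarrow> eval3 P v = 0"
      have "poly (coeff (coeff P i) j) 0 = 0" for i j
      proof -
        have "poly (poly (coeff P i) [:y:]) 0 = 0" for y
        proof -
          have "map_poly (\<lambda>q. poly (poly q [:y:]) 0) P = 0"
            unfolding poly_all_0_iff_0[symmetric] eval3_map_poly vec[symmetric]
            using 3 by (intro allI P) simp
          then have "coeff (map_poly (\<lambda>q. poly (poly q [:y:]) 0) P) i = 0" by simp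
          then show ?thesis by (simp add: coeff_map_poly)
        qed
        then have "map_poly (\<lambda>u. poly u 0) (coeff P i) = 0"
          unfolding poly_all_0_iff_0[symmetric] poly_map_poly_eval by blast
        then have "coeff (map_poly (\<lambda>u. poly u 0) (coeff P i)) j = 0" by simp
        then show ?thesis by (simp add: coeff_map_poly)
      qed
      then show "[:[:[:0, 1:]:]:] dvd P"
        by (simp add: const_poly_dvd_iff) (metis (no_types) minus_zero poly_eq_0_iff_dvd)
    qed
  qed
qed

lemma foliation_not_zero_on_plane:
  fixes l :: "complex^3"
  assumes "foliation n W" "l \<noteq> 0"
  shows "\<exists>v. l$1 * v$1 + l$2 * v$2 + l$3 * v$3 = 0 \<and> form_at W v \<noteq> 0"
proof (rule ccontr)
  assume neg: "\<not> ?thesis"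
  obtain h :: poly3 where h: "\<not> h dvd 1"
    "\<And>P. (\<And>v. l$1 * v$1 + l$2 * v$2 + l$3 * v$3 = 0 \<Longrightarrow> eval3 P v = 0) \<Longrightarrow> h dvd P"
    using linear_factor[OF assms(2)] by blast
  have "h dvd W $ i" for i
    by (rule h(2)) (use neg in \<open>auto simp: form_at_def vec_eq_iff\<close>)
  then show False using assms(1) h(1) unfolding foliation_def by blast
qed

section \<open>Forms that homotheties multiply by a constant\<close>

lemma poly_eq_by_infinite:
  fixes p q :: "complex poly"
  assumes "\<And>x. x \<in> A \<Longrightarrow> poly p x = poly q x" "infinite A"
  shows "p = q"
proof (rule ccontr)
  assume "p \<noteq> q"
  then have "finite {x. poly (p - q) x = 0}" by (intro poly_roots_finite) simp
  moreover have "A \<subseteq> {x. poly (p - q) x = 0}" using assms(1) by auto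
  ultimately show False using assms(2) finite_subset by blast
qed

text \<open>Meant for the multiplier of a form under homotheties, which is, up to a constant, a
  polynomial in \<open>c\<close> without zeros off 0.\<close>

lemma root_free_off_0_monomial:
  fixes r :: "complex poly"
  assumes "\<And>c. c \<noteq> 0 \<Longrightarrow> poly r c \<noteq> 0"
  shows "\<exists>e k. e \<le> degree r \<and> (\<forall>c. poly r c = k * c ^ e)"
proof -
  have "r \<noteq> 0" using assms[of 1] by auto
  then obtain q where q: "r = [:-0, 1:] ^ order 0 r * q" "\<not> [:-0, 1:] dvd q"
    using order_decomp by blast
  have "degree q = 0"
  proof (rule ccontr)
    assume "degree q \<noteq> 0"
    then obtain c where c: "poly q c = 0"
      using alg_closed_imp_poly_has_root[of q] by auto
    have "c \<noteq> 0" using c q(2) by (auto simp: poly_eq_0_iff_dvd)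
    moreover have "poly r c = 0" by (subst q(1)) (simp add: c)
    ultimately show False using assms by blast
  qed
  then obtain k where k: "q = [:k:]" using degree_eq_zeroE by blast
  have "order 0 r \<le> degree r" using \<open>r \<noteq> 0\<close> by (rule order_degree)
  moreover have "poly r c = k * c ^ order 0 r" for c
    by (subst q(1)) (simp add: k)
  ultimately show ?thesis by blast
qed

definition hom3 :: "complex \<Rightarrow> complex^3 \<Rightarrow> complex^3" where
  "hom3 c v = vector [c * v$1, c * v$2, v$3]"

lemma vec3_eq_iff: "(v :: complex^3) = w \<longleftrightarrow> v$1 = w$1 \<and> v$2 = w$2 \<and> v$3 = w$3"
  by (simp add: vec_eq_iff forall_3)

lemma hom3_nth [simp]: "hom3 c v $ 1 = c * v$1" "hom3 c v $ 2 = c * v$2" "hom3 c v $ 3 = v$3"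
  by (simp_all add: hom3_def)

text \<open>The multiplier is a power \<open>c ^ e\<close>; this fixes the joint degree of
  \<open>g\<close> in the first two variables and leaves \<open>m - e\<close> for the third. The
  binary form of degree \<open>e\<close> is recorded by its values \<open>r\<close> at
  \<open>(1, t)\<close>.\<close>

lemma homothety_invariant_form:
  assumes g: "form3 m g" and inv: "\<And>c v. c \<noteq> 0 \<Longrightarrow> g (hom3 c v) = ch c * g v"
    and ch: "\<And>c. c \<noteq> 0 \<Longrightarrow> ch c \<noteq> 0" and nz: "g v0 \<noteq> 0"
  obtains e r where "e \<le> m" "degree r \<le> e" "\<And>c. c \<noteq> 0 \<Longrightarrow> ch c = c ^ e"
    "\<And>v. v$1 \<noteq> 0 \<Longrightarrow> g v = (v$3) ^ (m - e) * (v$1) ^ e * poly r (v$2 / v$1)"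
proof -
  \<comment> \<open>The orbit of \<open>v0\<close> under homotheties lies on a line parametrized by
    \<open>c\<close>, so the multiplier becomes polynomial in \<open>c\<close>.\<close>
  obtain \<rho> where \<rho>: "degree \<rho> \<le> m" "\<And>c. g (vector [0, 0, v0$3] + c *s vector [v0$1, v0$2, 0]) = poly \<rho> c"
    using form3_line[OF g] by blast
  have \<rho>': "poly \<rho> c = ch c * g v0" if "c \<noteq> 0" for c
  proof -
    have "vector [0, 0, v0$3] + c *s vector [v0$1, v0$2, 0] = hom3 c v0"
      by (simp add: vec3_eq_iff)
    then show ?thesis using \<rho>(2)[of c] inv[OF that] by simp
  qed
  then have "poly \<rho> c \<noteq> 0" if "c \<noteq> 0" for c using ch nz that by simp
  then obtain e k where e: "e \<le> degree \<rho>" "\<And>c. poly \<rho> c = k * c ^ e"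
    using root_free_off_0_monomial[of \<rho>] by blast
  have "hom3 1 v0 = v0" by (simp add: vec3_eq_iff)
  then have "ch 1 = 1" using inv[of 1 v0] nz by simp
  then have "k = g v0" using \<rho>'[of 1] e(2)[of 1] by simp
  then have che: "ch c = c ^ e" if "c \<noteq> 0" for c
    using \<rho>'[OF that] e(2)[of c] nz by simp
  have em: "e \<le> m" using e(1) \<rho>(1) by simp
  obtain r where r: "\<And>t. g (vector [1, 0, 1] + t *s vector [0, 1, 0]) = poly r t"
    using form3_line[OF g] by blast
  have rt: "g (vector [1, t, 1]) = poly r t" for t
  proof -
    have "vector [1, 0, 1] + t *s vector [0, 1, 0] = (vector [1, t, 1] :: complex^3)"
      by (simp add: vec3_eq_iff)
    then show ?thesis using r[of t] by simp
  qed
  have generic: "g v = (v$3) ^ (m - e) * (v$1) ^ e * poly r (v$2 / v$1)" if "v$1 \<noteq> 0" "v$3 \<noteq> 0" for v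
  proof -
    have "v = v$3 *s hom3 (v$1 / v$3) (vector [1, v$2 / v$1, 1])"
      using that by (simp add: vec3_eq_iff)
    then have "g v = (v$3) ^ m * ((v$1 / v$3) ^ e * poly r (v$2 / v$1))"
      using that form3_scale[OF g] inv che rt by (metis divide_eq_0_iff)
    also have "(v$3) ^ m = (v$3) ^ (m - e) * (v$3) ^ e"
      using em by (simp flip: power_add)
    finally show ?thesis using that by (simp add: power_divide)
  qed
  \<comment> \<open>The formula extends to \<open>v$3 = 0\<close> since both sides are polynomial
    along the line through \<open>v\<close> parallel to the third axis.\<close>
  have g_eq: "g v = (v$3) ^ (m - e) * (v$1) ^ e * poly r (v$2 / v$1)" if v: "v$1 \<noteq> 0" for v
  proof -
    obtain s where s: "\<And>\<xi>. g (v + \<xi> *s vector [0, 0, 1]) = poly s \<xi>"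
      using form3_line[OF g] by blast
    define s' where "s' = smult ((v$1) ^ e * poly r (v$2 / v$1)) ([:v$3, 1:] ^ (m - e))"
    have "poly s \<xi> = poly s' \<xi>" if "\<xi> \<in> UNIV - {- v$3}" for \<xi>
    proof -
      have "v$3 + \<xi> \<noteq> 0" using that by (auto simp: eq_neg_iff_add_eq_0 add.commute)
      then show ?thesis
        using generic[of "v + \<xi> *s vector [0, 0, 1]"] v by (simp add: s[symmetric] s'_def)
    qed
    moreover have "infinite (UNIV - {- v$3})" using infinite_UNIV_char_0 by simp
    ultimately have "s = s'" using poly_eq_by_infinite[of "UNIV - {- v$3}" s s'] by blast
    then show ?thesis using s[of 0] by (simp add: s'_def)
  qed
  \<comment> \<open>Along \<open>(\<xi>, 1, 1)\<close> the form equals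
    \<open>\<xi> ^ e * poly r (1 / \<xi>)\<close>; a larger degree of \<open>r\<close> would give it
    a pole at 0.\<close>
  have "degree r \<le> e"
  proof (rule ccontr)
    assume "\<not> degree r \<le> e"
    define N where "N = degree r"
    obtain s where s: "\<And>\<xi>. g (vector [0, 1, 1] + \<xi> *s vector [1, 0, 0]) = poly s \<xi>"
      using form3_line[OF g] by blast
    have "poly (monom 1 (N - e) * s) \<xi> = poly (reflect_poly r) \<xi>" if "\<xi> \<in> UNIV - {0}" for \<xi>
    proof -
      have "\<xi> \<noteq> 0" using that by simp
      then have "poly s \<xi> = \<xi> ^ e * poly r (1 / \<xi>)"
        using g_eq[of "vector [0, 1, 1] + \<xi> *s vector [1, 0, 0]"] by (simp add: s[symmetric])
      then have "poly (monom 1 (N - e) * s) \<xi> = \<xi> ^ N * poly r (1 / \<xi>)"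
        using \<open>\<not> degree r \<le> e\<close> by (simp add: poly_monom N_def flip: power_add)
      then show ?thesis
        using poly_reflect_poly_nz[OF \<open>\<xi> \<noteq> 0\<close>] by (simp add: N_def divide_inverse)
    qed
    moreover have "infinite (UNIV - {0::complex})" using infinite_UNIV_char_0 by simp
    ultimately have "monom 1 (N - e) * s = reflect_poly r"
      using poly_eq_by_infinite[of "UNIV - {0}" "monom 1 (N - e) * s" "reflect_poly r"] by blast
    then have "poly (monom 1 (N - e) * s) 0 = poly (reflect_poly r) 0" by simp
    then show False
      using \<open>\<not> degree r \<le> e\<close> by (auto simp: poly_monom N_def power_0_left)
  qed
  with em che g_eq show ?thesis using that by blast
qed

text \<open>An algebraic limit for \<open>\<xi>\<close> tending to 0. It carries formulas known for
  nonzero coordinates over to points where the coordinate vanishes.\<close>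

lemma form3_limit:
  assumes "form3 m g" "\<And>\<xi>. \<xi> \<noteq> 0 \<Longrightarrow> g (a + \<xi> *s b) = poly q \<xi>"
  shows "g a = poly q 0"
proof -
  obtain r where r: "\<And>\<xi>. g (a + \<xi> *s b) = poly r \<xi>" using form3_line[OF assms(1)] by blast
  have "infinite (UNIV - {0::complex})" using infinite_UNIV_char_0 by simp
  then have "r = q"
    using poly_eq_by_infinite[of "UNIV - {0}" r q] assms(2) r by auto
  then show ?thesis using r[of 0] by simp
qed

lemma form3_zero_extend:
  assumes "form3 m g" "\<And>\<xi>. \<xi> \<noteq> 0 \<Longrightarrow> g (a + \<xi> *s b) = 0"
  shows "g a = 0"
  using form3_limit[OF assms(1), of a b 0] assms(2) by simp

lemma pullback_nth: "pullback M W v $ i = (\<Sum>j\<in>UNIV. M$j$i * eval3 (W$j) (M *v v))"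
  by (simp add: pullback_def matrix_vector_mult_def form_at_def transpose_def)

lemma form3_pullback:
  assumes "foliation n W"
  shows "form3 (n + 1) (\<lambda>v. pullback M W v $ i)"
  using assms unfolding pullback_nth foliation_def
  by (intro form3_sum form3_cmult form3_linear form3_eval3) auto

lemma pullback_annihilates_radial:
  assumes "foliation n W"
  shows "v$1 * pullback M W v $ 1 + v$2 * pullback M W v $ 2 + v$3 * pullback M W v $ 3 = 0"
proof -
  have "(\<Sum>i\<in>UNIV. (M *v v)$i * form_at W (M *v v) $ i) = 0"
    using assms unfolding foliation_def by blast
  then show ?thesis
    by (simp add: pullback_nth form_at_def matrix_vector_mult_def sum_3 algebra_simps)
qed

lemma pullback_eq_0_iff:
  assumes "invertible M"
  shows "pullback M W v = 0 \<longleftrightarrow> form_at W (M *v v) = 0"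
proof -
  obtain N' where "M ** N' = mat 1" using assms unfolding invertible_def by blast
  then have "transpose N' ** transpose M = mat 1"
    by (simp add: matrix_transpose_mul[symmetric])
  then obtain N where N: "N ** transpose M = mat 1" by blast
  have "form_at W (M *v v) = N *v pullback M W v"
    by (simp only: pullback_def matrix_vector_mul_assoc N matrix_vector_mul_lid)
  then show ?thesis by (auto simp: pullback_def)
qed

lemma pullback_not_zero_on_plane:
  fixes l :: "complex^3"
  assumes W: "foliation n W" and M: "invertible M" and l: "l \<noteq> 0"
  shows "\<exists>v. l$1 * v$1 + l$2 * v$2 + l$3 * v$3 = 0 \<and> pullback M W v \<noteq> 0"
proof -
  obtain N where N: "M ** N = mat 1" "N ** M = mat 1" using M unfolding invertible_def by blast
  define l' where "l' = transpose N *v l"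
  have "transpose M *v l' = l"
    by (simp only: l'_def matrix_vector_mul_assoc matrix_transpose_mul[symmetric] N transpose_mat
        matrix_vector_mul_lid)
  then have "l' \<noteq> 0" using l by auto
  then obtain w where w: "l'$1 * w$1 + l'$2 * w$2 + l'$3 * w$3 = 0" "form_at W w \<noteq> 0"
    using foliation_not_zero_on_plane[OF W] by blast
  have "M *v (N *v w) = w" by (simp add: matrix_vector_mul_assoc N)
  then have "pullback M W (N *v w) \<noteq> 0" using w(2) pullback_eq_0_iff[OF M] by simp
  moreover have "l$1 * (N *v w)$1 + l$2 * (N *v w)$2 + l$3 * (N *v w)$3 = 0"
    using w(1) by (simp add: l'_def matrix_vector_mult_def transpose_def sum_3 algebra_simps)
  ultimately show ?thesis by blast
qed

text \<open>The coefficient formulas hold only for \<open>v$1 \<noteq> 0\<close>. On a plane with a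
  vector \<open>b\<close> off this axis, moving in the direction \<open>b\<close> carries zeros over
  to the axis as well.\<close>

lemma pullback_not_zero_off_axis:
  fixes l b :: "complex^3"
  assumes W: "foliation n W" and M: "invertible M" and l: "l \<noteq> 0"
    and b: "l$1 * b$1 + l$2 * b$2 + l$3 * b$3 = 0" "b$1 \<noteq> 0"
    and zero: "\<And>v. l$1 * v$1 + l$2 * v$2 + l$3 * v$3 = 0 \<Longrightarrow> v$1 \<noteq> 0 \<Longrightarrow> pullback M W v = 0"
  shows False
proof -
  obtain v where v: "l$1 * v$1 + l$2 * v$2 + l$3 * v$3 = 0" "pullback M W v \<noteq> 0"
    using pullback_not_zero_on_plane[OF W M l] by blast
  have "v$1 = 0" using zero v by blast
  have "pullback M W v $ i = 0" for i
  proof (rule form3_zero_extend[OF form3_pullback[OF W]])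
    fix \<xi> :: complex assume "\<xi> \<noteq> 0"
    have "l$1 * (v + \<xi> *s b)$1 + l$2 * (v + \<xi> *s b)$2 + l$3 * (v + \<xi> *s b)$3 = 0"
      using v(1) b(1) by simp algebra
    then show "pullback M W (v + \<xi> *s b) $ i = 0"
      using zero \<open>v$1 = 0\<close> \<open>\<xi> \<noteq> 0\<close> b(2) by simp
  qed
  then show False using v(2) by (simp add: vec_eq_iff)
qed

definition homogeneous_chart :: "complex^3^3 \<Rightarrow> poly3 \<Rightarrow> poly3^3 \<Rightarrow> bool" where
  "homogeneous_chart M F W \<longleftrightarrow> invertible M \<and>
     (\<forall>c. c \<noteq> 0 \<longrightarrow>
         (\<exists>a. a \<noteq> 0 \<and> (\<forall>v. eval3 F (M *v hom3 c v) = a * eval3 F (M *v v))) \<and>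
         (\<exists>b. b \<noteq> 0 \<and> (\<forall>v. hom3 c (pullback M W (hom3 c v)) = b *s pullback M W v)))"

lemma homothety_mult: "homothety c *v v = hom3 c v"
  by (simp add: vec3_eq_iff matrix_vector_mult_def homothety_def sum_3)

lemma pullback_homothety: "pullback (M ** homothety c) W v = hom3 c (pullback M W (hom3 c v))"
proof -
  have "transpose (homothety c) = homothety c"
    by (simp add: vec_eq_iff forall_3 homothety_def transpose_def)
  then show ?thesis
    by (simp add: pullback_def matrix_transpose_mul matrix_vector_mul_assoc[symmetric] homothety_mult)
qed

lemma homogeneous_prefoliation_iff:
  "homogeneous_prefoliation F W \<longleftrightarrow> (\<exists>M. homogeneous_chart M F W)"
  unfolding homogeneous_prefoliation_def homogeneous_chart_def pullback_homothety
    matrix_vector_mul_assoc[symmetric] homothety_mult ..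

text \<open>\<open>k - e\<close> is the multiplicity of the line at infinity, and the roots of
  \<open>f\<close> are the slopes of the lines through the origin. The line \<open>v$1 = 0\<close>
  shows as a drop of \<open>degree f\<close> below \<open>e\<close>.\<close>

lemma homogeneous_chart_curve:
  assumes F: "homogeneous3 k F" and M: "homogeneous_chart M F W" and nz: "eval3 F (M *v v0) \<noteq> 0"
  obtains e f where "e \<le> k" "degree f \<le> e"
    "\<And>v. v$1 \<noteq> 0 \<Longrightarrow> eval3 F (M *v v) = (v$3) ^ (k - e) * (v$1) ^ e * poly f (v$2 / v$1)"
proof -
  have "\<exists>a. \<forall>c. c \<noteq> 0 \<longrightarrow> a c \<noteq> 0 \<and> (\<forall>v. eval3 F (M *v hom3 c v) = a c * eval3 F (M *v v))"
    using M unfolding homogeneous_chart_def by (intro choice) blast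
  then obtain a where a: "\<And>c. c \<noteq> 0 \<Longrightarrow> a c \<noteq> 0"
    "\<And>c v. c \<noteq> 0 \<Longrightarrow> eval3 F (M *v hom3 c v) = a c * eval3 F (M *v v)" by blast
  show ?thesis
    by (rule homothety_invariant_form[OF form3_linear[OF form3_eval3[OF F], of M] a(2) a(1) nz])
      (use that in blast)+
qed

text \<open>Coprimality turns \<open>a b' = a' b\<close> into \<open>b dvd b'\<close>, which forces
  \<open>b' = 0\<close>.\<close>

lemma wron_eq_0_imp_const:
  assumes cop: "\<And>c. \<not> (poly a c = 0 \<and> poly b c = 0)" and J: "wron a b = 0"
  shows "degree a = 0 \<and> degree b = 0"
proof (cases "b = 0")
  case True
  then have "poly a c \<noteq> 0" for c using cop[of c] by simp
  then have "degree a = 0" using alg_closed_imp_poly_has_root[of a] by blast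
  then show ?thesis using True by simp
next
  case False
  have eq: "a * pderiv b = pderiv a * b" using J by (simp add: wron_def)
  have "b dvd pderiv b"
  proof (rule dvd_of_order_le[OF False])
    fix c assume "poly b c = 0"
    then have ac: "poly a c \<noteq> 0" using cop[of c] by simp
    then have "a \<noteq> 0" by auto
    have "[:-c, 1:] ^ order c b dvd a * pderiv b"
      unfolding eq by (intro dvd_mult order_1)
    then show "[:-c, 1:] ^ order c b dvd pderiv b"
      using ac \<open>a \<noteq> 0\<close> unfolding order_divides
      by (cases "pderiv b = 0") (auto simp: order_mult order_0I)
  qed
  then have "pderiv b = 0"
    using dvd_imp_degree_le[of b "pderiv b"] by (cases "degree b = 0") (auto simp: degree_pderiv pderiv_eq_0_iff)
  moreover from this have "pderiv a = 0" using eq False by simp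
  ultimately show ?thesis by (simp add: pderiv_eq_0_iff)
qed

text \<open>The first two coefficients share the multiplier \<open>c ^ e\<close>, and a nonzero
  third one has \<open>c ^ (e + 1)\<close>, because the differentials of the first two coordinates
  scale as well. The absence of lines of singular points does the rest: it forces
  \<open>e = n\<close>, coprimality and a nonconstant Gauss map.\<close>

lemma homogeneous_chart_foliation:
  assumes W: "foliation n W" and n: "n \<ge> 1" and M: "homogeneous_chart M F W"
  obtains a b where "degree a \<le> n" "degree b \<le> n" "\<And>c. \<not> (poly a c = 0 \<and> poly b c = 0)"
    "tangent_cone a b \<noteq> 0" "wron a b \<noteq> 0"
    "\<And>v. v$1 \<noteq> 0 \<Longrightarrow> pullback M W v $ 1 = v$3 * (v$1) ^ n * poly a (v$2 / v$1)"
    "\<And>v. v$1 \<noteq> 0 \<Longrightarrow> pullback M W v $ 2 = v$3 * (v$1) ^ n * poly b (v$2 / v$1)"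
    "\<And>v. v$1 \<noteq> 0 \<Longrightarrow> pullback M W v $ 3 = - ((v$1) ^ (n + 1)) * poly (tangent_cone a b) (v$2 / v$1)"
proof -
  have inv: "invertible M" using M unfolding homogeneous_chart_def by blast
  have "\<exists>b. \<forall>c. c \<noteq> 0 \<longrightarrow> b c \<noteq> 0 \<and> (\<forall>v. hom3 c (pullback M W (hom3 c v)) = b c *s pullback M W v)"
    using M unfolding homogeneous_chart_def by (intro choice) blast
  then obtain b where b: "\<And>c. c \<noteq> 0 \<Longrightarrow> b c \<noteq> 0"
    "\<And>c v. c \<noteq> 0 \<Longrightarrow> hom3 c (pullback M W (hom3 c v)) = b c *s pullback M W v" by blast
  define G where "G i v = pullback M W v $ i" for i v
  have G: "form3 (n + 1) (G i)" for i unfolding G_def by (rule form3_pullback[OF W])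
  have euler: "v$1 * G 1 v + v$2 * G 2 v + v$3 * G 3 v = 0" for v
    unfolding G_def by (rule pullback_annihilates_radial[OF W])
  have b12: "G i (hom3 c v) = b c / c * G i v" if "c \<noteq> 0" "i = 1 \<or> i = 2" for c v i
    using arg_cong[OF b(2)[OF that(1), of v], of "\<lambda>u. u $ i"] that
    by (auto simp: G_def field_simps)
  have b3: "G 3 (hom3 c v) = b c * G 3 v" if "c \<noteq> 0" for c v
    using arg_cong[OF b(2)[OF that(1), of v], of "\<lambda>u. u $ 3"] by (simp add: G_def)
  have zero_iff: "pullback M W v = 0 \<longleftrightarrow> G 1 v = 0 \<and> G 2 v = 0 \<and> G 3 v = 0" for v
    by (simp add: G_def vec3_eq_iff)
  define \<beta> where "\<beta> c = b c / c" for c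
  have \<beta>: "c \<noteq> 0 \<Longrightarrow> \<beta> c \<noteq> 0" for c using b(1) by (simp add: \<beta>_def)
  have "\<exists>v. G 1 v \<noteq> 0 \<or> G 2 v \<noteq> 0"
  proof (rule ccontr)
    assume neg: "\<not> ?thesis"
    have "G 3 v = 0" for v
    proof (cases "v$3 = 0")
      case True
      show ?thesis
      proof (rule form3_zero_extend[OF G])
        fix \<xi> :: complex assume "\<xi> \<noteq> 0"
        then show "G 3 (v + \<xi> *s vector [0, 0, 1]) = 0"
          using euler[of "v + \<xi> *s vector [0, 0, 1]"] neg True by auto
      qed
    next
      case False
      then show ?thesis using euler[of v] neg by auto
    qed
    then have "pullback M W v = 0" for v using neg by (auto simp: zero_iff)
    then show False using pullback_not_zero_on_plane[OF W inv, of "vector [0, 0, 1]"]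
      by (auto simp: vec3_eq_iff)
  qed
  then obtain i0 v0 where i0: "i0 = 1 \<or> i0 = 2" "G i0 v0 \<noteq> 0" by blast
  obtain e where e: "e \<le> n + 1" "\<And>c. c \<noteq> 0 \<Longrightarrow> \<beta> c = c ^ e"
    by (rule homothety_invariant_form[OF G[of i0] _ \<beta> i0(2)]) (use b12 i0 in \<open>auto simp: \<beta>_def\<close>)
  have exp_inj: "j = j'" if "\<And>c::complex. c \<noteq> 0 \<Longrightarrow> c ^ j = c ^ j'" for j j' :: nat
  proof -
    have "(2::complex) ^ j = 2 ^ j'" using that by simp
    then have "(2::real) ^ j = 2 ^ j'" by (metis norm_numeral norm_power)
    then show ?thesis by simp
  qed
  have R12: "\<exists>r. degree r \<le> e \<and> (\<forall>v. v$1 \<noteq> 0 \<longrightarrow> G i v = (v$3) ^ (n + 1 - e) * (v$1) ^ e * poly r (v$2 / v$1))"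
    if i: "i = 1 \<or> i = 2" for i
  proof (cases "\<exists>v. G i v \<noteq> 0")
    case True
    then obtain v where v: "G i v \<noteq> 0" by blast
    show ?thesis
    proof (rule homothety_invariant_form[OF G[of i] _ \<beta> v])
      fix e' r assume *: "\<And>c. c \<noteq> 0 \<Longrightarrow> \<beta> c = c ^ e'" "degree r \<le> e'"
        "\<And>v. v$1 \<noteq> 0 \<Longrightarrow> G i v = (v$3) ^ (n + 1 - e') * (v$1) ^ e' * poly r (v$2 / v$1)"
      have "e' = e" using exp_inj * e(2) by metis
      then show ?thesis using * by blast
    qed (use b12 i in \<open>auto simp: \<beta>_def\<close>)
  qed (auto intro: exI[of _ 0])
  obtain r1 where r1: "degree r1 \<le> e"
      "\<And>v. v$1 \<noteq> 0 \<Longrightarrow> G 1 v = (v$3) ^ (n + 1 - e) * (v$1) ^ e * poly r1 (v$2 / v$1)"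
    using R12[of 1] by blast
  obtain r2 where r2: "degree r2 \<le> e"
      "\<And>v. v$1 \<noteq> 0 \<Longrightarrow> G 2 v = (v$3) ^ (n + 1 - e) * (v$1) ^ e * poly r2 (v$2 / v$1)"
    using R12[of 2] by blast
  note r = r1(1) r2(1) r1(2) r2(2)
  have not_inf: False if "\<And>v. v$3 = 0 \<Longrightarrow> v$1 \<noteq> 0 \<Longrightarrow> pullback M W v = 0"
    by (rule pullback_not_zero_off_axis[OF W inv, of "vector [0, 0, 1]" "vector [1, 0, 0]"])
      (use that in \<open>auto simp: vec3_eq_iff\<close>)
  have not_line: False if "\<And>v. v$2 = c * v$1 \<Longrightarrow> v$1 \<noteq> 0 \<Longrightarrow> pullback M W v = 0" for c
    by (rule pullback_not_zero_off_axis[OF W inv, of "vector [-c, 1, 0]" "vector [1, c, 0]"])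
      (use that in \<open>auto simp: vec3_eq_iff\<close>)
  have "e = n \<and> (\<exists>v. G 3 v \<noteq> 0)"
  proof (cases "\<exists>v. G 3 v \<noteq> 0")
    case True
    then obtain v where v: "G 3 v \<noteq> 0" by blast
    show ?thesis
    proof (rule homothety_invariant_form[OF G[of 3] b3 b(1) v])
      fix e' r3 assume *: "e' \<le> n + 1" "\<And>c. c \<noteq> 0 \<Longrightarrow> b c = c ^ e'"
        "\<And>v. v$1 \<noteq> 0 \<Longrightarrow> G 3 v = (v$3) ^ (n + 1 - e') * (v$1) ^ e' * poly r3 (v$2 / v$1)"
      have "c ^ (e + 1) = c ^ e'" if "c \<noteq> 0" for c :: complex
        using *(2)[OF that] e(2)[OF that] that by (simp add: \<beta>_def field_simps)
      then have e': "e' = e + 1" using exp_inj by metis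
      \<comment> \<open>The degree \<open>n + 1\<close> of the third coefficient gives
        \<open>e \<le> n\<close>; for \<open>e < n\<close> all three coefficients would vanish on
        the line at infinity.\<close>
      have "e = n"
      proof (rule ccontr)
        assume "e \<noteq> n"
        then have "e < n" using e' *(1) by simp
        then show False
          by (intro not_inf) (auto simp: zero_iff r *(3) e' power_0_left)
      qed
      then show ?thesis using True by blast
    qed auto
  next
    case False
    \<comment> \<open>Without a third coefficient the form would be \<open>X\<^sub>1^n\<close> times
      a multiple of \<open>X\<^sub>1 dX\<^sub>2 - X\<^sub>2 dX\<^sub>1\<close>, which vanishes on
      \<open>v$1 = 0\<close> because \<open>n \<ge> 1\<close>.\<close>
    then have G3: "G 3 v = 0" for v by blast
    have "e = n + 1"
    proof (rule ccontr)
      assume "e \<noteq> n + 1"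
      then have "e < n + 1" using e(1) by simp
      then show False
        by (intro not_inf) (auto simp: zero_iff r G3 power_0_left)
    qed
    have r12: "poly r1 t + t * poly r2 t = 0" for t
      using euler[of "vector [1, t, 1]"] r(3,4)[of "vector [1, t, 1]"] G3 by simp
    have no_root: "poly r2 t \<noteq> 0" for t
    proof
      assume t: "poly r2 t = 0"
      then have "poly r1 t = 0" using r12[of t] by simp
      with t show False by (intro not_line[of t]) (auto simp: zero_iff r G3)
    qed
    then have "degree r2 = 0"
      using alg_closed_imp_poly_has_root[of r2] by blast
    then obtain c0 where c0: "r2 = [:c0:]" using degree_eq_zeroE by blast
    have p1: "poly r1 t = - c0 * t" for t using r12[of t] c0 by (simp add: eq_neg_iff_add_eq_0 mult.commute)
    obtain v where v: "v$1 = 0" "pullback M W v \<noteq> 0"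
      using pullback_not_zero_on_plane[OF W inv, of "vector [1, 0, 0]"] by (auto simp: vec3_eq_iff)
    have "G 1 v = poly (monom (- c0 * v$2) n) 0"
    proof (rule form3_limit[OF G])
      fix \<xi> :: complex assume "\<xi> \<noteq> 0"
      then show "G 1 (v + \<xi> *s vector [1, 0, 0]) = poly (monom (- c0 * v$2) n) \<xi>"
        using r(3)[of "v + \<xi> *s vector [1, 0, 0]"] v(1) by (simp add: \<open>e = n + 1\<close> p1 poly_monom)
    qed
    moreover have "G 2 v = poly (monom c0 (n + 1)) 0"
    proof (rule form3_limit[OF G])
      fix \<xi> :: complex assume "\<xi> \<noteq> 0"
      then show "G 2 (v + \<xi> *s vector [1, 0, 0]) = poly (monom c0 (n + 1)) \<xi>"
        using r(4)[of "v + \<xi> *s vector [1, 0, 0]"] v(1) by (simp add: \<open>e = n + 1\<close> c0 poly_monom)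
    qed
    ultimately have "pullback M W v = 0" using n by (simp add: zero_iff G3 poly_monom)
    with v(2) show ?thesis by blast
  qed
  then have en: "e = n" by blast
  have G3: "G 3 v = - ((v$1) ^ (n + 1)) * poly (tangent_cone r1 r2) (v$2 / v$1)" if v1: "v$1 \<noteq> 0" for v
  proof -
    define u :: "complex \<Rightarrow> complex^3" where "u z = vector [v$1, v$2, z]" for z
    have nz: "G 3 (u z) = - ((v$1) ^ (n + 1)) * poly (tangent_cone r1 r2) (v$2 / v$1)" if "z \<noteq> 0" for z
    proof -
      have "z * G 3 (u z) = - (v$1 * G 1 (u z) + v$2 * G 2 (u z))"
        using euler[of "u z"] unfolding u_def vector_3 by algebra
      also have "\<dots> = z * (- ((v$1) ^ (n + 1)) * poly (tangent_cone r1 r2) (v$2 / v$1))"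
        using r(3,4)[of "u z"] v1 by (simp add: u_def en tangent_cone_def field_simps)
      finally show ?thesis using that by (metis mult_left_cancel)
    qed
    show ?thesis
    proof (cases "v$3 = 0")
      case False
      have "v = u (v$3)" by (simp add: u_def vec3_eq_iff)
      then show ?thesis using nz[OF False] by simp
    next
      case True
      have "G 3 v = poly [:- ((v$1) ^ (n + 1)) * poly (tangent_cone r1 r2) (v$2 / v$1):] 0"
      proof (rule form3_limit[OF G])
        fix \<xi> :: complex assume "\<xi> \<noteq> 0"
        moreover have "v + \<xi> *s vector [0, 0, 1] = u \<xi>" by (simp add: u_def vec3_eq_iff True)
        ultimately show "G 3 (v + \<xi> *s vector [0, 0, 1])
          = poly [:- ((v$1) ^ (n + 1)) * poly (tangent_cone r1 r2) (v$2 / v$1):] \<xi>"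
          using nz by simp
      qed
      then show ?thesis by simp
    qed
  qed
  have "\<not> (poly r1 c = 0 \<and> poly r2 c = 0)" for c
  proof
    assume "poly r1 c = 0 \<and> poly r2 c = 0"
    then show False
      by (intro not_line[of c]) (auto simp: zero_iff r G3 tangent_cone_def)
  qed
  \<comment> \<open>A constant Gauss map would make \<open>r1\<close> and \<open>r2\<close>
    constants, and then the power of \<open>X\<^sub>1\<close> makes the whole line
    \<open>v$1 = 0\<close> singular.\<close>
  moreover from this have "wron r1 r2 \<noteq> 0"
  proof (intro notI)
    assume cop: "\<And>c. \<not> (poly r1 c = 0 \<and> poly r2 c = 0)" and "wron r1 r2 = 0"
    then have "degree r1 = 0" "degree r2 = 0" using wron_eq_0_imp_const[of r1 r2] by auto
    then obtain c1 c2 where c12: "r1 = [:c1:]" "r2 = [:c2:]" using degree_eq_zeroE by metis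
    obtain v where v: "v$1 = 0" "pullback M W v \<noteq> 0"
      using pullback_not_zero_on_plane[OF W inv, of "vector [1, 0, 0]"] by (auto simp: vec3_eq_iff)
    have "G 1 v = poly (monom (v$3 * c1) n) 0"
      by (rule form3_limit[OF G, of _ _ "vector [1, 0, 0]"])
        (use v(1) in \<open>simp add: r en c12 poly_monom\<close>)
    moreover have "G 2 v = poly (monom (v$3 * c2) n) 0"
      by (rule form3_limit[OF G, of _ _ "vector [1, 0, 0]"])
        (use v(1) in \<open>simp add: r en c12 poly_monom\<close>)
    moreover have "G 3 v = poly (- monom c1 (n + 1) - monom (v$2 * c2) n) 0"
      by (rule form3_limit[OF G, of _ _ "vector [1, 0, 0]"])
        (use v(1) in \<open>simp add: G3 c12 poly_monom tangent_cone_def field_simps\<close>)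
    ultimately have "pullback M W v = 0" using n by (simp add: zero_iff poly_monom)
    with v(2) show False by blast
  qed
  moreover have "tangent_cone r1 r2 \<noteq> 0"
  proof
    assume 0: "tangent_cone r1 r2 = 0"
    have "G 3 v = 0" for v
    proof (cases "v$1 = 0")
      case True
      show ?thesis
        by (rule form3_zero_extend[OF G, of _ _ "vector [1, 0, 0]"]) (simp add: G3 0 True)
    qed (simp add: G3 0)
    then show False using \<open>e = n \<and> (\<exists>v. G 3 v \<noteq> 0)\<close> by blast
  qed
  ultimately show ?thesis
    using that[of r1 r2] r G3 unfolding en G_def by simp
qed

section \<open>Convexity\<close>

lemma det_mult_vectors:
  fixes M :: "complex^3^3"
  shows "det (vector [M *v u, M *v v, M *v w] :: complex^3^3) = det M * det (vector [u, v, w] :: complex^3^3)"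
proof -
  have "(vector [M *v u, M *v v, M *v w] :: complex^3^3) = vector [u, v, w] ** transpose M"
    by (simp add: vec_eq_iff forall_3 matrix_matrix_mult_def matrix_vector_mult_def transpose_def sum_3
        mult.commute)
  then show ?thesis by (simp add: det_mul mult.commute)
qed

text \<open>The leaves of a homogeneous foliation that are not lines through the origin are given by the
  quadrature \<open>dx / x = - b dt / C\<close> in the coordinates \<open>(x, t = y / x)\<close>.\<close>

lemma radial_leaf:
  fixes a b :: "complex poly"
  assumes C: "poly (tangent_cone a b) c \<noteq> 0"
  obtains D x where "open D" "connected D" "c \<in> D" "infinite D"
    "\<And>t. t \<in> D \<Longrightarrow> poly (tangent_cone a b) t \<noteq> 0" "\<And>t. t \<in> D \<Longrightarrow> x t \<noteq> (0::complex)"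
    "\<And>t. t \<in> D \<Longrightarrow> (x has_field_derivative - x t * poly b t / poly (tangent_cone a b) t) (at t)"
proof -
  let ?C = "poly (tangent_cone a b)"
  have "open {t. ?C t \<noteq> 0}"
    by (intro open_Collect_neq continuous_intros)
  then obtain r where r: "r > 0" "ball c r \<subseteq> {t. ?C t \<noteq> 0}"
    using C open_contains_ball by blast
  have "(\<lambda>t. - poly b t / ?C t) holomorphic_on ball c r"
    using r(2) by (intro holomorphic_intros) auto
  then obtain g where g: "\<And>t. t \<in> ball c r \<Longrightarrow> (g has_field_derivative - poly b t / ?C t) (at t)"
    using holomorphic_convex_primitive'[of "ball c r" "\<lambda>t. - poly b t / ?C t"]
    by (metis at_within_open convex_ball open_ball)
  have inf: "infinite (ball c r)"
    using r(1) finite_imp_not_open[of "ball c r"] by auto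
  show ?thesis
  proof (rule that[of "ball c r" "\<lambda>t. exp (g t)"])
    fix t assume t: "t \<in> ball c r"
    show "((\<lambda>t. exp (g t)) has_field_derivative - exp (g t) * poly b t / ?C t) (at t)"
      using DERIV_fun_exp[OF g[OF t]] by simp
  qed (use r inf in auto)
qed

text \<open>A curve in the chart \<open>M\<close>, parametrized by its slope
  \<open>t = y / x\<close>.\<close>

definition cone_curve :: "complex^3^3 \<Rightarrow> (complex \<Rightarrow> complex) \<Rightarrow> complex \<Rightarrow> complex^3" where
  "cone_curve M x t = M *v vector [x t, t * x t, 1]"

lemma curve_deriv_linear:
  assumes "\<And>i. ((\<lambda>s. u s $ i) has_field_derivative u' $ i) (at t)" "open D" "t \<in> D"
    "\<And>s. s \<in> D \<Longrightarrow> \<gamma> s = M *v u s"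
  shows "curve_deriv \<gamma> t = M *v u'"
proof -
  have "((\<lambda>s. \<gamma> s $ i) has_field_derivative (M *v u') $ i) (at t)" for i
  proof (rule has_field_derivative_transform_within_open[OF _ assms(2,3)])
    show "((\<lambda>s. (M *v u s) $ i) has_field_derivative (M *v u') $ i) (at t)"
      unfolding matrix_vector_mult_def by (auto intro!: derivative_eq_intros assms(1) simp: mult.commute)
  qed (simp add: assms(4))
  then show ?thesis
    by (simp add: curve_deriv_def vec_eq_iff DERIV_imp_deriv)
qed

text \<open>With \<open>g = x' / x = - b / C\<close> the determinant is \<open>det M\<close> times
  \<open>2 x'^2 - x x'' = x^2 (g^2 - g')\<close>, and expanding \<open>C' = a' + b + t b'\<close>
  reduces \<open>g^2 - g'\<close> to \<open>wron a b / C^2\<close>. So a leaf that is not radial is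
  inflected exactly at the critical slopes of the Gauss map.\<close>

lemma integral_cone_curve:
  fixes a b :: "complex poly" and x :: "complex \<Rightarrow> complex"
  defines "C \<equiv> poly (tangent_cone a b)"
  assumes M: "invertible M"
    and W: "\<And>v. v$1 \<noteq> 0 \<Longrightarrow> pullback M W v $ 1 = v$3 * (v$1) ^ n * poly a (v$2 / v$1)"
      "\<And>v. v$1 \<noteq> 0 \<Longrightarrow> pullback M W v $ 2 = v$3 * (v$1) ^ n * poly b (v$2 / v$1)"
      "\<And>v. v$1 \<noteq> 0 \<Longrightarrow> pullback M W v $ 3 = - ((v$1) ^ (n + 1)) * poly (tangent_cone a b) (v$2 / v$1)"
    and D: "open D" "connected D" "\<And>t. t \<in> D \<Longrightarrow> C t \<noteq> 0" "\<And>t. t \<in> D \<Longrightarrow> x t \<noteq> 0"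
      "\<And>t. t \<in> D \<Longrightarrow> (x has_field_derivative - x t * poly b t / C t) (at t)"
  shows "integral_curve W D (cone_curve M x)"
    and "\<And>t. t \<in> D \<Longrightarrow> det (vector [cone_curve M x t, curve_deriv (cone_curve M x) t,
            curve_deriv (curve_deriv (cone_curve M x)) t] :: complex^3^3)
          = det M * ((x t)\<^sup>2 * poly (wron a b) t / (C t)\<^sup>2)"
proof -
  let ?\<gamma> = "cone_curve M x"
  define g where "g t = - poly b t / C t" for t
  define x' where "x' t = x t * g t" for t
  define g' where "g' t = (poly b t * poly (pderiv (tangent_cone a b)) t - poly (pderiv b) t * C t) / (C t)\<^sup>2" for t
  define x'' where "x'' t = x' t * g t + x t * g' t" for t
  define u v w :: "complex \<Rightarrow> complex^3" where "u t = vector [x t, t * x t, 1]"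
    and "v t = vector [x' t, x t + t * x' t, 0]" and "w t = vector [x'' t, 2 * x' t + t * x'' t, 0]" for t
  have dx: "(x has_field_derivative x' t) (at t)" if "t \<in> D" for t
    using D(5)[OF that] by (simp add: x'_def g_def)
  have dg: "(g has_field_derivative g' t) (at t)" if "t \<in> D" for t
    unfolding g_def[abs_def] using D(3)[OF that]
    by (auto intro!: derivative_eq_intros poly_DERIV simp: C_def g'_def power2_eq_square field_simps)
  have dx': "(x' has_field_derivative x'' t) (at t)" if "t \<in> D" for t
    unfolding x'_def[abs_def] using dx[OF that] dg[OF that]
    by (auto intro!: derivative_eq_intros simp: x''_def x'_def)
  have du: "((\<lambda>s. u s $ i) has_field_derivative v t $ i) (at t)" if "t \<in> D" for t i
    using exhaust_3[of i] dx[OF that]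
    by (auto simp: u_def v_def intro!: derivative_eq_intros)
  have dv: "((\<lambda>s. v s $ i) has_field_derivative w t $ i) (at t)" if "t \<in> D" for t i
    using exhaust_3[of i] dx[OF that] dx'[OF that]
    by (auto simp: w_def v_def intro!: derivative_eq_intros)
  have \<gamma>: "?\<gamma> t = M *v u t" for t by (simp add: cone_curve_def u_def)
  have d1: "curve_deriv ?\<gamma> t = M *v v t" if "t \<in> D" for t
    by (rule curve_deriv_linear[OF du[OF that] D(1) that \<gamma>])
  have d2: "curve_deriv (curve_deriv ?\<gamma>) t = M *v w t" if "t \<in> D" for t
    by (rule curve_deriv_linear[OF dv[OF that] D(1) that d1])
  obtain N where N: "N ** M = mat 1" using M unfolding invertible_def by blast
  have inj: "y = 0" if "M *v y = 0" for y
  proof -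
    have "N *v (M *v y) = y" by (simp only: matrix_vector_mul_assoc N matrix_vector_mul_lid)
    then show ?thesis using that by simp
  qed
  have pb: "pullback M W (u t) $ 1 = x t ^ n * poly a t" "pullback M W (u t) $ 2 = x t ^ n * poly b t"
    "pullback M W (u t) $ 3 = - (x t ^ (n + 1)) * C t" if "t \<in> D" for t
    using W[of "u t"] D(4)[OF that] by (simp_all add: u_def C_def)
  show "integral_curve W D ?\<gamma>"
    unfolding integral_curve_def
  proof (intro conjI allI ballI impI D)
    fix i
    have "(\<lambda>t. u t $ j) holomorphic_on D" for j
      by (rule holomorphic_onI) (metis du field_differentiable_def field_differentiable_at_within)
    then show "(\<lambda>t. ?\<gamma> t $ i) holomorphic_on D"
      unfolding \<gamma> matrix_vector_mult_def by (auto intro!: holomorphic_intros)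
  next
    fix t assume t: "t \<in> D"
    have "pullback M W (u t) \<noteq> 0"
      using pb(3)[OF t] D(3,4)[OF t] by (auto simp: vec3_eq_iff)
    then show "form_at W (?\<gamma> t) \<noteq> 0"
      unfolding \<gamma> pullback_eq_0_iff[OF M] .
    have "(\<Sum>i\<in>UNIV. form_at W (?\<gamma> t) $ i * curve_deriv ?\<gamma> t $ i)
        = (\<Sum>i\<in>UNIV. pullback M W (u t) $ i * v t $ i)"
      unfolding d1[OF t] unfolding \<gamma> pullback_nth form_at_def
      by (simp add: matrix_vector_mult_def sum_3 algebra_simps)
    also have "\<dots> = x t ^ n * (x' t * C t + poly b t * x t)"
      unfolding sum_3 pb[OF t] by (simp add: v_def C_def tangent_cone_def algebra_simps)
    also have "\<dots> = 0" using D(3)[OF t] by (simp add: x'_def g_def)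
    finally show "(\<Sum>i\<in>UNIV. form_at W (?\<gamma> t) $ i * curve_deriv ?\<gamma> t $ i) = 0" .
  next
    fix t p q assume t: "t \<in> D" and *: "p *s ?\<gamma> t + q *s curve_deriv ?\<gamma> t = 0"
    have "M *v (p *s u t + q *s v t) = 0"
      using * unfolding d1[OF t] \<gamma> by (simp add: matrix_vector_right_distrib vector_scalar_commute)
    then have "p *s u t + q *s v t = 0" by (rule inj)
    then have "(p *s u t + q *s v t) $ 1 = 0" "(p *s u t + q *s v t) $ 2 = 0" "(p *s u t + q *s v t) $ 3 = 0"
      by (simp_all only: zero_index)
    then have e: "p * x t + q * x' t = 0" "p * (t * x t) + q * (x t + t * x' t) = 0" "p = 0"
      unfolding u_def v_def by simp_all
    then show "p = 0" "q = 0" using D(4)[OF t] by (auto simp: algebra_simps)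
  qed
  fix t assume t: "t \<in> D"
  have "det (vector [u t, v t, w t] :: complex^3^3) = 2 * (x' t)\<^sup>2 - x t * x'' t"
    by (simp add: det_3 u_def v_def w_def power2_eq_square algebra_simps)
  also have "\<dots> = (x t)\<^sup>2 * ((g t)\<^sup>2 - g' t)"
    by (simp add: x'_def x''_def power2_eq_square algebra_simps)
  also have "(g t)\<^sup>2 - g' t = poly (wron a b) t / (C t)\<^sup>2"
    using D(3)[OF t]
    by (simp add: g_def g'_def power_divide diff_divide_distrib[symmetric] add_divide_distrib[symmetric])
      (simp add: C_def wron_def tangent_cone_def pderiv_add pderiv_pCons power2_eq_square algebra_simps)
  finally show "det (vector [?\<gamma> t, curve_deriv ?\<gamma> t, curve_deriv (curve_deriv ?\<gamma>) t] :: complex^3^3)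
          = det M * ((x t)\<^sup>2 * poly (wron a b) t / (C t)\<^sup>2)"
    unfolding d1[OF t] d2[OF t] \<gamma> det_mult_vectors by simp
qed

lemma same_point_refl: "same_point v v"
  unfolding same_point_def by (intro exI[of _ 1]) simp

lemma integral_curve_leaf:
  assumes "integral_curve W D \<gamma>" "s \<in> D" "t \<in> D"
  shows "\<gamma> t \<in> leaf W (\<gamma> s)"
  unfolding leaf_def joined_def using assms same_point_refl by blast

text \<open>At a critical slope that is not fixed, a leaf has an inflection point, so by convexity
  it is straight. As it sweeps out an open set of slopes, the Gauss map would be constant, against
  \<open>wron a b \<noteq> 0\<close>.\<close>

lemma convex_imp_critical_fixed:
  fixes a b :: "complex poly"
  assumes conv: "convex_foliation W" and M: "invertible M"
    and W: "\<And>v. v$1 \<noteq> 0 \<Longrightarrow> pullback M W v $ 1 = v$3 * (v$1) ^ n * poly a (v$2 / v$1)"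
      "\<And>v. v$1 \<noteq> 0 \<Longrightarrow> pullback M W v $ 2 = v$3 * (v$1) ^ n * poly b (v$2 / v$1)"
      "\<And>v. v$1 \<noteq> 0 \<Longrightarrow> pullback M W v $ 3 = - ((v$1) ^ (n + 1)) * poly (tangent_cone a b) (v$2 / v$1)"
    and J: "wron a b \<noteq> 0" "poly (wron a b) c = 0"
  shows "poly (tangent_cone a b) c = 0"
proof (rule ccontr)
  assume "poly (tangent_cone a b) c \<noteq> 0"
  then obtain D x where D: "open D" "connected D" "c \<in> D" "infinite D"
    "\<And>t. t \<in> D \<Longrightarrow> poly (tangent_cone a b) t \<noteq> 0" "\<And>t. t \<in> D \<Longrightarrow> x t \<noteq> (0::complex)"
    "\<And>t. t \<in> D \<Longrightarrow> (x has_field_derivative - x t * poly b t / poly (tangent_cone a b) t) (at t)"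
    using radial_leaf by blast
  have ic: "integral_curve W D (cone_curve M x)"
    by (rule integral_cone_curve(1)[OF M W D(1,2,5-7)])
  have det0: "det (vector [cone_curve M x c, curve_deriv (cone_curve M x) c,
            curve_deriv (curve_deriv (cone_curve M x)) c] :: complex^3^3) = 0"
    by (subst integral_cone_curve(2)[OF M W D(1,2,5-7,3)]) (simp_all add: J(2))
  define \<gamma> where "\<gamma> = cone_curve M x"
  have ns: "nonsingular_at W (\<gamma> c)"
  proof -
    have "form_at W (\<gamma> c) \<noteq> 0" "\<forall>p q. p *s \<gamma> c + q *s curve_deriv \<gamma> c = 0 \<longrightarrow> p = 0 \<and> q = 0"
      using ic D(3) unfolding integral_curve_def \<gamma>_def by blast+
    moreover from this(2) have "\<gamma> c \<noteq> 0" by (metis add.right_neutral vector_smult_lzero vector_smult_rzero zero_neq_one)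
    ultimately show ?thesis by (simp add: nonsingular_at_def)
  qed
  have "inflection_point W (\<gamma> c)"
    unfolding inflection_point_def
    using ic D(3) same_point_refl det0 unfolding \<gamma>_def
    by (intro exI[of _ D] exI[of _ "cone_curve M x"] exI[of _ c]) simp
  moreover have "\<gamma> c \<in> leaf W (\<gamma> c)" by (simp add: leaf_def)
  ultimately have "in_straight_line (leaf W (\<gamma> c))"
    using conv ns unfolding convex_foliation_def by blast
  then obtain l :: "complex^3" where l: "l \<noteq> 0" "\<And>w. w \<in> leaf W (\<gamma> c) \<Longrightarrow> (\<Sum>i\<in>UNIV. l$i * w$i) = 0"
    unfolding in_straight_line_def by blast
  define m where "m = transpose M *v l"
  have m0: "m \<noteq> 0"
  proof
    assume "m = 0"
    obtain N where N: "M ** N = mat 1" using M unfolding invertible_def by blast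
    have "transpose N *v m = l"
      unfolding m_def matrix_vector_mul_assoc matrix_transpose_mul[symmetric] N by simp
    then show False using \<open>m = 0\<close> l(1) by simp
  qed
  have line: "m$1 * x t + m$2 * (t * x t) + m$3 = 0" if t: "t \<in> D" for t
  proof -
    have "\<gamma> t \<in> leaf W (\<gamma> c)"
      unfolding \<gamma>_def by (rule integral_curve_leaf[OF ic D(3) t])
    from l(2)[OF this] show ?thesis
      by (simp add: \<gamma>_def cone_curve_def m_def matrix_vector_mult_def transpose_def sum_3 algebra_simps)
  qed
  \<comment> \<open>Differentiating the equation of the line and inserting the quadrature for
    \<open>x'\<close> leaves a linear relation between \<open>a\<close> and \<open>b\<close> with
    constant coefficients.\<close>
  have "poly (smult (m$2) a - smult (m$1) b) t = 0" if t: "t \<in> D" for t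
  proof -
    let ?x' = "- x t * poly b t / poly (tangent_cone a b) t"
    have "((\<lambda>t. m$1 * x t + m$2 * (t * x t) + m$3) has_field_derivative
        m$1 * ?x' + m$2 * (x t + t * ?x')) (at t)"
      using D(7)[OF t] by (auto intro!: derivative_eq_intros simp: algebra_simps)
    moreover have "((\<lambda>t. m$1 * x t + m$2 * (t * x t) + m$3) has_field_derivative 0) (at t)"
      by (rule has_field_derivative_transform_within_open[OF DERIV_const[of 0] D(1) t]) (simp add: line)
    ultimately have "m$1 * ?x' + m$2 * (x t + t * ?x') = 0" by (rule DERIV_unique)
    moreover have "?x' * poly (tangent_cone a b) t = - (x t * poly b t)"
      using D(5)[OF t] by simp
    ultimately have "x t * (m$2 * poly (tangent_cone a b) t - (m$1 + m$2 * t) * poly b t) = 0"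
      by algebra
    then show ?thesis using D(6)[OF t] by (simp add: tangent_cone_def algebra_simps)
  qed
  then have ab: "smult (m$2) a = smult (m$1) b"
    using poly_eq_by_infinite[OF _ D(4), of "smult (m$2) a - smult (m$1) b" 0] by simp
  have "smult (m$2) (wron a b) = 0" "smult (m$1) (wron a b) = 0"
  proof -
    have "smult (m$2) (wron a b) = smult (m$2) a * pderiv b - pderiv (smult (m$2) a) * b"
      by (simp add: wron_def pderiv_smult smult_diff_right)
    also have "\<dots> = 0" unfolding ab by (simp add: pderiv_smult mult.commute)
    finally show "smult (m$2) (wron a b) = 0" .
    have "smult (m$1) (wron a b) = a * pderiv (smult (m$1) b) - pderiv a * smult (m$1) b"
      by (simp add: wron_def pderiv_smult smult_diff_right)
    also have "\<dots> = 0" unfolding ab[symmetric] by (simp add: pderiv_smult mult.commute)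
    finally show "smult (m$1) (wron a b) = 0" .
  qed
  then have "m$1 = 0" "m$2 = 0" using J(1) by auto
  then have "m$3 = 0" using line[OF D(3)] by simp
  then show False using m0 \<open>m$1 = 0\<close> \<open>m$2 = 0\<close> by (simp add: vec3_eq_iff)
qed

text \<open>A leaf through a point of slope \<open>c\<close> that is not fixed sweeps out an open
  set of slopes. If the curve contained it, \<open>f\<close> would vanish on all of them.\<close>

lemma invariant_imp_fixed:
  fixes a b f :: "complex poly"
  assumes inv: "invariant_curve W F" and M: "invertible M"
    and W: "\<And>v. v$1 \<noteq> 0 \<Longrightarrow> pullback M W v $ 1 = v$3 * (v$1) ^ n * poly a (v$2 / v$1)"
      "\<And>v. v$1 \<noteq> 0 \<Longrightarrow> pullback M W v $ 2 = v$3 * (v$1) ^ n * poly b (v$2 / v$1)"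
      "\<And>v. v$1 \<noteq> 0 \<Longrightarrow> pullback M W v $ 3 = - ((v$1) ^ (n + 1)) * poly (tangent_cone a b) (v$2 / v$1)"
    and F: "\<And>v. v$1 \<noteq> 0 \<Longrightarrow> eval3 F (M *v v) = (v$3) ^ j * (v$1) ^ e * poly f (v$2 / v$1)"
    and f: "f \<noteq> 0" "poly f c = 0"
  shows "poly (tangent_cone a b) c = 0"
proof (rule ccontr)
  assume "poly (tangent_cone a b) c \<noteq> 0"
  then obtain D x where D: "open D" "connected D" "c \<in> D" "infinite D"
    "\<And>t. t \<in> D \<Longrightarrow> poly (tangent_cone a b) t \<noteq> 0" "\<And>t. t \<in> D \<Longrightarrow> x t \<noteq> (0::complex)"
    "\<And>t. t \<in> D \<Longrightarrow> (x has_field_derivative - x t * poly b t / poly (tangent_cone a b) t) (at t)"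
    using radial_leaf by blast
  have ic: "integral_curve W D (cone_curve M x)"
    by (rule integral_cone_curve(1)[OF M W D(1,2,5-7)])
  define \<gamma> where "\<gamma> = cone_curve M x"
  have ns: "nonsingular_at W (\<gamma> c)"
  proof -
    have "form_at W (\<gamma> c) \<noteq> 0" "\<forall>p q. p *s \<gamma> c + q *s curve_deriv \<gamma> c = 0 \<longrightarrow> p = 0 \<and> q = 0"
      using ic D(3) unfolding integral_curve_def \<gamma>_def by blast+
    moreover from this(2) have "\<gamma> c \<noteq> 0" by (metis add.right_neutral vector_smult_lzero vector_smult_rzero zero_neq_one)
    ultimately show ?thesis by (simp add: nonsingular_at_def)
  qed
  have F\<gamma>: "eval3 F (\<gamma> t) = x t ^ e * poly f t" if "t \<in> D" for t
    using F[of "vector [x t, t * x t, 1]"] D(6)[OF that] by (simp add: \<gamma>_def cone_curve_def)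
  have "eval3 F (\<gamma> c) = 0" using F\<gamma>[OF D(3)] f(2) by simp
  then have "eval3 F (\<gamma> t) = 0" if "t \<in> D" for t
    using inv ns integral_curve_leaf[OF ic D(3) that] unfolding invariant_curve_def \<gamma>_def by blast
  then have "poly f t = 0" if "t \<in> D" for t using F\<gamma>[OF that] D(6)[OF that] that by simp
  then have "f = 0" using poly_eq_by_infinite[OF _ D(4), of f 0] by simp
  with f(1) show False by simp
qed

section \<open>Slopes and radial coordinates\<close>

text \<open>The coefficients of \<open>(x - p)\<^sup>j f (a + p b)\<close>, \<open>j \<le> 1\<close>, as a polynomial in \<open>p\<close>; the factor \<open>x - p\<close> is
  contributed by the line at infinity.\<close>

definition slope_coeff0 :: "nat \<Rightarrow> complex poly \<Rightarrow> complex poly \<Rightarrow> complex poly" where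
  "slope_coeff0 j f a = (if j = 0 then f * a else pCons 0 (f * a))"

definition slope_coeff1 :: "nat \<Rightarrow> complex poly \<Rightarrow> complex poly \<Rightarrow> complex poly \<Rightarrow> complex poly" where
  "slope_coeff1 j f a b = (if j = 0 then f * b else pCons 0 (f * b) - f * a)"

definition slope_coeff2 :: "nat \<Rightarrow> complex poly \<Rightarrow> complex poly \<Rightarrow> complex poly" where
  "slope_coeff2 j f b = (if j = 0 then 0 else - (f * b))"

text \<open>The derivative \<open>dt/dp\<close> of a root \<open>t\<close> of
  \<open>(x - p)\<^sup>j f (a + p b)\<close> by implicit differentiation, in the shape of
  \<open>\<tau>\<close> in \<open>flat_of_const_trace\<close>.\<close>

definition slope_deriv :: "nat \<Rightarrow> complex poly \<Rightarrow> complex poly \<Rightarrow> complex poly \<Rightarrow> complex \<Rightarrow> complex \<Rightarrow> complex" where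
  "slope_deriv j f a b p t =
     - (poly (slope_coeff1 j f a b) t + 2 * p * poly (slope_coeff2 j f b) t) /
     (poly (pderiv (slope_coeff0 j f a)) t + p * poly (pderiv (slope_coeff1 j f a b)) t
       + p\<^sup>2 * poly (pderiv (slope_coeff2 j f b)) t)"

lemma slope_coeffs:
  assumes "j \<le> 1"
  shows "slope_coeff0 j f a + smult p (slope_coeff1 j f a b) + smult (p\<^sup>2) (slope_coeff2 j f b)
     = [:-p, 1:] ^ j * (f * (a + smult p b))"
proof -
  have "j = 0 \<or> j = 1" using assms by auto
  then show ?thesis
  proof
    assume "j = 0"
    then show ?thesis by (simp add: slope_coeff0_def slope_coeff1_def slope_coeff2_def algebra_simps)
  next
    assume "j = 1"
    then show ?thesis
      by (intro poly_ext)
        (simp add: slope_coeff0_def slope_coeff1_def slope_coeff2_def power2_eq_square algebra_simps)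
  qed
qed

text \<open>The factor \<open>(x - p)\<^sup>j\<close> contributes at most the root \<open>p\<close>.
  So \<open>j + degree f + n\<close> distinct roots force \<open>j \<le> 1\<close> and, for
  \<open>j = 1\<close>, a root \<open>p\<close> not shared with the other factors.\<close>

lemma card_roots_with_infinity:
  fixes a b f :: "complex poly"
  defines "R p \<equiv> a + smult p b"
  assumes dR: "degree (R p) \<le> n" and nz: "f * R p \<noteq> 0"
    and S: "S = {t. poly ([:-p, 1:] ^ j * (f * R p)) t = 0}" "card S = j + degree f + n"
  shows "j \<le> 1" "card {t. poly (R p * f) t = 0} = n + degree f"
    "S = (if j = 0 then {t. poly (R p * f) t = 0} else insert p {t. poly (R p * f) t = 0})"
    "j \<noteq> 0 \<Longrightarrow> poly (R p * f) p \<noteq> 0"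
proof -
  define S' where "S' = {t. poly (R p * f) t = 0}"
  have fin: "finite S'" unfolding S'_def using nz by (intro poly_roots_finite) auto
  have "card S' \<le> degree (R p * f)"
    unfolding S'_def using nz by (intro card_poly_roots_bound) auto
  also have "\<dots> \<le> n + degree f" using degree_mult_le[of "R p" f] dR by simp
  finally have c: "card S' \<le> n + degree f" .
  have eq: "S = (if j = 0 then S' else insert p S')"
    unfolding S S'_def by auto
  have "j \<le> 1 \<and> card S' = n + degree f \<and> (j \<noteq> 0 \<longrightarrow> p \<notin> S')"
    using S(2) c fin unfolding eq by (auto simp: card_insert_if split: if_splits)
  then show "j \<le> 1" "card {t. poly (R p * f) t = 0} = n + degree f"
    "S = (if j = 0 then {t. poly (R p * f) t = 0} else insert p {t. poly (R p * f) t = 0})"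
    "j \<noteq> 0 \<Longrightarrow> poly (R p * f) p \<noteq> 0"
    using eq unfolding S'_def by auto
qed

text \<open>The three kinds of slopes: those of fixed lines stand still, the preimages of
  \<open>p\<close> under the Gauss map move as in \<open>slope_trace\<close>, and the slope
  \<open>p\<close> of the line at infinity moves at speed 1.\<close>

lemma slope_deriv_simps:
  fixes a b f :: "complex poly"
  defines "R p \<equiv> a + smult p b"
  assumes "j \<le> 1" "j \<noteq> 0 \<Longrightarrow> t \<noteq> p"
  shows "poly f t = 0 \<Longrightarrow> slope_deriv j f a b p t = 0"
    and "poly (R p) t = 0 \<Longrightarrow> poly f t \<noteq> 0 \<Longrightarrow>
      slope_deriv j f a b p t = - poly b t / poly (pderiv (R p)) t"
    and "j = 1 \<Longrightarrow> poly (R p * f) p \<noteq> 0 \<Longrightarrow> slope_deriv j f a b p p = 1"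
proof -
  have den: "poly (pderiv (slope_coeff0 j f a)) x + p * poly (pderiv (slope_coeff1 j f a b)) x
       + p\<^sup>2 * poly (pderiv (slope_coeff2 j f b)) x = poly (pderiv ([:-p, 1:] ^ j * (f * R p))) x" for x
    unfolding R_def slope_coeffs[OF assms(2), symmetric] by (simp add: pderiv_add pderiv_smult)
  have j: "j = 0 \<or> j = 1" using assms(2) by auto
  have num: "poly (slope_coeff1 j f a b) x + 2 * p * poly (slope_coeff2 j f b) x
     = (if j = 0 then poly f x * poly b x else (x - p) * poly f x * poly b x - poly f x * poly (R p) x)" for x
    using j by (auto simp: slope_coeff1_def slope_coeff2_def R_def algebra_simps)
  show "poly f t = 0 \<Longrightarrow> slope_deriv j f a b p t = 0"
    unfolding slope_deriv_def num by auto
  show "slope_deriv j f a b p t = - poly b t / poly (pderiv (R p)) t"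
    if t: "poly (R p) t = 0" "poly f t \<noteq> 0"
    using j
  proof
    assume "j = 0"
    then show ?thesis
      unfolding slope_deriv_def num den using t by (simp add: pderiv_mult)
  next
    assume "j = 1"
    then have "t - p \<noteq> 0" using assms(3) by simp
    then show ?thesis
      using \<open>j = 1\<close> unfolding slope_deriv_def num den using t
      by (simp add: pderiv_mult pderiv_pCons del: mult_pCons_left)
  qed
  show "slope_deriv j f a b p p = 1" if "j = 1" "poly (R p * f) p \<noteq> 0"
    unfolding slope_deriv_def num den using that
    by (simp add: pderiv_mult pderiv_pCons del: mult_pCons_left)
qed

text \<open>The slope \<open>p\<close> adds only a constant: at any other slope \<open>t\<close> its
  quotient \<open>(p - s) / (t - s)\<close>, \<open>s = p\<close>, is 0, and at \<open>t = p\<close>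
  all quotients are 1, so \<open>sym2\<close> is \<open>N^2 - N\<close> for the
  \<open>N = n + degree f\<close> other slopes.\<close>

lemma sum_slope_deriv:
  fixes a b f :: "complex poly"
  defines "R p \<equiv> a + smult p b"
  assumes dR: "degree (R p) \<le> n" and nz: "f * R p \<noteq> 0"
    and S: "S = {t. poly ([:-p, 1:] ^ j * (f * R p)) t = 0}" "card S = j + degree f + n"
  shows "(\<Sum>t\<in>S. slope_deriv j f a b p t * sym2 S p t) =
     slope_trace a b {t. poly (R p * f) t = 0} p
     + of_nat j * ((of_nat (n + degree f))\<^sup>2 - of_nat (n + degree f))"
proof -
  define S' where "S' = {t. poly (R p * f) t = 0}"
  note c = card_roots_with_infinity[OF dR[unfolded R_def] nz[unfolded R_def] S[unfolded R_def],
      folded R_def, folded S'_def]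
  have nz': "R p * f \<noteq> 0" using nz by auto
  note simple = simple_roots_product[OF S'_def nz' dR c(2)]
  have fin: "finite S'" by (rule simple(4))
  have p_notin: "p \<notin> S'" if "j \<noteq> 0" using c(4)[OF that] by (simp add: S'_def)
  have sym: "sym2 S p t = sym2 S' p t" if "t \<in> S'" for t
  proof (cases "j = 0")
    case False
    then have "S - {t} = insert p (S' - {t})" "p \<notin> S' - {t}"
      using c(3) p_notin that by auto
    then show ?thesis using fin by (simp add: sym2_def)
  qed (simp add: c(3))
  have tau: "slope_deriv j f a b p t * sym2 S p t =
      (if poly (R p) t = 0 then - poly b t / poly (pderiv (R p)) t * sym2 S' p t else 0)"
    if t: "t \<in> S'" for t
  proof -
    have tp: "j \<noteq> 0 \<Longrightarrow> t \<noteq> p" using p_notin t by auto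
    show ?thesis
    proof (cases "poly (R p) t = 0")
      case True
      then show ?thesis
        using slope_deriv_simps(2)[OF c(1) tp] simple(5)[of t] sym[OF t] by (simp add: R_def)
    next
      case False
      then have "poly f t = 0" using t by (simp add: S'_def)
      then show ?thesis
        using slope_deriv_simps(1)[OF c(1) tp] False by simp
    qed
  qed
  have main: "(\<Sum>t\<in>S'. slope_deriv j f a b p t * sym2 S p t) = slope_trace a b S' p"
  proof -
    have "(\<Sum>t\<in>S'. slope_deriv j f a b p t * sym2 S p t)
      = (\<Sum>t\<in>S'. if poly (R p) t = 0 then - poly b t / poly (pderiv (R p)) t * sym2 S' p t else 0)"
      by (intro sum.cong tau) auto
    also have "\<dots> = slope_trace a b S' p"
      unfolding slope_trace_def R_def[symmetric] using fin by (subst sum.inter_filter[symmetric]) auto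
    finally show ?thesis .
  qed
  show ?thesis
  proof (cases "j = 0")
    case True
    then show ?thesis using main c(3) unfolding S'_def by simp
  next
    case False
    then have j: "j = 1" using c(1) by simp
    have S_eq: "S = insert p S'" using c(3) False by simp
    have "S - {p} = S'" using S_eq p_notin[OF False] by auto
    have "sym2 S p p = (\<Sum>s\<in>S'. 1)\<^sup>2 - (\<Sum>s\<in>S'. 1)"
      unfolding sym2_def \<open>S - {p} = S'\<close> using p_notin[OF False]
      by (intro arg_cong2[of _ _ _ _ "(-)"] arg_cong[of _ _ "\<lambda>x. x\<^sup>2"] sum.cong) auto
    then have "sym2 S p p = (of_nat (n + degree f))\<^sup>2 - of_nat (n + degree f)"
      using c(2) by simp
    moreover have "slope_deriv j f a b p p = 1"
      \<comment> \<open>Any value other than \<open>p\<close> can stand for the parameter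
        \<open>t\<close> here.\<close>
      using slope_deriv_simps(3)[of j "p + 1" p] c(1) j c(4) by (auto simp: R_def)
    moreover have "(\<Sum>t\<in>S. slope_deriv j f a b p t * sym2 S p t)
       = slope_deriv j f a b p p * sym2 S p p + (\<Sum>t\<in>S'. slope_deriv j f a b p t * sym2 S p t)"
      unfolding S_eq using fin p_notin[OF False] by simp
    ultimately show ?thesis
      using main j unfolding S'_def by simp
  qed
qed

section \<open>Changing the slope coordinate\<close>

lemma reflection:
  fixes p q :: "complex poly"
  assumes "\<And>t. t \<noteq> 0 \<Longrightarrow> poly p t = t ^ N * poly q (1 / t)"
  shows "degree p \<le> N" "coeff p N = poly q 0"
proof -
  define D where "D = degree q"
  have "poly (monom 1 D * p) t = poly (monom 1 N * reflect_poly q) t" if "t \<in> UNIV - {0}" for t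
    using that assms[of t] poly_reflect_poly_nz[of t q]
    by (simp add: poly_monom D_def divide_inverse)
  moreover have "infinite (UNIV - {0::complex})" using infinite_UNIV_char_0 by simp
  ultimately have eq: "monom 1 D * p = monom 1 N * reflect_poly q"
    using poly_eq_by_infinite[of "UNIV - {0}" "monom 1 D * p" "monom 1 N * reflect_poly q"] by blast
  have "degree p \<le> N \<and> coeff p N = poly q 0"
  proof (cases "q = 0")
    case True
    then have "p = 0" using eq by simp
    then show ?thesis using True by simp
  next
    case False
    have "D \<le> N"
    proof (rule ccontr)
      assume "\<not> D \<le> N"
      then have "coeff (monom 1 D * p) N = 0" by (simp add: coeff_monom_mult)
      then show False using False unfolding eq by (simp add: coeff_monom_mult)
    qed
    have cp: "coeff p i = (if i + D < N then 0 else coeff (reflect_poly q) (i + D - N))" for i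
      using arg_cong[OF eq, of "\<lambda>r. coeff r (i + D)"] by (simp add: coeff_monom_mult)
    have "degree p \<le> N"
      by (rule degree_le) (auto simp: cp coeff_reflect_poly D_def)
    moreover have "coeff p N = poly q 0"
      by (simp add: cp coeff_reflect_poly D_def poly_0_coeff_0)
    ultimately show ?thesis by blast
  qed
  then show "degree p \<le> N" "coeff p N = poly q 0" by auto
qed

text \<open>The Wronskian of two binary forms of degree \<open>n\<close> behaves as a form of degree
  \<open>2 n - 2\<close>: the terms with the factor \<open>n\<close> in the two derivatives
  cancel.\<close>

lemma wron_reflection:
  fixes a b A B :: "complex poly"
  assumes n: "n \<ge> 1"
    and a: "\<And>t. t \<noteq> 0 \<Longrightarrow> poly a t = t ^ n * poly A (1 / t)"
    and b: "\<And>t. t \<noteq> 0 \<Longrightarrow> poly b t = t ^ n * poly B (1 / t)"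
    and t: "t \<noteq> 0"
  shows "poly (wron a b) t = t ^ (2 * n - 2) * poly (- wron A B) (1 / t)"
proof -
  have d: "poly (pderiv u) t = t ^ (n - 1) * (of_nat n * poly U (1 / t) - 1 / t * poly (pderiv U) (1 / t))"
    if u: "\<And>t. t \<noteq> 0 \<Longrightarrow> poly u t = t ^ n * poly U (1 / t)" for u U
  proof -
    have "((\<lambda>t. t ^ n * poly U (1 / t)) has_field_derivative
        of_nat n * t ^ (n - 1) * poly U (1 / t) + t ^ n * (poly (pderiv U) (1 / t) * (- 1 / t\<^sup>2))) (at t)"
      using t by (auto intro!: derivative_eq_intros DERIV_chain'[OF _ poly_DERIV] simp: power2_eq_square)
    then have "(poly u has_field_derivative
        of_nat n * t ^ (n - 1) * poly U (1 / t) + t ^ n * (poly (pderiv U) (1 / t) * (- 1 / t\<^sup>2))) (at t)"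
      by (rule has_field_derivative_transform_within_open[of _ _ _ "UNIV - {0}"]) (use t u in auto)
    then have "poly (pderiv u) t
       = of_nat n * t ^ (n - 1) * poly U (1 / t) + t ^ n * (poly (pderiv U) (1 / t) * (- 1 / t\<^sup>2))"
      using poly_DERIV DERIV_unique by blast
    also have "t ^ n = t * t ^ (n - 1)" using n by (cases n) auto
    finally show ?thesis using t by (simp add: field_simps power2_eq_square)
  qed
  have da: "poly (pderiv a) t = t ^ (n - 1) * (of_nat n * poly A (1 / t) - 1 / t * poly (pderiv A) (1 / t))"
    by (rule d[OF a])
  have db: "poly (pderiv b) t = t ^ (n - 1) * (of_nat n * poly B (1 / t) - 1 / t * poly (pderiv B) (1 / t))"
    by (rule d[OF b])
  have "poly (wron a b) t = t ^ n * t ^ (n - 1) * (1 / t) * poly (- wron A B) (1 / t)"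
    unfolding wron_def poly_diff poly_mult da db a[OF t] b[OF t] poly_minus
    by (simp add: algebra_simps)
  also have "t ^ n * t ^ (n - 1) * (1 / t) = t ^ (2 * n - 2)"
    using t n by (cases n) (auto simp: mult_2 power_add)
  finally show ?thesis .
qed

text \<open>The new slope \<open>t\<close> is the old slope \<open>c + 1 / t\<close>, so the
  direction missed by the new coordinate is the old slope \<open>c\<close>. The matrix is symmetric
  and commutes with homotheties.\<close>

definition radial_change :: "complex \<Rightarrow> complex^3^3" where
  "radial_change c = vector [vector [0, 1, 0], vector [1, c, 0], vector [0, 0, 1]]"

definition radial_change_inv :: "complex \<Rightarrow> complex^3^3" where
  "radial_change_inv c = vector [vector [-c, 1, 0], vector [1, 0, 0], vector [0, 0, 1]]"

lemma radial_change_mult: "radial_change c *v v = vector [v$2, v$1 + c * v$2, v$3]"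
  by (simp add: vec3_eq_iff matrix_vector_mult_def radial_change_def sum_3)

lemma radial_change_inv_mult: "radial_change_inv c *v v = vector [v$2 - c * v$1, v$1, v$3]"
  by (simp add: vec3_eq_iff matrix_vector_mult_def radial_change_inv_def sum_3)

lemma radial_change_inverse:
  "radial_change c ** radial_change_inv c = mat 1" "radial_change_inv c ** radial_change c = mat 1"
  by (simp_all add: vec_eq_iff forall_3 matrix_matrix_mult_def radial_change_def radial_change_inv_def
      sum_3 mat_def)

lemma pullback_radial_change:
  "pullback (M ** radial_change c) W v = radial_change c *v pullback M W (radial_change c *v v)"
proof -
  have "transpose (radial_change c) = radial_change c"
    by (simp add: vec_eq_iff forall_3 radial_change_def transpose_def)
  then show ?thesis
    by (simp only: pullback_def matrix_transpose_mul matrix_vector_mul_assoc[symmetric])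
qed

lemma homogeneous_chart_radial_change:
  assumes "homogeneous_chart M F W"
  shows "homogeneous_chart (M ** radial_change c) F W"
proof -
  have hom: "radial_change c *v hom3 s v = hom3 s (radial_change c *v v)" for s v
    by (simp add: radial_change_mult vec3_eq_iff algebra_simps)
  have inv: "invertible (M ** radial_change c)"
    using assms radial_change_inverse unfolding homogeneous_chart_def
    by (metis invertible_def invertible_mult)
  have lin: "radial_change c *v (b *s v) = b *s (radial_change c *v v)" for b v
    by (simp add: vector_scalar_commute)
  show ?thesis
    unfolding homogeneous_chart_def
  proof (intro conjI inv allI impI)
    fix s :: complex assume s: "s \<noteq> 0"
    show "\<exists>a. a \<noteq> 0 \<and> (\<forall>v. eval3 F ((M ** radial_change c) *v hom3 s v) = a * eval3 F ((M ** radial_change c) *v v))"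
      using assms s unfolding homogeneous_chart_def matrix_vector_mul_assoc[symmetric] hom by blast
    obtain b where b: "b \<noteq> 0" "\<And>v. hom3 s (pullback M W (hom3 s v)) = b *s pullback M W v"
      using assms s unfolding homogeneous_chart_def by blast
    show "\<exists>b. b \<noteq> 0 \<and> (\<forall>v. hom3 s (pullback (M ** radial_change c) W (hom3 s v)) = b *s pullback (M ** radial_change c) W v)"
      unfolding pullback_radial_change
      by (intro exI[of _ b] conjI allI b(1))
        (simp only: hom[symmetric] b(2)[of "radial_change c *v _", unfolded hom[symmetric]] lin)
  qed
qed

section \<open>The dual web in homogeneous coordinates\<close>

text \<open>The line \<open>y = p x - q\<close> of the chart \<open>M ** N\<close>, seen in the
  chart \<open>M\<close>, consists of the points \<open>line_base + x line_dir\<close>, the images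
  under \<open>N\<close> of \<open>(x, p x - q, 1)\<close>.\<close>

definition line_base :: "complex^3^3 \<Rightarrow> complex \<times> complex \<Rightarrow> complex^3" where
  "line_base N z = N *v vector [0, - snd z, 1]"

definition line_dir :: "complex^3^3 \<Rightarrow> complex \<times> complex \<Rightarrow> complex^3" where
  "line_dir N z = N *v vector [1, fst z, 0]"

text \<open>The cross product of base and direction, hence the coefficients of the equation of the
  line in the chart \<open>M\<close>.\<close>

definition line_coord :: "complex^3^3 \<Rightarrow> complex \<times> complex \<Rightarrow> complex^3" where
  "line_coord N z = (let Y = line_base N z; D = line_dir N z in
     vector [Y$2 * D$3 - Y$3 * D$2, Y$3 * D$1 - Y$1 * D$3, Y$1 * D$2 - Y$2 * D$1])"

lemma line_coord_nth:
  "line_coord N z $ 1 = line_base N z $ 2 * line_dir N z $ 3 - line_base N z $ 3 * line_dir N z $ 2"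
  "line_coord N z $ 2 = line_base N z $ 3 * line_dir N z $ 1 - line_base N z $ 1 * line_dir N z $ 3"
  "line_coord N z $ 3 = line_base N z $ 1 * line_dir N z $ 2 - line_base N z $ 2 * line_dir N z $ 1"
  by (simp_all add: line_coord_def Let_def)

lemma line_nth:
  "line_base N z $ i = N$i$3 - snd z * N$i$2" "line_dir N z $ i = N$i$1 + fst z * N$i$2"
  by (simp_all add: line_base_def line_dir_def matrix_vector_mult_def sum_3)

text \<open>The point of the line \<open>z\<close> at which the leaf of the dual web defined by \<open>\<theta>\<close> is tangent.\<close>

definition contact_point :: "complex^3^3 \<Rightarrow> complex \<times> complex \<Rightarrow> complex \<times> complex \<Rightarrow> complex^3" where
  "contact_point N \<theta> z = snd \<theta> *s line_base N z - fst \<theta> *s line_dir N z"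

lemma Leg_eq:
  "Leg (M ** N) F W z x = eval3 F (M *v (line_base N z + x *s line_dir N z)) *
     (\<Sum>i\<in>UNIV. pullback M W (line_base N z + x *s line_dir N z) $ i * line_dir N z $ i)"
proof -
  define X :: "complex^3" where "X = vector [x, fst z * x - snd z, 1]"
  have X: "N *v X = line_base N z + x *s line_dir N z"
    by (simp add: vec3_eq_iff line_nth X_def matrix_vector_mult_def sum_3 algebra_simps)
  have "pullback (M ** N) W X $ 1 + fst z * pullback (M ** N) W X $ 2
     = (\<Sum>i\<in>UNIV. pullback M W (N *v X) $ i * line_dir N z $ i)"
    unfolding pullback_nth line_nth matrix_vector_mul_assoc[symmetric]
    by (simp add: matrix_matrix_mult_def sum_3 algebra_simps)
  then show ?thesis
    unfolding Leg_def split_def Let_def X_def[symmetric] matrix_vector_mul_assoc[symmetric] X by simp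
qed

text \<open>At \<open>y\<close> the coefficients of the form are proportional to
  \<open>(y\<^sub>3 a, y\<^sub>3 b, - y\<^sub>1 a - y\<^sub>2 b)\<close>. Pairing them with the
  direction of the line produces minors of \<open>y\<close> and the direction, that is,
  \<open>a m\<^sub>2 - b m\<^sub>1\<close>.\<close>

lemma Leg_factor:
  fixes a b f :: "complex poly" and M N :: "complex^3^3" and z :: "complex \<times> complex"
  assumes W: "\<And>v. v$1 \<noteq> 0 \<Longrightarrow> pullback M W v $ 1 = v$3 * (v$1) ^ n * poly a (v$2 / v$1)"
      "\<And>v. v$1 \<noteq> 0 \<Longrightarrow> pullback M W v $ 2 = v$3 * (v$1) ^ n * poly b (v$2 / v$1)"
      "\<And>v. v$1 \<noteq> 0 \<Longrightarrow> pullback M W v $ 3 = - ((v$1) ^ (n + 1)) * poly (tangent_cone a b) (v$2 / v$1)"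
    and F: "\<And>v. v$1 \<noteq> 0 \<Longrightarrow> eval3 F (M *v v) = (v$3) ^ j * (v$1) ^ e * poly f (v$2 / v$1)"
  defines "y x \<equiv> line_base N z + x *s line_dir N z"
  assumes y: "y x $ 1 \<noteq> 0"
  shows "Leg (M ** N) F W z x = (y x $ 3) ^ j * (y x $ 1) ^ (e + n) * poly f (y x $ 2 / y x $ 1) *
    (poly a (y x $ 2 / y x $ 1) * line_coord N z $ 2 - poly b (y x $ 2 / y x $ 1) * line_coord N z $ 1)"
proof -
  define t where "t = y x $ 2 / y x $ 1"
  have y2: "y x $ 2 = t * y x $ 1" using y by (simp add: t_def)
  have c: "line_coord N z $ 2 = y x $ 3 * line_dir N z $ 1 - y x $ 1 * line_dir N z $ 3"
    "- line_coord N z $ 1 = y x $ 3 * line_dir N z $ 2 - y x $ 2 * line_dir N z $ 3"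
    by (simp_all add: line_coord_nth y_def algebra_simps)
  have "(\<Sum>i\<in>UNIV. pullback M W (y x) $ i * line_dir N z $ i)
     = (y x $ 1) ^ n * (poly a t * (y x $ 3 * line_dir N z $ 1 - y x $ 1 * line_dir N z $ 3)
         + poly b t * (y x $ 3 * line_dir N z $ 2 - t * y x $ 1 * line_dir N z $ 3))"
    unfolding sum_3 W[OF y] t_def[symmetric] by (simp add: tangent_cone_def algebra_simps)
  also have "\<dots> = (y x $ 1) ^ n * (poly a t * line_coord N z $ 2 - poly b t * line_coord N z $ 1)"
    unfolding y2[symmetric] c(1) c(2)[symmetric] by simp
  finally show ?thesis
    unfolding Leg_eq y_def[symmetric] F[OF y] t_def[symmetric]
    by (simp add: power_add mult_ac)
qed

lemma line_coord_orthogonal: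
  "(\<Sum>i\<in>UNIV. line_coord N z $ i * (line_base N z + x *s line_dir N z) $ i) = 0"
  "(\<Sum>i\<in>UNIV. line_coord N z $ i * contact_point N \<theta> z $ i) = 0"
  unfolding sum_3 by (simp_all add: line_coord_nth contact_point_def algebra_simps)

text \<open>The factor \<open>[:u, w:]\<close> is read as a binary linear form. For
  \<open>w = 0\<close> its root is at infinity and is detected by the degree of the product falling
  below \<open>card I\<close>.\<close>

lemma prod_linear_has_factor:
  fixes g h :: "'a \<Rightarrow> complex"
  assumes fin: "finite I" and eq: "(\<Prod>i\<in>I. [:g i, h i:]) = q * [:u, w:]" and deg: "degree q < card I"
  shows "\<exists>i\<in>I. g i * w = h i * u"
proof (cases "w = 0")
  case False
  have "poly (\<Prod>i\<in>I. [:g i, h i:]) (- u / w) = 0"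
    unfolding eq using False by simp
  then obtain i where "i \<in> I" "g i + h i * (- u / w) = 0"
    using fin by (auto simp: poly_prod mult.commute)
  then show ?thesis using False by (intro bexI[of _ i]) (auto simp: field_simps)
next
  case True
  have "\<exists>i\<in>I. h i = 0"
  proof (rule ccontr)
    assume neg: "\<not> ?thesis"
    then have "degree (\<Prod>i\<in>I. [:g i, h i:]) = (\<Sum>i\<in>I. degree [:g i, h i:])"
      by (intro degree_prod_eq_sum_degree) auto
    also have "\<dots> = card I" using neg by simp
    finally have "card I = degree (q * [:u, w:])" unfolding eq by simp
    also have "\<dots> \<le> degree q" using True degree_mult_le[of q "[:u, w:]"] by simp
    finally show False using deg by simp
  qed
  then show ?thesis using True by auto
qed

text \<open>The linear forms are pairwise non-proportional. One of them is matched with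
  \<open>[:u, w:]\<close> and cancelled, and \<open>prod_linear_has_factor\<close> finds a second
  one proportional to it.\<close>

lemma prod_linear_no_square_factor:
  fixes g h :: "nat \<Rightarrow> complex"
  assumes nz: "\<And>i. i < d \<Longrightarrow> (g i, h i) \<noteq> 0"
    and wedge: "\<And>i j. i < d \<Longrightarrow> j < d \<Longrightarrow> i \<noteq> j \<Longrightarrow> g i * h j - h i * g j \<noteq> 0"
    and eq: "(\<Prod>i<d. [:g i, h i:]) = q * [:u, w:] * [:u, w:]" and deg: "degree q + 2 \<le> d"
  shows False
proof -
  have pn: "(\<Prod>i<d. [:g i, h i:]) \<noteq> 0" using nz by (auto simp: zero_prod_def)
  then have uw: "u \<noteq> 0 \<or> w \<noteq> 0" using eq by auto
  have "degree (q * [:u, w:]) < card {..<d}"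
    using deg degree_mult_le[of q "[:u, w:]"] by (auto split: if_splits)
  from prod_linear_has_factor[OF _ eq this] obtain i where i: "i < d" "g i * w = h i * u" by auto
  obtain c where c: "c \<noteq> 0" "[:g i, h i:] = smult c [:u, w:]"
  proof (cases "w = 0")
    case True
    then have "h i = 0" "g i \<noteq> 0" "u \<noteq> 0" using i uw nz[OF i(1)] by (auto simp: zero_prod_def)
    then show ?thesis using that[of "g i / u"] True by simp
  next
    case False
    then have "g i = h i / w * u" using i by (simp add: field_simps)
    moreover from this have "h i \<noteq> 0" using nz[OF i(1)] by (auto simp: zero_prod_def)
    ultimately show ?thesis using that[of "h i / w"] False by simp
  qed
  have "[:g i, h i:] * (\<Prod>k\<in>{..<d}-{i}. [:g k, h k:]) = q * [:u, w:] * [:u, w:]"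
    using i(1) eq by (simp add: prod.remove[of "{..<d}" i] del: mult_pCons_left)
  then have "[:u, w:] * smult c (\<Prod>k\<in>{..<d}-{i}. [:g k, h k:]) = [:u, w:] * (q * [:u, w:])"
    unfolding c(2) by (simp add: mult_ac del: mult_pCons_left mult_pCons_right smult_pCons)
  then have "smult c (\<Prod>k\<in>{..<d}-{i}. [:g k, h k:]) = q * [:u, w:]"
    using uw by (subst (asm) mult_left_cancel) auto
  then have "smult (1 / c) (smult c (\<Prod>k\<in>{..<d}-{i}. [:g k, h k:])) = smult (1 / c) (q * [:u, w:])"
    by (rule arg_cong)
  then have eq': "(\<Prod>k\<in>{..<d}-{i}. [:g k, h k:]) = smult (1 / c) q * [:u, w:]"
    unfolding mult_smult_left[symmetric] using c(1) by (simp del: mult_pCons_right)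
  have "degree (smult (1 / c) q) < card ({..<d} - {i})"
    using deg i(1) c(1) by simp
  from prod_linear_has_factor[OF _ eq' this] obtain k where k: "k < d" "k \<noteq> i" "g k * w = h k * u"
    by auto
  have "w * (g i * h k - h i * g k) = 0" "u * (g i * h k - h i * g k) = 0"
    using i(2) k(3) by algebra+
  then show False using wedge[OF i(1) k(1)] k(2) uw by auto
qed

text \<open>The web is singular at the line at infinity, where its equation vanishes identically,
  and at lines through the origin, where the equation has a square factor. The assumption
  \<open>gen\<close> excludes the axis on which the slope is undefined.\<close>

lemma regular_line_nondegenerate:
  fixes a b f :: "complex poly" and M N :: "complex^3^3" and g h :: "nat \<Rightarrow> complex"
  assumes W: "\<And>v. v$1 \<noteq> 0 \<Longrightarrow> pullback M W v $ 1 = v$3 * (v$1) ^ n * poly a (v$2 / v$1)"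
      "\<And>v. v$1 \<noteq> 0 \<Longrightarrow> pullback M W v $ 2 = v$3 * (v$1) ^ n * poly b (v$2 / v$1)"
      "\<And>v. v$1 \<noteq> 0 \<Longrightarrow> pullback M W v $ 3 = - ((v$1) ^ (n + 1)) * poly (tangent_cone a b) (v$2 / v$1)"
    and F: "\<And>v. v$1 \<noteq> 0 \<Longrightarrow> eval3 F (M *v v) = (v$3) ^ j * (v$1) ^ e * poly f (v$2 / v$1)"
    and d: "d = j + e + n" "d \<ge> 3"
    and nz: "\<And>i. i < d \<Longrightarrow> (g i, h i) \<noteq> 0"
    and wedge: "\<And>i j. i < d \<Longrightarrow> j < d \<Longrightarrow> i \<noteq> j \<Longrightarrow> g i * h j - h i * g j \<noteq> 0"
    and Leg: "\<And>x. Leg (M ** N) F W z x = (\<Prod>i<d. g i + h i * x)"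
    and gen: "line_base N z $ 1 \<noteq> 0 \<or> line_dir N z $ 1 \<noteq> 0"
  shows "line_coord N z $ 3 \<noteq> 0" "line_coord N z $ 1 \<noteq> 0 \<or> line_coord N z $ 2 \<noteq> 0"
proof -
  define Y D m where "Y = line_base N z" and "D = line_dir N z" and "m = line_coord N z"
  define L where "L i = [:Y $ i, D $ i:]" for i
  have "L 1 \<noteq> 0" using gen by (auto simp: L_def Y_def D_def)
  define A where "A = UNIV - {x. poly (L 1) x = 0}"
  have A: "infinite A"
    unfolding A_def using poly_roots_finite[OF \<open>L 1 \<noteq> 0\<close>] infinite_UNIV_char_0 by simp
  have L_eq: "(Y + x *s D) $ i = poly (L i) x" for x i by (simp add: L_def)
  have P: "poly (\<Prod>i<d. [:g i, h i:]) x = (poly (L 3) x) ^ j * (poly (L 1) x) ^ (e + n) * poly f (poly (L 2) x / poly (L 1) x) *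
    (poly a (poly (L 2) x / poly (L 1) x) * m $ 2 - poly b (poly (L 2) x / poly (L 1) x) * m $ 1)"
    if "x \<in> A" for x
    using Leg_factor[OF W F, where N = N and z = z and x = x] that Leg[of x]
    unfolding Y_def[symmetric] D_def[symmetric] m_def[symmetric] L_eq
    by (simp add: A_def poly_prod mult.commute)
  have pn: "(\<Prod>i<d. [:g i, h i:]) \<noteq> 0" using nz by (auto simp: zero_prod_def)
  show "line_coord N z $ 1 \<noteq> 0 \<or> line_coord N z $ 2 \<noteq> 0"
  proof (rule ccontr)
    assume "\<not> ?thesis"
    then have "poly (\<Prod>i<d. [:g i, h i:]) x = poly 0 x" if "x \<in> A" for x
      using P[OF that] by (simp add: m_def)
    then show False using poly_eq_by_infinite[OF _ A] pn by blast
  qed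
  show "line_coord N z $ 3 \<noteq> 0"
  proof
    assume "line_coord N z $ 3 = 0"
    \<comment> \<open>On a line through the origin \<open>y / x\<close> is constant, so \<open>Leg\<close> is a constant times powers of two
      linear forms in \<open>x\<close> of total degree \<open>d \<ge> 3\<close>.\<close>
    then have m3: "Y $ 1 * D $ 2 = Y $ 2 * D $ 1" by (simp add: line_coord_nth Y_def D_def)
    obtain \<rho> where \<rho>: "Y $ 2 = \<rho> * Y $ 1" "D $ 2 = \<rho> * D $ 1"
    proof (cases "Y $ 1 = 0")
      case True
      then have "D $ 1 \<noteq> 0" "Y $ 2 = 0" using gen m3 by (auto simp: Y_def D_def)
      then show ?thesis using that[of "D $ 2 / D $ 1"] True by simp
    next
      case False
      then show ?thesis using that[of "Y $ 2 / Y $ 1"] m3 by (simp add: field_simps)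
    qed
    define \<kappa> where "\<kappa> = poly f \<rho> * (poly a \<rho> * m $ 2 - poly b \<rho> * m $ 1)"
    have "poly (\<Prod>i<d. [:g i, h i:]) x = poly (smult \<kappa> (L 3 ^ j * L 1 ^ (e + n))) x" if x: "x \<in> A" for x
    proof -
      have "poly (L 2) x / poly (L 1) x = \<rho>"
        using x \<rho> by (simp add: A_def L_def field_simps)
      then show ?thesis using P[OF x] by (simp add: \<kappa>_def)
    qed
    then have eq: "(\<Prod>i<d. [:g i, h i:]) = smult \<kappa> (L 3 ^ j * L 1 ^ (e + n))"
      using poly_eq_by_infinite[OF _ A] by blast
    have dL: "degree (L i) \<le> 1" for i by (simp add: L_def)
    have "j \<ge> 2 \<or> e + n \<ge> 2" using d by linarith
    then show False
    proof
      assume j: "j \<ge> 2"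
      show False
      proof (rule prod_linear_no_square_factor[OF nz wedge])
        have "L 3 ^ j = L 3 ^ (j - 2) * L 3 * L 3"
          using j by (metis le_add_diff_inverse2 mult.assoc power2_eq_square power_add)
        then show "(\<Prod>i<d. [:g i, h i:]) = smult \<kappa> (L 3 ^ (j - 2) * L 1 ^ (e + n)) * [:Y $ 3, D $ 3:] * [:Y $ 3, D $ 3:]"
          unfolding eq L_def[symmetric] by (simp add: mult_ac)
        have "degree (L 3 ^ (j - 2) * L 1 ^ (e + n)) \<le> (j - 2) * 1 + (e + n) * 1"
          by (intro degree_mult_le' degree_power_le' dL)
        then show "degree (smult \<kappa> (L 3 ^ (j - 2) * L 1 ^ (e + n))) + 2 \<le> d"
          using j d(1) degree_smult_le[of \<kappa> "L 3 ^ (j - 2) * L 1 ^ (e + n)"]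
          unfolding mult_1_right by arith
      qed
    next
      assume j: "e + n \<ge> 2"
      show False
      proof (rule prod_linear_no_square_factor[OF nz wedge])
        have "L 1 ^ (e + n) = L 1 ^ (e + n - 2) * L 1 * L 1"
          using j by (metis le_add_diff_inverse2 mult.assoc power2_eq_square power_add)
        then show "(\<Prod>i<d. [:g i, h i:]) = smult \<kappa> (L 3 ^ j * L 1 ^ (e + n - 2)) * [:Y $ 1, D $ 1:] * [:Y $ 1, D $ 1:]"
          unfolding eq L_def[symmetric] by (simp add: mult_ac)
        have "degree (L 3 ^ j * L 1 ^ (e + n - 2)) \<le> j * 1 + (e + n - 2) * 1"
          by (intro degree_mult_le' degree_power_le' dL)
        then show "degree (smult \<kappa> (L 3 ^ j * L 1 ^ (e + n - 2))) + 2 \<le> d"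
          using j d(1) degree_smult_le[of \<kappa> "L 3 ^ j * L 1 ^ (e + n - 2)"]
          unfolding mult_1_right by arith
      qed
    qed
  qed
qed

text \<open>Made for \<open>\<mu>\<^sub>i = m\<^sub>i / m\<^sub>3\<close>: the line coordinates have
  constant gradients, so the differential of a quotient is explicit and its closedness a
  computation.\<close>

lemma gradient_quotient:
  assumes u: "\<And>z. z \<in> U \<Longrightarrow> has_grad u A z" and w: "\<And>z. z \<in> U \<Longrightarrow> has_grad w B z"
    and nz: "\<And>z. z \<in> U \<Longrightarrow> w z \<noteq> 0" and U: "open U"
  defines "E \<equiv> \<lambda>z. cscale (1 / w z) A + cscale (- u z / (w z)\<^sup>2) B"
  shows "\<And>z. z \<in> U \<Longrightarrow> has_grad (\<lambda>z. u z / w z) (E z) z" "holomorphic_form U E"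
    "\<And>z. z \<in> U \<Longrightarrow> ext_deriv E z = 0"
proof -
  have hu: "holomorphic2 U u" "holomorphic2 U w" using u w U unfolding holomorphic2_iff by blast+
  have const: "holomorphic_form U (\<lambda>z. C)" "ext_deriv (\<lambda>z. C) z = 0" for C z
  proof -
    show "holomorphic_form U (\<lambda>z. C)"
      using U by (simp add: holomorphic_form_def holomorphic2_const)
    show "ext_deriv (\<lambda>z. C) z = 0"
      by (subst ext_deriv_eq, (rule has_grad_const)+) simp
  qed
  have gw: "has_grad (\<lambda>z. 1 / w z) (cscale (- 1 / (w z)\<^sup>2) B) z" if "z \<in> U" for z
    using has_grad_inverse[OF w[OF that] nz[OF that]]
    by (simp add: divide_inverse power_inverse)
  have g1: "has_grad (\<lambda>z. u z * (1 / w z)) (cscale (u z) (cscale (- 1 / (w z)\<^sup>2) B) + cscale (1 / w z) A) z"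
    if "z \<in> U" for z
    by (intro has_grad_mult u gw that)
  then show "has_grad (\<lambda>z. u z / w z) (E z) z" if "z \<in> U" for z
    using that by (simp add: E_def cscale_alg add.commute)
  have f2: "- u z / (w z)\<^sup>2 = - (u z * (1 / w z)) * (1 / w z)" for z
    by (simp add: power2_eq_square)
  have h1: "holomorphic_form U (\<lambda>z. cscale (1 / w z) A)"
    "holomorphic_form U (\<lambda>z. cscale (- u z / (w z)\<^sup>2) B)"
    unfolding power2_eq_square diff_0[symmetric] using nz
    by (intro holomorphic_form_scale const holomorphic2_divide holomorphic2_diff holomorphic2_mult
        holomorphic2_const hu U; simp)+
  then show "holomorphic_form U E" unfolding E_def by (rule holomorphic_form_add)
  fix z assume z: "z \<in> U"
  have g2: "has_grad (\<lambda>z. 0 - u z * (1 / w z) * (1 / w z))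
     (0 - (cscale (u z * (1 / w z)) (cscale (- 1 / (w z)\<^sup>2) B) +
       cscale (1 / w z) (cscale (u z) (cscale (- 1 / (w z)\<^sup>2) B) + cscale (1 / w z) A))) z"
    by (intro has_grad_diff has_grad_const has_grad_mult[OF g1 gw] z)
  then have g2: "has_grad (\<lambda>z. - u z / (w z)\<^sup>2)
     (0 - (cscale (u z * (1 / w z)) (cscale (- 1 / (w z)\<^sup>2) B) +
       cscale (1 / w z) (cscale (u z) (cscale (- 1 / (w z)\<^sup>2) B) + cscale (1 / w z) A))) z"
    unfolding f2 by simp
  show "ext_deriv E z = 0"
    unfolding E_def ext_deriv_add[OF h1 z] ext_deriv_scale[OF const(1) z gw[OF z]]
      ext_deriv_scale[OF const(1) z g2] const(2)
    by (simp add: wedge_def power2_eq_square algebra_simps)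
qed

text \<open>The products of \<open>p\<close> and \<open>q\<close> cancel in each minor, so the line
  coordinates are affine in \<open>(p, q)\<close> and this gradient is constant.\<close>

definition line_coord_grad :: "complex^3^3 \<Rightarrow> 3 \<Rightarrow> 3 \<Rightarrow> complex \<times> complex" where
  "line_coord_grad N i j = (N$i$3 * N$j$2 - N$j$3 * N$i$2, N$j$2 * N$i$1 - N$i$2 * N$j$1)"

lemma has_grad_affine: "has_grad (\<lambda>z. c + fst z * a + snd z * b) (a, b) z"
  unfolding has_grad_def by (auto intro!: derivative_eq_intros)

lemma has_grad_line_coord:
  "has_grad (\<lambda>z. line_coord N z $ 1) (line_coord_grad N 2 3) z"
  "has_grad (\<lambda>z. line_coord N z $ 2) (line_coord_grad N 3 1) z"
  "has_grad (\<lambda>z. line_coord N z $ 3) (line_coord_grad N 1 2) z"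
proof -
  have aff: "(N$i$3 - snd z * N$i$2) * (N$j$1 + fst z * N$j$2) - (N$j$3 - snd z * N$j$2) * (N$i$1 + fst z * N$i$2)
    = (N$i$3 * N$j$1 - N$j$3 * N$i$1) + fst z * (N$i$3 * N$j$2 - N$j$3 * N$i$2)
       + snd z * (N$j$2 * N$i$1 - N$i$2 * N$j$1)" for i j z
    by (simp add: algebra_simps)
  show "has_grad (\<lambda>z. line_coord N z $ 1) (line_coord_grad N 2 3) z"
    "has_grad (\<lambda>z. line_coord N z $ 2) (line_coord_grad N 3 1) z"
    "has_grad (\<lambda>z. line_coord N z $ 3) (line_coord_grad N 1 2) z"
    unfolding line_coord_nth line_nth aff line_coord_grad_def by (rule has_grad_affine)+
qed

text \<open>Projective duality: \<open>\<Sum>i. Y\<^sub>i dm\<^sub>i\<close> defines the pencil of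
  lines through \<open>Y\<close>, and for the contact point of \<open>\<theta>\<close> it gives back
  \<open>\<theta>\<close> up to the constant \<open>det N\<close>.\<close>

lemma contact_point_grad:
  fixes N :: "complex^3^3" and \<theta> z :: "complex \<times> complex"
  defines "Y \<equiv> contact_point N \<theta> z"
  shows "cscale (Y$1) (line_coord_grad N 2 3) + cscale (Y$2) (line_coord_grad N 3 1)
    + cscale (Y$3) (line_coord_grad N 1 2) = cscale (det N) \<theta>"
  by (simp add: Y_def contact_point_def line_nth line_coord_grad_def det_3 prod_eq_iff algebra_simps)

text \<open>Translates roots in \<open>x\<close> into slopes: \<open>\<theta>\<close> vanishes on
  \<open>(1, x)\<close> where the point with parameter \<open>x\<close> has the slope of the contact
  point.\<close>

lemma contact_point_param:
  fixes N :: "complex^3^3" and \<theta> z :: "complex \<times> complex"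
  defines "Y \<equiv> contact_point N \<theta> z" and "y x \<equiv> line_base N z + x *s line_dir N z"
  shows "(fst \<theta> + snd \<theta> * x) * line_coord N z $ 3 = y x $ 2 * Y$1 - y x $ 1 * Y$2"
  by (simp add: Y_def y_def contact_point_def line_coord_nth algebra_simps)

section \<open>The web near a regular point in slope coordinates\<close>

lemma holomorphic2_prod:
  "open U \<Longrightarrow> (\<And>i. i \<in> I \<Longrightarrow> holomorphic2 U (f i)) \<Longrightarrow> holomorphic2 U (\<lambda>z. \<Prod>i\<in>I. f i z)"
  by (induction I rule: infinite_finite_induct) (auto intro: holomorphic2_const holomorphic2_mult)

lemma holomorphic2_subset: "holomorphic2 U f \<Longrightarrow> open V \<Longrightarrow> V \<subseteq> U \<Longrightarrow> holomorphic2 V f"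
  unfolding holomorphic2_def by blast

lemma decomposes_subset: "decomposes d \<Phi> U \<theta> \<Longrightarrow> open V \<Longrightarrow> V \<subseteq> U \<Longrightarrow> decomposes d \<Phi> V \<theta>"
  unfolding decomposes_def holomorphic_form_def by (auto intro: holomorphic2_subset)

text \<open>The slope \<open>\<tau> = y\<^sub>2 / y\<^sub>1\<close> replaces \<open>x\<close> as
  parameter of the line. The two expressions for \<open>Leg\<close> share the factor
  \<open>y\<^sub>1^d\<close>, and removing it leaves the two polynomials in \<open>\<tau>\<close>.
  The factor \<open>\<tau> - p\<close> comes from \<open>y\<^sub>3\<close>, as \<open>p\<close> is
  the slope at which the line meets the line at infinity.\<close>

lemma slope_polynomial:
  fixes a b f :: "complex poly" and M N :: "complex^3^3" and \<theta> :: "nat \<Rightarrow> complex \<times> complex"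
    and z :: "complex \<times> complex"
  assumes W: "\<And>v. v$1 \<noteq> 0 \<Longrightarrow> pullback M W v $ 1 = v$3 * (v$1) ^ n * poly a (v$2 / v$1)"
      "\<And>v. v$1 \<noteq> 0 \<Longrightarrow> pullback M W v $ 2 = v$3 * (v$1) ^ n * poly b (v$2 / v$1)"
      "\<And>v. v$1 \<noteq> 0 \<Longrightarrow> pullback M W v $ 3 = - ((v$1) ^ (n + 1)) * poly (tangent_cone a b) (v$2 / v$1)"
    and F: "\<And>v. v$1 \<noteq> 0 \<Longrightarrow> eval3 F (M *v v) = (v$3) ^ j * (v$1) ^ e * poly f (v$2 / v$1)"
    and d: "d = j + e + n"
    and Leg: "\<And>x. Leg (M ** N) F W z x = (\<Prod>i<d. fst (\<theta> i) + snd (\<theta> i) * x)"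
    and m: "line_coord N z $ 2 \<noteq> 0" "line_coord N z $ 3 \<noteq> 0"
    and Y: "\<And>i. i < d \<Longrightarrow> contact_point N (\<theta> i) z $ 1 \<noteq> 0"
  defines "p \<equiv> - line_coord N z $ 1 / line_coord N z $ 2"
    and "t i \<equiv> contact_point N (\<theta> i) z $ 2 / contact_point N (\<theta> i) z $ 1"
  shows "\<exists>c. c \<noteq> 0 \<and> [:-p, 1:] ^ j * (f * (a + smult p b)) = smult c (\<Prod>i<d. [:- t i, 1:])"
proof -
  define B D where "B = line_base N z" and "D = line_dir N z"
  define m1 m2 m3 where "m1 = line_coord N z $ 1" and "m2 = line_coord N z $ 2" and "m3 = line_coord N z $ 3"
  define \<kappa>1 \<kappa>2 where "\<kappa>1 = (- m2 / m3) ^ j * m2" and "\<kappa>2 = (\<Prod>i<d. contact_point N (\<theta> i) z $ 1 / m3)"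
  have \<kappa>: "\<kappa>1 \<noteq> 0" "\<kappa>2 \<noteq> 0" using m Y by (auto simp: \<kappa>1_def \<kappa>2_def m2_def m3_def)
  have m3: "m3 = B$1 * D$2 - B$2 * D$1" by (simp add: m3_def line_coord_nth B_def D_def)
  have p: "m1 = - p * m2" using m by (simp add: p_def m1_def m2_def)
  \<comment> \<open>The excluded slope, if there is one, is that of \<open>line_dir\<close>, the
    point of the line missed by the parameter \<open>x\<close>.\<close>
  define A where "A = UNIV - {\<tau>. poly [:D$2, - D$1:] \<tau> = 0}"
  have "[:D$2, - D$1:] \<noteq> 0" using m(2) m3 by (auto simp: m3_def)
  then have A: "infinite A"
    unfolding A_def using poly_roots_finite infinite_UNIV_char_0 by (metis Diff_infinite_finite)
  have "poly (smult \<kappa>1 ([:-p, 1:] ^ j * (f * (a + smult p b)))) \<tau> = poly (smult \<kappa>2 (\<Prod>i<d. [:- t i, 1:])) \<tau>"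
    if \<tau>: "\<tau> \<in> A" for \<tau>
  proof -
    define q where "q = D$2 - \<tau> * D$1"
    have q: "q \<noteq> 0" using \<tau> by (simp add: A_def q_def)
    \<comment> \<open>The parameter of the point of slope \<open>\<tau>\<close>, from
      \<open>B$2 + x D$2 = \<tau> (B$1 + x D$1)\<close>.\<close>
    define x where "x = (\<tau> * B$1 - B$2) / q"
    define y where "y = B + x *s D"
    have xq: "x * q = \<tau> * B$1 - B$2" using q by (simp add: x_def)
    have y12: "y$2 = \<tau> * y$1"
    proof -
      have "q * (y$2 - \<tau> * y$1) = 0"
        using xq unfolding y_def q_def by (simp add: algebra_simps)
      then show ?thesis using q by simp
    qed
    have "q * y$1 = m3" using xq unfolding y_def q_def m3 by (simp add: algebra_simps) algebra
    then have y1: "y$1 \<noteq> 0" using m(2) by (auto simp: m3_def)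
    then have yt: "y$2 / y$1 = \<tau>" using y12 by simp
    have "m1 * y$1 + m2 * y$2 + m3 * y$3 = 0"
      using line_coord_orthogonal(1)[of N z x] unfolding sum_3 by (simp add: m1_def m2_def m3_def y_def B_def D_def)
    then have "m3 * y$3 = - m2 * y$1 * (\<tau> - p)" unfolding y12 p by algebra
    then have y3: "y$3 = - m2 / m3 * (y$1 * (\<tau> - p))"
      using m(2) by (simp add: m3_def field_simps)
    have "Leg (M ** N) F W z x = (y$3) ^ j * (y$1) ^ (e + n) * poly f \<tau> * (poly a \<tau> * m2 - poly b \<tau> * m1)"
      using Leg_factor[OF W F, where N = N and z = z and x = x] y1 yt
      by (simp add: y_def B_def D_def m1_def m2_def)
    also have "poly a \<tau> * m2 - poly b \<tau> * m1 = m2 * poly (a + smult p b) \<tau>"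
      by (simp add: p algebra_simps)
    also have "(y$3) ^ j = (- m2 / m3) ^ j * ((y$1) ^ j * (\<tau> - p) ^ j)"
      unfolding y3 power_mult_distrib ..
    finally have L1: "Leg (M ** N) F W z x = (y$1) ^ d * poly (smult \<kappa>1 ([:-p, 1:] ^ j * (f * (a + smult p b)))) \<tau>"
      by (simp add: \<kappa>1_def d power_add mult_ac)
    have "fst (\<theta> i) + snd (\<theta> i) * x = y$1 * (contact_point N (\<theta> i) z $ 1 / m3) * (\<tau> - t i)" if "i < d" for i
    proof -
      have "(fst (\<theta> i) + snd (\<theta> i) * x) * m3 = y$1 * (\<tau> * contact_point N (\<theta> i) z $ 1 - contact_point N (\<theta> i) z $ 2)"
        using contact_point_param[of "\<theta> i" x N z] y12
        unfolding m3_def y_def[symmetric] B_def[symmetric] D_def[symmetric] by algebra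
      also have "\<dots> = y$1 * (contact_point N (\<theta> i) z $ 1 * (\<tau> - t i))"
        using Y[OF that] by (simp add: t_def right_diff_distrib mult.commute)
      also have "\<dots> = y$1 * (contact_point N (\<theta> i) z $ 1 / m3) * (\<tau> - t i) * m3"
        using m(2) by (simp add: m3_def)
      finally show ?thesis
        using m(2) unfolding m3_def by (metis mult_right_cancel)
    qed
    then have pe: "(\<Prod>i<d. fst (\<theta> i) + snd (\<theta> i) * x) = (\<Prod>i<d. y$1 * (contact_point N (\<theta> i) z $ 1 / m3) * (\<tau> - t i))"
      by (intro prod.cong) auto
    then have "Leg (M ** N) F W z x = (y$1) ^ d * poly (smult \<kappa>2 (\<Prod>i<d. [:- t i, 1:])) \<tau>"
      unfolding Leg pe prod.distrib \<kappa>2_def[symmetric] by (simp add: poly_prod mult_ac)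
    with L1 show ?thesis using y1 by simp
  qed
  then have "smult \<kappa>1 ([:-p, 1:] ^ j * (f * (a + smult p b))) = smult \<kappa>2 (\<Prod>i<d. [:- t i, 1:])"
    using poly_eq_by_infinite[OF _ A] by blast
  then have "smult (1 / \<kappa>1) (smult \<kappa>1 ([:-p, 1:] ^ j * (f * (a + smult p b))))
      = smult (1 / \<kappa>1) (smult \<kappa>2 (\<Prod>i<d. [:- t i, 1:]))" by (rule arg_cong)
  then have "[:-p, 1:] ^ j * (f * (a + smult p b)) = smult (\<kappa>2 / \<kappa>1) (\<Prod>i<d. [:- t i, 1:])"
    using \<kappa> by (simp del: mult_pCons_left mult_pCons_right)
  then show ?thesis using \<kappa> by (intro exI[of _ "\<kappa>2 / \<kappa>1"]) auto
qed

text \<open>Each \<open>\<theta> i\<close> is a multiple of the slope form belonging to the slope of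
  its contact point, so the given decomposition fits the coframe \<open>d\<mu>\<^sub>1\<close>,
  \<open>d\<mu>\<^sub>2\<close>. Pairwise transversality makes the \<open>d\<close> slopes distinct,
  which supplies the root counts that the constancy of the trace requires.\<close>

lemma flat_at_generic_chart:
  fixes a b f :: "complex poly" and M N :: "complex^3^3" and \<theta> :: "nat \<Rightarrow> form1"
  assumes W: "\<And>v. v$1 \<noteq> 0 \<Longrightarrow> pullback M W v $ 1 = v$3 * (v$1) ^ n * poly a (v$2 / v$1)"
      "\<And>v. v$1 \<noteq> 0 \<Longrightarrow> pullback M W v $ 2 = v$3 * (v$1) ^ n * poly b (v$2 / v$1)"
      "\<And>v. v$1 \<noteq> 0 \<Longrightarrow> pullback M W v $ 3 = - ((v$1) ^ (n + 1)) * poly (tangent_cone a b) (v$2 / v$1)"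
    and F: "\<And>v. v$1 \<noteq> 0 \<Longrightarrow> eval3 F (M *v v) = (v$3) ^ j * (v$1) ^ e * poly f (v$2 / v$1)"
    and n: "n \<ge> 1" and a: "degree a \<le> n" and b: "degree b = n" and f: "degree f \<le> e"
    and J: "wron a b \<noteq> 0" "degree (wron a b) = 2 * n - 2"
    and cop: "\<And>c. \<not> (poly a c = 0 \<and> poly b c = 0)"
    and crit: "\<And>c. poly (wron a b) c = 0 \<Longrightarrow> poly (tangent_cone a b) c = 0"
    and inv: "\<And>c. poly f c = 0 \<Longrightarrow> poly (tangent_cone a b) c = 0"
    and d: "d = j + e + n" "d \<ge> 3" and N: "det N \<noteq> 0"
    and dec: "decomposes d (Leg (M ** N) F W) U \<theta>" and z0: "z0 \<in> U"
    and m: "line_coord N z0 $ 2 \<noteq> 0" "line_coord N z0 $ 3 \<noteq> 0"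
    and Y: "\<And>i. i < d \<Longrightarrow> contact_point N (\<theta> i z0) z0 $ 1 \<noteq> 0"
  shows "web_curvature_at d (Leg (M ** N) F W) z0 0"
proof -
  define cp where "cp i z = contact_point N (\<theta> i z) z" for i z
  define m1 m2 m3 where "m1 z = line_coord N z $ 1" and "m2 z = line_coord N z $ 2"
    and "m3 z = line_coord N z $ 3" for z
  have U: "open U" and hol_\<theta>: "\<And>i. i < d \<Longrightarrow> holomorphic_form U (\<theta> i)"
    using dec unfolding decomposes_def by blast+
  have hol_cp: "holomorphic2 U (\<lambda>z. cp i z $ l)" if "i < d" for i l
  proof -
    have "holomorphic2 U (\<lambda>z. line_base N z $ l)" "holomorphic2 U (\<lambda>z. line_dir N z $ l)"
      unfolding line_nth using U has_grad_fst has_grad_snd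
      by (intro holomorphic2_diff holomorphic2_add holomorphic2_mult holomorphic2_const; simp add: holomorphic2_iff; blast)+
    then show ?thesis
      unfolding cp_def contact_point_def using hol_\<theta>[OF that] unfolding holomorphic_form_def
      by (auto intro!: holomorphic2_diff holomorphic2_mult)
  qed
  have hol_m: "holomorphic2 U m2" "holomorphic2 U m3"
    using U has_grad_line_coord unfolding holomorphic2_iff m2_def m3_def by blast+
  \<comment> \<open>The product of all denominators; where it is nonzero is an open neighbourhood of
    \<open>z0\<close>.\<close>
  define G where "G z = m2 z * m3 z * (\<Prod>i<d. cp i z $ 1)" for z
  have "holomorphic2 U G"
    unfolding G_def[abs_def] by (intro holomorphic2_mult holomorphic2_prod hol_m hol_cp U) auto
  then have "continuous_on U G" by (rule holomorphic2_continuous_on)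
  define V where "V = U \<inter> G -` (- {0})"
  have V: "open V" unfolding V_def
    by (rule continuous_open_preimage[OF \<open>continuous_on U G\<close> U]) auto
  have VU: "V \<subseteq> U" by (auto simp: V_def)
  have Vnz: "m2 z \<noteq> 0" "m3 z \<noteq> 0" "i < d \<Longrightarrow> cp i z $ 1 \<noteq> 0" if "z \<in> V" for z i
    using that by (auto simp: V_def G_def)
  have z0V: "z0 \<in> V" using z0 m Y by (auto simp: V_def G_def m2_def m3_def cp_def)
  have decV: "decomposes d (Leg (M ** N) F W) V \<theta>" by (rule decomposes_subset[OF dec V VU])
  define A1 A2 A3 where "A1 = line_coord_grad N 2 3" and "A2 = line_coord_grad N 3 1" and "A3 = line_coord_grad N 1 2"
  have grad: "has_grad m1 A1 z" "has_grad m2 A2 z" "has_grad m3 A3 z" for z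
    using has_grad_line_coord[of N z] unfolding m1_def m2_def m3_def A1_def A2_def A3_def by auto
  define E1 where "E1 = (\<lambda>z. cscale (1 / m3 z) A1 + cscale (- m1 z / (m3 z)\<^sup>2) A3)"
  define E2 where "E2 = (\<lambda>z. cscale (1 / m3 z) A2 + cscale (- m2 z / (m3 z)\<^sup>2) A3)"
  have E1: "has_grad (\<lambda>z. m1 z / m3 z) (E1 z) z" "holomorphic_form V E1" "ext_deriv E1 z = 0"
    if "z \<in> V" for z
    using that unfolding E1_def
    by - ((rule gradient_quotient[OF grad(1) grad(3) Vnz(2) V]; assumption)+)
  have E2: "has_grad (\<lambda>z. m2 z / m3 z) (E2 z) z" "holomorphic_form V E2" "ext_deriv E2 z = 0"
    if "z \<in> V" for z
    using that unfolding E2_def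
    by - ((rule gradient_quotient[OF grad(2) grad(3) Vnz(2) V]; assumption)+)
  define \<mu> where "\<mu> z = m2 z / m3 z" for z
  define p where "p z = - m1 z / m2 z" for z
  define \<pi> where "\<pi> z = cscale (- 1 / \<mu> z) (E1 z + cscale (p z) (E2 z))" for z
  have \<mu>_nz: "\<mu> z \<noteq> 0" if "z \<in> V" for z using Vnz[OF that] by (simp add: \<mu>_def)
  have grad_p: "has_grad p (\<pi> z) z" if z: "z \<in> V" for z
  proof -
    have "has_grad (\<lambda>z. m1 z / m3 z * inverse (m2 z / m3 z))
       (cscale (m1 z / m3 z) (cscale (- (inverse (m2 z / m3 z))\<^sup>2) (E2 z)) + cscale (inverse (m2 z / m3 z)) (E1 z)) z"
      using E1(1)[OF z] E2(1)[OF z] \<mu>_nz[OF z] unfolding \<mu>_def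
      by (intro has_grad_mult has_grad_inverse) auto
    from has_grad_diff[OF has_grad_const[of 0] this]
    have "has_grad (\<lambda>z. 0 - m1 z / m3 z * inverse (m2 z / m3 z)) (\<pi> z) z"
    proof (rule back_subst[where P = "\<lambda>g. has_grad _ g z"])
      show "0 - (cscale (m1 z / m3 z) (cscale (- (inverse (m2 z / m3 z))\<^sup>2) (E2 z))
          + cscale (inverse (m2 z / m3 z)) (E1 z)) = \<pi> z"
        using Vnz[OF z] by (simp add: \<pi>_def p_def \<mu>_def prod_eq_iff field_simps power2_eq_square)
    qed
    then show ?thesis
      by (rule has_grad_cong_open[OF _ V z]) (use Vnz in \<open>auto simp: p_def field_simps\<close>)
  qed
  interpret slope_coframe V E1 E2 \<pi> \<mu> p
  proof
    show "has_grad \<mu> (E2 z) z" if "z \<in> V" for z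
      using E2(1)[OF that] by (simp add: \<mu>_def[abs_def])
    show "deriv_along \<pi> p 1 z" if "z \<in> V" for z
      using grad_p[OF that] by (simp add: deriv_along_def cscale_def)
  qed (use V E1 E2 \<mu>_nz z0V in \<open>auto simp: \<pi>_def\<close>)
  define t where "t i z = cp i z $ 2 / cp i z $ 1" for i z
  have \<theta>_eq: "cscale (det N) (\<theta> i z) = cscale (m3 z * cp i z $ 1) (slope_form (t i) z)"
    if i: "i < d" and z: "z \<in> V" for i z
  proof -
    have "m1 z * cp i z $ 1 + m2 z * cp i z $ 2 + m3 z * cp i z $ 3 = 0"
      using line_coord_orthogonal(2)[of N z "\<theta> i z"] by (simp add: sum_3 m1_def m2_def m3_def cp_def)
    then have c3: "cp i z $ 3 = - (m1 z * cp i z $ 1 + m2 z * cp i z $ 2) / m3 z"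
      using Vnz(2)[OF z] by (simp add: field_simps eq_neg_iff_add_eq_0)
    have "cscale (det N) (\<theta> i z) = cscale (cp i z $ 1) A1 + cscale (cp i z $ 2) A2 + cscale (cp i z $ 3) A3"
      unfolding cp_def A1_def A2_def A3_def contact_point_grad ..
    also have "\<dots> = cscale (m3 z * cp i z $ 1) (slope_form (t i) z)"
      unfolding c3 slope_form_def unfolding E1_def E2_def t_def using Vnz(2)[OF z] Vnz(3)[OF z i]
      by (simp add: prod_eq_iff field_simps power2_eq_square)
    finally show ?thesis .
  qed
  have wedge_sf: "(det N)\<^sup>2 * wedge (\<theta> i z) (\<theta> k z)
      = (m3 z)\<^sup>2 * cp i z $ 1 * cp k z $ 1 * ((t k z - t i z) * wedge (E1 z) (E2 z))"
    if "i < d" "k < d" "z \<in> V" for i k z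
  proof -
    have "(det N)\<^sup>2 * wedge (\<theta> i z) (\<theta> k z) = wedge (cscale (det N) (\<theta> i z)) (cscale (det N) (\<theta> k z))"
      by (simp add: wedge_def power2_eq_square algebra_simps)
    then show ?thesis
      unfolding \<theta>_eq[OF that(1,3)] \<theta>_eq[OF that(2,3)]
      by (simp add: wedge_def slope_form_def power2_eq_square algebra_simps)
  qed
  have wedge_\<theta>: "wedge (\<theta> i z) (\<theta> k z) \<noteq> 0" if "i < d" "k < d" "i \<noteq> k" "z \<in> V" for i k z
    using decV that unfolding decomposes_def by blast
  have t_neq: "t i z \<noteq> t k z" if "i < d" "k < d" "i \<noteq> k" "z \<in> V" for i k z
    using wedge_sf[OF that(1,2,4)] wedge_\<theta>[OF that] N by auto
  \<comment> \<open>Two transverse members of the web show that \<open>d\<mu>\<^sub>1\<close> and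
    \<open>d\<mu>\<^sub>2\<close> are independent.\<close>
  have w: "wedge (E1 z) (E2 z) \<noteq> 0" if "z \<in> V" for z
    using wedge_sf[of 0 1 z] wedge_\<theta>[of 0 1 z] N d(2) that by auto
  define R where "R x = a + smult x b" for x
  have dR: "degree (R x) \<le> n" for x
    unfolding R_def using a b by (intro degree_add_le order_trans[OF degree_smult_le]) auto
  define H where "H x = [:-x, 1:] ^ j * (f * R x)" for x
  have slope_poly: "\<exists>c. c \<noteq> 0 \<and> H (p z) = smult c (\<Prod>i<d. [:- t i z, 1:])" if z: "z \<in> V" for z
    unfolding H_def R_def p_def m1_def m2_def t_def cp_def
  proof (rule slope_polynomial[OF W F d(1)])
    show "Leg (M ** N) F W z x = (\<Prod>i<d. fst (\<theta> i z) + snd (\<theta> i z) * x)" for x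
      using decV z unfolding decomposes_def by blast
  qed (use Vnz[OF z] in \<open>auto simp: m2_def m3_def cp_def\<close>)
  have inj: "inj_on (\<lambda>i. t i z) {..<d}" if "z \<in> V" for z
    using t_neq[OF _ _ _ that] by (force simp: inj_on_def)
  define S where "S z = (\<lambda>i. t i z) ` {..<d}" for z
  have prod_S: "(\<Prod>i<d. [:- t i z, 1:]) = (\<Prod>s\<in>S z. [:-s, 1:])" if "z \<in> V" for z
    unfolding S_def using inj[OF that] by (simp add: prod.reindex)
  have card_S: "card (S z) = d" if "z \<in> V" for z
    unfolding S_def using inj[OF that] by (simp add: card_image)
  \<comment> \<open>The \<open>d = j + e + n\<close> slopes are finite and distinct, so neither
    \<open>f\<close> nor \<open>R\<close> can fall short of its maximal degree.\<close>
  have H_props: "f * R (p z) \<noteq> 0" "degree f = e" "S z = {x. poly (H (p z)) x = 0}"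
      "\<And>i. i < d \<Longrightarrow> poly (pderiv (H (p z))) (t i z) \<noteq> 0" if z: "z \<in> V" for z
  proof -
    obtain c where c: "c \<noteq> 0" "H (p z) = smult c (\<Prod>s\<in>S z. [:-s, 1:])"
      using slope_poly[OF z] prod_S[OF z] by auto
    have fin: "finite (S z)" by (simp add: S_def)
    have "degree (H (p z)) = d" using c prod_linear_degree(1)[OF fin] card_S[OF z] by simp
    moreover have "H (p z) \<noteq> 0" using c fin by auto
    ultimately show nz: "f * R (p z) \<noteq> 0" by (auto simp: H_def)
    have "degree (H (p z)) = j + (degree f + degree (R (p z)))"
      using nz unfolding H_def by (subst degree_mult_eq) (auto simp: degree_mult_eq degree_power_eq)
    then show "degree f = e" using \<open>degree (H (p z)) = d\<close> f dR[of "p z"] d(1) by linarith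
    show "S z = {x. poly (H (p z)) x = 0}"
      unfolding c(2) using c(1) fin by (auto simp: poly_prod)
    fix i assume "i < d"
    then have "t i z \<in> S z" by (auto simp: S_def)
    then show "poly (pderiv (H (p z))) (t i z) \<noteq> 0"
      unfolding c(2) using c(1) fin by (subst pderiv_at_simple_root) auto
  qed
  have S: "S z = {t. poly ([:- p z, 1:] ^ j * (f * (a + smult (p z) b))) t = 0}"
    "card (S z) = j + degree f + n" "f * (a + smult (p z) b) \<noteq> 0" if z: "z \<in> V" for z
    using H_props[OF z] card_S[OF z] d(1) unfolding H_def R_def by auto
  note card = card_roots_with_infinity[OF dR[unfolded R_def] S(3,1,2)]
  have j: "j \<le> 1" by (rule card(1)[OF z0V z0V z0V])
  have H_eq: "H x = slope_coeff0 j f a + smult x (slope_coeff1 j f a b) + smult (x\<^sup>2) (slope_coeff2 j f b)" for x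
    unfolding H_def R_def slope_coeffs[OF j] ..
  show ?thesis
  proof (rule flat_of_const_trace[OF decV z0V, where t = t and ?h0.0 = "slope_coeff0 j f a"
        and ?h1.0 = "slope_coeff1 j f a b" and ?h2.0 = "slope_coeff2 j f b"])
    show "holomorphic2 V (t i)" if "i < d" for i
      unfolding t_def[abs_def]
      by (intro holomorphic2_divide holomorphic2_subset[OF hol_cp[OF that] V VU]) (use Vnz that in auto)
    show "wedge (E1 z) (E2 z) \<noteq> 0" if "z \<in> V" for z by (rule w[OF that])
    show "t i z \<noteq> t k z" if "i < d" "k < d" "i \<noteq> k" "z \<in> V" for i k z by (rule t_neq[OF that])
    show "wedge (slope_form (t i) z) (\<theta> i z) = 0" if "i < d" "z \<in> V" for i z
    proof -
      have "det N * wedge (slope_form (t i) z) (\<theta> i z) = wedge (slope_form (t i) z) (cscale (det N) (\<theta> i z))"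
        by (simp add: wedge_def algebra_simps)
      also have "\<dots> = 0" unfolding \<theta>_eq[OF that] by (simp add: wedge_def)
      finally show ?thesis using N by simp
    qed
    show "poly (slope_coeff0 j f a) (t i z) + p z * poly (slope_coeff1 j f a b) (t i z)
        + (p z)\<^sup>2 * poly (slope_coeff2 j f b) (t i z) = 0" if "i < d" "z \<in> V" for i z
    proof -
      have "t i z \<in> {x. poly (H (p z)) x = 0}"
        using that by (subst H_props(3)[OF that(2), symmetric]) (auto simp: S_def)
      then show ?thesis unfolding H_eq by simp
    qed
    show "poly (pderiv (slope_coeff0 j f a)) (t i z) + p z * poly (pderiv (slope_coeff1 j f a b)) (t i z)
        + (p z)\<^sup>2 * poly (pderiv (slope_coeff2 j f b)) (t i z) \<noteq> 0" if "i < d" "z \<in> V" for i z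
      using H_props(4)[OF that(2,1)] unfolding H_eq by (simp add: pderiv_add pderiv_smult)
    \<comment> \<open>The constant is the value at \<open>z0\<close>. The line at infinity
      contributes equally at \<open>z\<close> and \<open>z0\<close>, which leaves the two traces to
      compare.\<close>
    show "(\<Sum>i<d. - (poly (slope_coeff1 j f a b) (t i z) + 2 * p z * poly (slope_coeff2 j f b) (t i z)) /
        (poly (pderiv (slope_coeff0 j f a)) (t i z) + p z * poly (pderiv (slope_coeff1 j f a b)) (t i z)
          + (p z)\<^sup>2 * poly (pderiv (slope_coeff2 j f b)) (t i z))
        * sym2 ((\<lambda>i. t i z) ` {..<d}) (p z) (t i z))
      = (\<Sum>x\<in>S z0. slope_deriv j f a b (p z0) x * sym2 (S z0) (p z0) x)" if z: "z \<in> V" for z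
    proof -
      have "(\<Sum>i<d. slope_deriv j f a b (p z) (t i z) * sym2 (S z) (p z) (t i z))
          = (\<Sum>x\<in>S z. slope_deriv j f a b (p z) x * sym2 (S z) (p z) x)"
        unfolding S_def by (subst sum.reindex[OF inj[OF z]]) simp
      also have "\<dots> = (\<Sum>x\<in>S z0. slope_deriv j f a b (p z0) x * sym2 (S z0) (p z0) x)"
        unfolding sum_slope_deriv[OF dR[unfolded R_def] S(3,1,2)[OF z]]
          sum_slope_deriv[OF dR[unfolded R_def] S(3,1,2)[OF z0V]]
      proof (intro arg_cong2[of _ _ _ _ "(+)"] refl)
        show "slope_trace a b {t. poly ((a + smult (p z) b) * f) t = 0} (p z)
          = slope_trace a b {t. poly ((a + smult (p z0) b) * f) t = 0} (p z0)"
          by (rule slope_trace_const[OF n a b J cop crit inv refl _ card(2)[OF z z z] refl _ card(2)[OF z0V z0V z0V]])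
            (use S(3)[OF z] S(3)[OF z0V] in \<open>auto simp: mult.commute\<close>)
      qed
      finally show ?thesis unfolding slope_deriv_def S_def .
    qed
  qed
qed

lemma contact_point_radial_change:
  "contact_point (radial_change_inv c ** N) \<theta> z = radial_change_inv c *v contact_point N \<theta> z"
  unfolding contact_point_def line_base_def line_dir_def matrix_vector_mul_assoc[symmetric]
  by (simp add: matrix_vector_mult_diff_distrib vector_scalar_commute)

lemma line_coord_radial_change:
  "line_coord (radial_change_inv c ** N) z $ 1 = - line_coord N z $ 2"
  "line_coord (radial_change_inv c ** N) z $ 2 = - (line_coord N z $ 1 + c * line_coord N z $ 2)"
  "line_coord (radial_change_inv c ** N) z $ 3 = - line_coord N z $ 3"
  unfolding line_coord_nth line_base_def line_dir_def matrix_vector_mul_assoc[symmetric]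
  by (simp_all add: radial_change_inv_mult algebra_simps)

lemma det_radial_change_inv: "det (radial_change_inv c) = -1"
  by (simp add: det_3 radial_change_inv_def)

text \<open>A change of the radial coordinate \<open>y / x\<close> makes its value at infinity avoid the tangent lines through
  the origin, the critical points of the Gauss map and the directions relevant at one given line.\<close>

lemma generic_radial_change:
  fixes M :: "complex^3^3"
  assumes W: "foliation n W" and n: "n \<ge> 1" and M: "homogeneous_chart M F W"
    and B: "finite B"
  obtains c a b where "c \<notin> B" "degree a \<le> n" "degree b = n" "\<And>x. \<not> (poly a x = 0 \<and> poly b x = 0)"
    "wron a b \<noteq> 0" "degree (wron a b) = 2 * n - 2"
    "\<And>v. v$1 \<noteq> 0 \<Longrightarrow> pullback (M ** radial_change c) W v $ 1 = v$3 * (v$1) ^ n * poly a (v$2 / v$1)"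
    "\<And>v. v$1 \<noteq> 0 \<Longrightarrow> pullback (M ** radial_change c) W v $ 2 = v$3 * (v$1) ^ n * poly b (v$2 / v$1)"
    "\<And>v. v$1 \<noteq> 0 \<Longrightarrow> pullback (M ** radial_change c) W v $ 3 = - ((v$1) ^ (n + 1)) * poly (tangent_cone a b) (v$2 / v$1)"
proof -
  obtain a1 b1 where ab1: "degree a1 \<le> n" "degree b1 \<le> n" "\<And>c. \<not> (poly a1 c = 0 \<and> poly b1 c = 0)"
    "tangent_cone a1 b1 \<noteq> 0" "wron a1 b1 \<noteq> 0"
    "\<And>v. v$1 \<noteq> 0 \<Longrightarrow> pullback M W v $ 1 = v$3 * (v$1) ^ n * poly a1 (v$2 / v$1)"
    "\<And>v. v$1 \<noteq> 0 \<Longrightarrow> pullback M W v $ 2 = v$3 * (v$1) ^ n * poly b1 (v$2 / v$1)"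
    "\<And>v. v$1 \<noteq> 0 \<Longrightarrow> pullback M W v $ 3 = - ((v$1) ^ (n + 1)) * poly (tangent_cone a1 b1) (v$2 / v$1)"
    by (rule homogeneous_chart_foliation[OF W n M], rule that)
  have "finite (B \<union> {c. poly (tangent_cone a1 b1) c = 0} \<union> {c. poly (wron a1 b1) c = 0})"
    using B ab1(4,5) by (simp add: poly_roots_finite)
  from ex_new_if_finite[OF infinite_UNIV_char_0 this]
  obtain c where c: "c \<notin> B" "poly (tangent_cone a1 b1) c \<noteq> 0" "poly (wron a1 b1) c \<noteq> 0"
    by auto
  obtain a2 b2 where ab2: "degree a2 \<le> n" "degree b2 \<le> n" "\<And>c. \<not> (poly a2 c = 0 \<and> poly b2 c = 0)"
    "tangent_cone a2 b2 \<noteq> 0" "wron a2 b2 \<noteq> 0"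
    "\<And>v. v$1 \<noteq> 0 \<Longrightarrow> pullback (M ** radial_change c) W v $ 1 = v$3 * (v$1) ^ n * poly a2 (v$2 / v$1)"
    "\<And>v. v$1 \<noteq> 0 \<Longrightarrow> pullback (M ** radial_change c) W v $ 2 = v$3 * (v$1) ^ n * poly b2 (v$2 / v$1)"
    "\<And>v. v$1 \<noteq> 0 \<Longrightarrow> pullback (M ** radial_change c) W v $ 3 = - ((v$1) ^ (n + 1)) * poly (tangent_cone a2 b2) (v$2 / v$1)"
    by (rule homogeneous_chart_foliation[OF W n homogeneous_chart_radial_change[OF M, of c]], rule that)
  \<comment> \<open>The change of chart sends the coefficients \<open>(a1, b1)\<close> to
    \<open>(b1, a1 + c b1)\<close>, taken at the old slope \<open>c + s\<close> with
    \<open>s = 1 / t\<close>.\<close>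
  define A B' where "A = pcompose b1 [:c, 1:]" and "B' = pcompose (a1 + smult c b1) [:c, 1:]"
  have at: "poly a2 t = t ^ n * poly A (1 / t)" "poly b2 t = t ^ n * poly B' (1 / t)" if t: "t \<noteq> 0" for t
  proof -
    define v :: "complex^3" where "v = vector [1, t, 1]"
    have cv: "radial_change c *v v = vector [t, 1 + c * t, 1]" by (simp add: radial_change_mult v_def)
    have s: "(1 + c * t) / t = c + 1 / t" using t by (simp add: field_simps)
    show "poly a2 t = t ^ n * poly A (1 / t)"
      using ab2(6)[of v] ab1(7)[of "vector [t, 1 + c * t, 1]"] t
      unfolding pullback_radial_change cv by (simp add: v_def radial_change_mult A_def poly_pcompose s)
    show "poly b2 t = t ^ n * poly B' (1 / t)"
      using ab2(7)[of v] ab1(6,7)[of "vector [t, 1 + c * t, 1]"] t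
      unfolding pullback_radial_change cv
      by (simp add: v_def radial_change_mult B'_def poly_pcompose s algebra_simps)
  qed
  \<comment> \<open>Coefficients of maximal degree are values at the old slope \<open>c\<close>,
    where the tangent cone and the Wronskian do not vanish.\<close>
  have "coeff b2 n = poly B' 0" by (rule reflection(2)[OF at(2)])
  also have "\<dots> = poly (tangent_cone a1 b1) c" by (simp add: B'_def poly_pcompose tangent_cone_def)
  finally have "degree b2 = n" using c(2) ab2(2) by (metis le_antisym le_degree)
  have "wron A B' = - pcompose (wron a1 b1) [:c, 1:]"
    by (rule poly_ext) (simp add: A_def B'_def wron_def poly_pcompose pderiv_pcompose pderiv_pCons
        pderiv_add pderiv_smult algebra_simps)
  then have "poly (wron a2 b2) t = t ^ (2 * n - 2) * poly (pcompose (wron a1 b1) [:c, 1:]) (1 / t)"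
    if "t \<noteq> 0" for t
    using wron_reflection[OF n at that] by simp
  from reflection[OF this]
  have "degree (wron a2 b2) \<le> 2 * n - 2" "coeff (wron a2 b2) (2 * n - 2) = poly (wron a1 b1) c"
    by (simp_all add: poly_pcompose)
  then have "degree (wron a2 b2) = 2 * n - 2" using c(3) by (metis le_antisym le_degree)
  then show ?thesis
    using that[of c a2 b2] c(1) ab2 \<open>degree b2 = n\<close> by blast
qed

theorem mainTheorem2:
  fixes k d :: nat and F :: poly3 and W :: "poly3^3"
  assumes "prefoliation k d F W"
    and "d \<ge> 1" and "k < d"
    and "homogeneous_prefoliation F W"
    and "convex_prefoliation F W"
  shows "flat_dual_web d F W"
  unfolding flat_dual_web_def flat_web_def
proof (intro allI impI)
  fix M' :: "complex^3^3" and z0 :: "complex \<times> complex"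
  assume M': "invertible M'" and "regular_web_at d (Leg M' F W) z0"
  then obtain U \<theta> where z0: "z0 \<in> U" and dec: "decomposes d (Leg M' F W) U \<theta>"
    unfolding regular_web_at_def by blast
  show "web_curvature_at d (Leg M' F W) z0 0"
  proof (cases "d \<ge> 3")
    case False
    \<comment> \<open>A web of at most two foliations has no 3-subwebs, and its curvature is an
      empty sum.\<close>
    then have no_triple: "(i < j \<and> j < l \<and> l < d) = False" for i j l :: nat by auto
    have no_triples: "{(i :: nat, j :: nat, l :: nat). False} = {}" by auto
    show ?thesis
      unfolding web_curvature_at_def no_triple no_triples using z0 dec
      by (intro exI[of _ U] exI[of _ \<theta>] exI[of _ "\<lambda>_ _ _ _. 0"]) simp
  next
    case d3: True
    define n where "n = d - k"
    have n: "n \<ge> 1" using assms(3) by (simp add: n_def)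
    have W: "foliation n W" and Fh: "homogeneous3 k F"
      using assms(1) by (auto simp: prefoliation_def reduced_curve_def n_def)
    have conv: "convex_foliation W" and inv_curve: "invariant_curve W F"
      using assms(5) by (auto simp: convex_prefoliation_def)
    obtain M0 where M0: "homogeneous_chart M0 F W"
      using assms(4) unfolding homogeneous_prefoliation_iff by blast
    define g h where "g i = fst (\<theta> i z0)" and "h i = snd (\<theta> i z0)" for i
    have gh: "(g i, h i) \<noteq> 0" if "i < d" for i
      using dec z0 that unfolding decomposes_def g_def h_def by simp
    have wedge: "g i * h j - h i * g j \<noteq> 0" if "i < d" "j < d" "i \<noteq> j" for i j
      using dec z0 that unfolding decomposes_def wedge_def g_def h_def by blast
    have Leg: "Leg M' F W z0 x = (\<Prod>i<d. g i + h i * x)" for x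
      using dec z0 unfolding decomposes_def g_def h_def by blast
    have F_nz: "\<exists>w. eval3 F w \<noteq> 0"
    proof (rule ccontr)
      assume "\<not> ?thesis"
      then have "Leg M' F W z0 x = 0" for x by (simp add: Leg_def split_def Let_def)
      then have "poly (\<Prod>i<d. [:g i, h i:]) x = 0" for x using Leg[of x] by (simp add: poly_prod mult.commute)
      then have "(\<Prod>i<d. [:g i, h i:]) = 0"
        unfolding poly_all_0_iff_0[symmetric] by blast
      then show False using gh by (auto simp: zero_prod_def)
    qed
    have inv_chart: "invertible M" if "homogeneous_chart M F W" for M
      using that by (simp add: homogeneous_chart_def)
    have split: "\<exists>N. M' = M ** N \<and> det N \<noteq> 0" if M: "homogeneous_chart M F W" for M
    proof -
      obtain L where L: "M ** L = mat 1" "L ** M = mat 1"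
        using inv_chart[OF M] unfolding invertible_def by blast
      have "M' = M ** (L ** M')" by (simp add: matrix_mul_assoc L)
      moreover have "det (L ** M') \<noteq> 0"
        using L(1) M' unfolding invertible_det_nz det_mul by (metis det_I det_mul mult_eq_0_iff zero_neq_one)
      ultimately show ?thesis by blast
    qed
    have curve: "\<exists>e f. e \<le> k \<and> degree f \<le> e \<and> f \<noteq> 0 \<and>
        (\<forall>v. v$1 \<noteq> 0 \<longrightarrow> eval3 F (M *v v) = (v$3) ^ (k - e) * (v$1) ^ e * poly f (v$2 / v$1))"
      if M: "homogeneous_chart M F W" for M
    proof -
      have form: "form3 k (\<lambda>v. eval3 F (M *v v))" by (rule form3_linear[OF form3_eval3[OF Fh]])
      obtain L where L: "M ** L = mat 1" using inv_chart[OF M] unfolding invertible_def by blast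
      obtain w where w: "eval3 F w \<noteq> 0" using F_nz by blast
      have v0: "eval3 F (M *v (L *v w)) \<noteq> 0"
        using w by (simp only: matrix_vector_mul_assoc L matrix_vector_mul_lid not_False_eq_True)
      obtain e f where ef: "e \<le> k" "degree f \<le> e"
        "\<And>v. v$1 \<noteq> 0 \<Longrightarrow> eval3 F (M *v v) = (v$3) ^ (k - e) * (v$1) ^ e * poly f (v$2 / v$1)"
        using homogeneous_chart_curve[OF Fh M v0] by blast
      have "f \<noteq> 0"
      proof
        assume f0: "f = 0"
        have "eval3 F (M *v v) = 0" for v
        proof (cases "v$1 = 0")
          case True
          show ?thesis
            by (rule form3_zero_extend[OF form, of _ "vector [1, 0, 0]"]) (simp add: ef(3) f0 True)
        qed (simp add: ef(3) f0)
        with v0 show False by blast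
      qed
      with ef show ?thesis by blast
    qed
    have nondeg_chart: "line_coord N z0 $ 3 \<noteq> 0 \<and> (line_coord N z0 $ 1 \<noteq> 0 \<or> line_coord N z0 $ 2 \<noteq> 0)"
      if M: "homogeneous_chart M F W" and MN: "M' = M ** N"
        and gen: "line_base N z0 $ 1 \<noteq> 0 \<or> line_dir N z0 $ 1 \<noteq> 0" for M N
    proof -
      obtain a b where "degree a \<le> n" "degree b \<le> n" "\<And>c. \<not> (poly a c = 0 \<and> poly b c = 0)"
        "tangent_cone a b \<noteq> 0" "wron a b \<noteq> 0" and ab: "\<And>v. v$1 \<noteq> 0 \<Longrightarrow> pullback M W v $ 1 = v$3 * (v$1) ^ n * poly a (v$2 / v$1)"
        "\<And>v. v$1 \<noteq> 0 \<Longrightarrow> pullback M W v $ 2 = v$3 * (v$1) ^ n * poly b (v$2 / v$1)"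
        "\<And>v. v$1 \<noteq> 0 \<Longrightarrow> pullback M W v $ 3 = - ((v$1) ^ (n + 1)) * poly (tangent_cone a b) (v$2 / v$1)"
        by (rule homogeneous_chart_foliation[OF W n M], rule that)
      obtain e f where ef: "e \<le> k"
        "\<And>v. v$1 \<noteq> 0 \<Longrightarrow> eval3 F (M *v v) = (v$3) ^ (k - e) * (v$1) ^ e * poly f (v$2 / v$1)"
        using curve[OF M] by blast
      have d: "d = (k - e) + e + n" using ef(1) assms(3) by (simp add: n_def)
      note nd = regular_line_nondegenerate[OF ab ef(2) d d3 gh wedge Leg[unfolded MN] gen]
      show ?thesis by (rule conjI[OF nd(1) nd(2)])
    qed
    \<comment> \<open>If the line \<open>z0\<close> is the axis on which the slope is undefined,
      \<open>radial_change 0\<close> exchanges the first two coordinates.\<close>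
    obtain M1 N1 where M1: "homogeneous_chart M1 F W" "M' = M1 ** N1" "det N1 \<noteq> 0"
        and nondeg: "line_coord N1 z0 $ 3 \<noteq> 0" "line_coord N1 z0 $ 1 \<noteq> 0 \<or> line_coord N1 z0 $ 2 \<noteq> 0"
    proof -
      obtain N0 where N0: "M' = M0 ** N0" "det N0 \<noteq> 0" using split[OF M0] by blast
      show ?thesis
      proof (cases "line_base N0 z0 $ 1 \<noteq> 0 \<or> line_dir N0 z0 $ 1 \<noteq> 0")
        case True
        then show ?thesis using that[OF M0 N0] nondeg_chart[OF M0 N0(1)] by blast
      next
        case False
        define N1 where "N1 = radial_change_inv 0 ** N0"
        have MN: "M' = (M0 ** radial_change 0) ** N1"
          unfolding N1_def N0(1)
          by (metis matrix_mul_assoc matrix_mul_rid radial_change_inverse(1))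
        have dN: "det N1 \<noteq> 0"
          using N0(2) det_radial_change_inv[of 0] by (simp add: N1_def det_mul)
        have "line_base N1 z0 $ 1 = line_base N0 z0 $ 2" "line_dir N1 z0 $ 1 = line_dir N0 z0 $ 2"
          unfolding N1_def line_base_def line_dir_def matrix_vector_mul_assoc[symmetric]
          by (simp_all add: radial_change_inv_mult)
        moreover have "line_base N0 z0 $ 2 \<noteq> 0 \<or> line_dir N0 z0 $ 2 \<noteq> 0"
        proof (rule ccontr)
          assume neg: "\<not> ?thesis"
          have z: "N0$1$3 = snd z0 * N0$1$2" "N0$1$1 = - fst z0 * N0$1$2"
            "N0$2$3 = snd z0 * N0$2$2" "N0$2$1 = - fst z0 * N0$2$2"
            using neg False unfolding line_nth by (auto simp: eq_neg_iff_add_eq_0)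
          have "det N0 = 0" unfolding det_3 z by (simp add: algebra_simps)
          then show False using N0(2) by blast
        qed
        ultimately have "line_base N1 z0 $ 1 \<noteq> 0 \<or> line_dir N1 z0 $ 1 \<noteq> 0" by simp
        then show ?thesis
          using that[OF homogeneous_chart_radial_change[OF M0] MN dN]
            nondeg_chart[OF homogeneous_chart_radial_change[OF M0] MN] by blast
      qed
    qed
    define Y where "Y i = contact_point N1 (\<theta> i z0) z0" for i
    \<comment> \<open>The values of \<open>c\<close> for which the new slope would be infinite where
      the line \<open>z0\<close> meets the line at infinity, or at one of its contact
      points.\<close>
    define B where "B = {c. line_coord N1 z0 $ 1 + c * line_coord N1 z0 $ 2 = 0} \<union>
      (\<Union>i<d. {c. Y i $ 2 + c * (- Y i $ 1) = 0})"
    have fin_lin: "finite {c. u + c * v = 0}" if "u \<noteq> 0 \<or> v \<noteq> 0" for u v :: complex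
    proof -
      have "finite {c. poly [:u, v:] c = 0}" using that by (intro poly_roots_finite) auto
      then show ?thesis by simp
    qed
    \<comment> \<open>A contact point lies on the line \<open>z0\<close>, which avoids the origin
      because its third coordinate is nonzero.\<close>
    have Y_nz: "Y i $ 2 \<noteq> 0 \<or> - Y i $ 1 \<noteq> 0" if i: "i < d" for i
    proof (rule ccontr)
      assume "\<not> ?thesis"
      then have "h i * line_base N1 z0 $ 1 = g i * line_dir N1 z0 $ 1"
        "h i * line_base N1 z0 $ 2 = g i * line_dir N1 z0 $ 2"
        by (auto simp: Y_def contact_point_def g_def h_def)
      then have "h i * line_coord N1 z0 $ 3 = 0" "g i * line_coord N1 z0 $ 3 = 0"
        unfolding line_coord_nth by algebra+
      then show False using nondeg(1) gh[OF i] by (simp add: zero_prod_def)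
    qed
    have "finite B"
      unfolding B_def using fin_lin nondeg(2) Y_nz by blast
    obtain c a b where c: "c \<notin> B" and ab: "degree a \<le> n" "degree b = n" "\<And>x. \<not> (poly a x = 0 \<and> poly b x = 0)"
      "wron a b \<noteq> 0" "degree (wron a b) = 2 * n - 2"
      and Wab: "\<And>v. v$1 \<noteq> 0 \<Longrightarrow> pullback (M1 ** radial_change c) W v $ 1 = v$3 * (v$1) ^ n * poly a (v$2 / v$1)"
      "\<And>v. v$1 \<noteq> 0 \<Longrightarrow> pullback (M1 ** radial_change c) W v $ 2 = v$3 * (v$1) ^ n * poly b (v$2 / v$1)"
      "\<And>v. v$1 \<noteq> 0 \<Longrightarrow> pullback (M1 ** radial_change c) W v $ 3 = - ((v$1) ^ (n + 1)) * poly (tangent_cone a b) (v$2 / v$1)"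
      by (rule generic_radial_change[OF W n M1(1) \<open>finite B\<close>], rule that)
    define M N where "M = M1 ** radial_change c" and "N = radial_change_inv c ** N1"
    have M: "homogeneous_chart M F W"
      unfolding M_def by (rule homogeneous_chart_radial_change[OF M1(1)])
    have MN: "M' = M ** N"
      unfolding M_def N_def M1(2) by (metis matrix_mul_assoc matrix_mul_rid radial_change_inverse(1))
    have dN: "det N \<noteq> 0" using M1(3) det_radial_change_inv[of c] by (simp add: N_def det_mul)
    note Wab = Wab[folded M_def]
    obtain e f where ef: "e \<le> k" "degree f \<le> e" "f \<noteq> 0"
      "\<And>v. v$1 \<noteq> 0 \<Longrightarrow> eval3 F (M *v v) = (v$3) ^ (k - e) * (v$1) ^ e * poly f (v$2 / v$1)"
      using curve[OF M] by blast
    have d: "d = (k - e) + e + n" using ef(1) assms(3) by (simp add: n_def)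
    have crit: "poly (tangent_cone a b) x = 0" if "poly (wron a b) x = 0" for x
      by (rule convex_imp_critical_fixed[OF conv inv_chart[OF M] Wab ab(4) that])
    have fixed: "poly (tangent_cone a b) x = 0" if "poly f x = 0" for x
      by (rule invariant_imp_fixed[OF inv_curve inv_chart[OF M] Wab ef(4) ef(3) that])
    have m: "line_coord N z0 $ 2 \<noteq> 0" "line_coord N z0 $ 3 \<noteq> 0"
      using c nondeg(1) unfolding N_def line_coord_radial_change neg_equal_0_iff_equal B_def by blast+
    have Ync: "contact_point N (\<theta> i z0) z0 $ 1 \<noteq> 0" if "i < d" for i
      using c that unfolding N_def contact_point_radial_change radial_change_inv_mult B_def
      by (auto simp: Y_def)
    show ?thesis
      unfolding MN
      by (rule flat_at_generic_chart[OF Wab ef(4) n ab(1,2) ef(2) ab(4,5,3) crit fixed d d3 dN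
            dec[unfolded MN] z0 m Ync])
  qed
qed

end
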